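(* (a) For every flexible graphon property $\mathcal R\subseteq\mathcal W_0$, the maximum of $d_1(\cdot,\mathcal R)$ over $\mathcal W_0$ is attained by a constant function. (b) For every flexible and robust graph property $\mathcal P$ there is a number $p$, $0\le p\le1$, such that for every graph $G$ with $|V(G)|=n$, \[ d_1(G,\mathcal P)\le \mathbb E\bigl(d_1(\mathbb G(n,p),\mathcal P)\bigr)+o(1)\qquad(n\to\infty), \] where the $o(1)$ term depends only on $n$ (and $\mathcal P$), not on $G$.
   Context: Graphs are finite and simple; a graph property is a class of graphs invariant under isomorphism. $\mathbb G(n,p)$ is the random graph on $n$ nodes in which each pair is an edge independently with probability $p$. $\mathcal W_0$ is the set of symmetric measurable functions $W:[0,1]^2\to[0,1]$. For a graph $F$ on $[k]$, $t(F,W)=\int_{[0,1]^k}\prod_{ij\in E(F)}W(x_i,x_j)\,dx$, and $t(F,G)$ is the probability that a uniformly random map $V(F)\to V(G)$ preserves adjacency. Functions $W_1,W_2\in\mathcal W_0$ are isomorphic if $t(F,W_1)=t(F,W_2)$ for every graph $F$. A function property is a subset of $\mathcal W_0$; a graphon property is a function property invariant under isomorphism. $d_1(U,W)=\int_{[0,1]^2}|U-W|$, and $d_1(W,\mathcal R)=\inf_{U\in\mathcal R}d_1(W,U)$. Flexibility: $U\in\mathcal W_0$ is a flexing of $W\in\mathcal W_0$ if $U(x,y)=W(x,y)$ for all $x,y$ with $W(x,y)\in\{0,1\}$. A function property is flexible if it contains every flexing of each of its members. The closure $\overline{\mathcal P}\subseteq\mathcal W_0$ of a graph property $\mathcal P$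 is the set of all $W\in\mathcal W_0$ for which there are $G_n\in\mathcal P$ with $|V(G_n)|\to\infty$ and $t(F,G_n)\to t(F,W)$ for every graph $F$. A graph property is flexible if its closure is flexible. Robustness: for graphs $G_1,G_2$ on the same node set $V$, $d_1(G_1,G_2)=|E(G_1)\triangle E(G_2)|/|V|^2$; $d_1(G,\mathcal P)$ is the minimum of $d_1(G,H)$ over $H\in\mathcal P$ with $V(H)=V(G)$ ($\infty$ if there is none). For $G$ on $\{1,\dots,n\}$, $W_G(x,y)=1$ if $x\in((i-1)/n,i/n]$, $y\in((j-1)/n,j/n]$ with $ij\in E(G)$, and $0$ otherwise. $\mathcal P$ is robust if for every $\varepsilon>0$ there are $n(\varepsilon)>0$ and $\varepsilon'>0$ such that if $|V(G)|\ge n(\varepsilon)$ and $d_1(W_G,\overline{\mathcal P})\le\varepsilon'$, then $d_1(G,\mathcal P)\le\varepsilon$. *)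

theory Defs
  imports "HOL-Analysis.Analysis" "HOL-Probability.Probability"
begin

section \<open>Graphs and graph properties\<close>

(* Node sets are finite sets of natural numbers; every finite graph has an isomorphic copy
   of this form. *)
type_synonym graph = "nat set \<times> nat set set"

abbreviation verts :: "graph \<Rightarrow> nat set" where "verts \<equiv> fst"
abbreviation edges :: "graph \<Rightarrow> nat set set" where "edges \<equiv> snd"

definition all_pairs :: "nat set \<Rightarrow> nat set set" where
  "all_pairs V = {e. e \<subseteq> V \<and> card e = 2}"

definition simple_graph :: "graph \<Rightarrow> bool" where
  "simple_graph G \<longleftrightarrow> finite (verts G) \<and> edges G \<subseteq> all_pairs (verts G)"

definition graph_iso :: "graph \<Rightarrow> graph \<Rightarrow> bool" where
  "graph_iso G H \<longleftrightarrow>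
     (\<exists>f. bij_betw f (verts G) (verts H) \<and> edges H = (\<lambda>e. f ` e) ` edges G)"

definition graph_property :: "graph set \<Rightarrow> bool" where
  "graph_property P \<longleftrightarrow>
     (\<forall>G\<in>P. simple_graph G) \<and>
     (\<forall>G\<in>P. \<forall>H. simple_graph H \<and> graph_iso G H \<longrightarrow> H \<in> P)"

definition random_graph :: "nat \<Rightarrow> real \<Rightarrow> graph pmf" where
  "random_graph n p =
     map_pmf (\<lambda>f. ({1..n}, {e \<in> all_pairs {1..n}. f e}))
       (Pi_pmf (all_pairs {1..n}) False (\<lambda>_. bernoulli_pmf p))"

section \<open>Functions on the unit square\<close>

(* Measurable means Lebesgue measurable. An element of W0 represents its restriction to the
   unit square: values outside the square are unconstrained, and no notion below refers to them. *)
definition W0 :: "(real \<Rightarrow> real \<Rightarrow> real) set" where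
  "W0 = {W. (\<lambda>(x, y). W x y) \<in> borel_measurable (lebesgue_on ({0..1} \<times> {0..1})) \<and>
            (\<forall>x\<in>{0..1}. \<forall>y\<in>{0..1}. W x y = W y x \<and> 0 \<le> W x y \<and> W x y \<le> 1)}"

(* The completed product is Lebesgue measure on the cube indexed by the nodes of F; the completion
   is needed because W is only Lebesgue measurable. Restricting to i < j counts every edge once. *)
definition t_fun :: "graph \<Rightarrow> (real \<Rightarrow> real \<Rightarrow> real) \<Rightarrow> real" where
  "t_fun F W =
     (LINT x | completion (Pi\<^sub>M (verts F) (\<lambda>_. restrict_space lborel {0..1})).
        (\<Prod>(i, j) \<in> {(i, j). i < j \<and> {i, j} \<in> edges F}. W (x i) (x j)))"

definition t_graph :: "graph \<Rightarrow> graph \<Rightarrow> real" where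
  "t_graph F G =
     real (card {\<phi> \<in> verts F \<rightarrow>\<^sub>E verts G. \<forall>e\<in>edges F. \<phi> ` e \<in> edges G}) /
     real (card (verts F \<rightarrow>\<^sub>E verts G))"

definition isomorphic_fun :: "(real \<Rightarrow> real \<Rightarrow> real) \<Rightarrow> (real \<Rightarrow> real \<Rightarrow> real) \<Rightarrow> bool" where
  "isomorphic_fun W1 W2 \<longleftrightarrow> (\<forall>F. simple_graph F \<longrightarrow> t_fun F W1 = t_fun F W2)"

definition graphon_property :: "(real \<Rightarrow> real \<Rightarrow> real) set \<Rightarrow> bool" where
  "graphon_property R \<longleftrightarrow>
     R \<subseteq> W0 \<and> (\<forall>W\<in>R. \<forall>U\<in>W0. isomorphic_fun U W \<longrightarrow> U \<in> R)"

definition d1_fun :: "(real \<Rightarrow> real \<Rightarrow> real) \<Rightarrow> (real \<Rightarrow> real \<Rightarrow> real) \<Rightarrow> real" where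
  "d1_fun U W = (LINT (x, y) | lebesgue_on ({0..1} \<times> {0..1}). \<bar>U x y - W x y\<bar>)"

(* Infimum in ennreal: the distance to the empty set is infinite. *)
definition d1_fun_set :: "(real \<Rightarrow> real \<Rightarrow> real) \<Rightarrow> (real \<Rightarrow> real \<Rightarrow> real) set \<Rightarrow> ennreal" where
  "d1_fun_set W R = (INF U\<in>R. ennreal (d1_fun W U))"

section \<open>Flexibility\<close>

definition flexing :: "(real \<Rightarrow> real \<Rightarrow> real) \<Rightarrow> (real \<Rightarrow> real \<Rightarrow> real) \<Rightarrow> bool" where
  "flexing U W \<longleftrightarrow>
     U \<in> W0 \<and> W \<in> W0 \<and>
     (\<forall>x\<in>{0..1}. \<forall>y\<in>{0..1}. W x y \<in> {0, 1} \<longrightarrow> U x y = W x y)"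

definition flexible_fun_property :: "(real \<Rightarrow> real \<Rightarrow> real) set \<Rightarrow> bool" where
  "flexible_fun_property R \<longleftrightarrow> (\<forall>W\<in>R. \<forall>U. flexing U W \<longrightarrow> U \<in> R)"

definition graph_closure :: "graph set \<Rightarrow> (real \<Rightarrow> real \<Rightarrow> real) set" where
  "graph_closure P =
     {W \<in> W0. \<exists>G :: nat \<Rightarrow> graph. (\<forall>n. G n \<in> P) \<and>
        filterlim (\<lambda>n. card (verts (G n))) at_top sequentially \<and>
        (\<forall>F. simple_graph F \<longrightarrow> (\<lambda>n. t_graph F (G n)) \<longlonglongrightarrow> t_fun F W)}"

definition flexible_graph_property :: "graph set \<Rightarrow> bool" where
  "flexible_graph_property P \<longleftrightarrow> flexible_fun_property (graph_closure P)"

section \<open>Robustness\<close>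

(* Used only for graphs on the same node set. *)
definition d1_graph :: "graph \<Rightarrow> graph \<Rightarrow> real" where
  "d1_graph G H = real (card (sym_diff (edges G) (edges H))) / (real (card (verts G)))\<^sup>2"

(* The infimum is over a finite set, hence a minimum, and it is infinite if that set is empty. *)
definition d1_graph_set :: "graph \<Rightarrow> graph set \<Rightarrow> ennreal" where
  "d1_graph_set G P = (INF H \<in> {H \<in> P. verts H = verts G}. ennreal (d1_graph G H))"

(* For graphs with node set {1..n}. *)
definition W_graph :: "graph \<Rightarrow> real \<Rightarrow> real \<Rightarrow> real" where
  "W_graph G x y =
     (let n = real (card (verts G)) in
      if \<exists>i j. {i, j} \<in> edges G \<and>
               x \<in> {(real i - 1) / n <.. real i / n} \<and> y \<in> {(real j - 1) / n <.. real j / n}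
      then 1 else 0)"

(* It suffices to consider graphs on {1..n}: for a graph property P, the closure and the distance
   to P are invariant under relabelling the nodes. *)
definition robust :: "graph set \<Rightarrow> bool" where
  "robust P \<longleftrightarrow>
     (\<forall>\<epsilon>>0::real. \<exists>N>0::nat. \<exists>\<epsilon>'>0::real. \<forall>n\<ge>N. \<forall>G.
        simple_graph G \<and> verts G = {1..n} \<and>
        d1_fun_set (W_graph G) (graph_closure P) \<le> ennreal \<epsilon>' \<longrightarrow>
        d1_graph_set G P \<le> ennreal \<epsilon>)"

end

theory Submission
  imports Defs "HOL-Library.Diagonal_Subsequence" "HOL-Combinatorics.Permutations" "HOL-Real_Asymp.Real_Asymp"
begin

text \<open>Let \<open>L U W\<close> be the integral of \<open>W\<close> over \<open>{U = 0}\<close> plus the integral of \<open>1 - W\<close> over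
  \<open>{U = 1}\<close> (called \<open>flex_cost\<close> below). If \<open>R\<close> is flexible and \<open>U \<in> R\<close>, then replacing \<open>U\<close> by \<open>W\<close>
  wherever \<open>U\<close> is not 0 or 1 stays in \<open>R\<close>, so the distance of \<open>W\<close> from \<open>R\<close> is the infimum of
  \<open>L U W\<close> over \<open>U \<in> R\<close>. As \<open>L U W\<close> is affine in \<open>W\<close> and \<open>R\<close> is invariant under measure preserving
  maps, averaging \<open>W\<close> over such maps shows that \<open>W\<close> is at most as far from \<open>R\<close> as the constant
  function with the same mean; the distance of constants is Lipschitz, so it has a maximum.

  For (b), take \<open>U\<close> in the closure of \<open>P\<close>. Overwriting a suitably permuted \<open>G\<close> with a step
  approximation of the sets \<open>{U = 0}\<close> and \<open>{U = 1}\<close> produces a graph close to the closure, hence to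
  \<open>P\<close> by robustness, and changes \<open>G\<close> by about \<open>L U q / 2\<close> at edge density \<open>q\<close> (the factor 1/2
  appears because the distance of graphs counts every edge once). Conversely, if graphs \<open>H\<close> in \<open>P\<close>
  were too close to random graphs of density \<open>p\<close>, compactness would provide a limit \<open>U\<close> of them in
  the closure; random graphs keep density \<open>p\<close> on \<open>{U = 0}\<close> and \<open>{U = 1}\<close>, where \<open>H\<close> has density
  0 and 1 in the limit, so the distance is at least \<open>L U p / 2\<close>.\<close>

section \<open>Lebesgue measure on the unit square\<close>

text \<open>Members of \<open>W0\<close> are only Lebesgue measurable, while Fubini and product
  measures live on the Borel sets of \<open>unit_sq\<close>. So functions are first replaced by
  Borel ones that agree almost everywhere; densities ignore null sets, so a graphon property
  contains both. Only then is flexing used, which demands equality at every point. The averaging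
  runs over permutations of n equal cells. They never mix diagonal cells with others, so the mean is
  matched only up to order 1/n. Weak convergence suffices in the lower bound because 0 and 1 are
  extreme values: limit density 0 or 1 on a set forces almost all pairs there to be non-edges or
  edges. Convergence of \<open>t_fun\<close>, needed for membership in the closure, is not weakly
  continuous and goes through the cut norm. In the upper bound \<open>U\<close> must be nearly
  optimal for the density of G, and the size from which the bound holds depends on \<open>U\<close>;
  a finite grid of densities makes it uniform in G. If the closure is empty, compactness bounds the
  sizes in P, and for large n the right-hand side is infinite.\<close>

abbreviation unit_lborel :: "real measure" where
  "unit_lborel \<equiv> restrict_space lborel {0..1}"

abbreviation unit_sq :: "(real \<times> real) measure" where
  "unit_sq \<equiv> unit_lborel \<Otimes>\<^sub>M unit_lborel"

abbreviation square :: "(real \<times> real) set" where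
  "square \<equiv> {0..1} \<times> {0..1}"

interpretation unit: prob_space unit_lborel
  by (rule prob_space_restrict_space) auto

interpretation sq: pair_prob_space unit_lborel unit_lborel ..

interpretation cube: product_prob_space "\<lambda>_::nat. unit_lborel" UNIV ..

lemma space_unit_sq: "space unit_sq = square"
  by (simp add: space_pair_measure space_restrict_space)

lemma square_borel [measurable, simp]: "square \<in> sets borel"
  by (intro closed_Times borel_closed) auto

lemma square_lebesgue [simp]: "square \<in> sets lebesgue"
  using square_borel by (simp del: square_borel)

lemma borel_measurable_unit_sq:
  "f \<in> borel_measurable borel \<Longrightarrow> f \<in> borel_measurable unit_sq"
proof -
  assume f: "f \<in> borel_measurable borel"
  have "(\<lambda>z. z) \<in> unit_sq \<rightarrow>\<^sub>M (borel \<Otimes>\<^sub>M borel)"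
    by (rule measurable_pair) (auto simp: comp_def intro!: measurable_fst'' measurable_snd'' measurable_restrict_space1)
  then have "(\<lambda>z. z) \<in> unit_sq \<rightarrow>\<^sub>M borel" by (simp add: borel_prod)
  from measurable_compose[OF this f] show ?thesis by simp
qed

lemma sets_unit_sq: "sets unit_sq = sets (restrict_space borel square)"
proof (intro equalityI subsetI)
  have fst: "fst \<in> restrict_space borel square \<rightarrow>\<^sub>M unit_lborel"
    and snd: "snd \<in> restrict_space borel square \<rightarrow>\<^sub>M unit_lborel"
    by (intro measurable_restrict_space2 measurable_restrict_space1;
        force simp: space_restrict_space borel_prod[symmetric])+
  have 1: "(\<lambda>z. z) \<in> restrict_space borel square \<rightarrow>\<^sub>M unit_sq"
    using fst snd by (intro measurable_pair) (auto simp: comp_def)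
  have 2: "(\<lambda>z. z) \<in> unit_sq \<rightarrow>\<^sub>M restrict_space borel square"
    using borel_measurable_unit_sq[of "\<lambda>z. z"]
    by (intro measurable_restrict_space2) (auto simp: space_unit_sq)
  fix A :: "(real \<times> real) set"
  { assume "A \<in> sets unit_sq"
    from measurable_sets[OF 1 this] sets.sets_into_space[OF this]
    show "A \<in> sets (restrict_space borel square)"
      by (simp add: space_restrict_space space_unit_sq Int_absorb2) }
  { assume "A \<in> sets (restrict_space borel square)"
    from measurable_sets[OF 2 this] sets.sets_into_space[OF this]
    show "A \<in> sets unit_sq"
      by (simp add: space_restrict_space space_unit_sq Int_absorb2) }
qed

lemma unit_sq_eq: "unit_sq = restrict_space lborel square"
proof (rule pair_measure_eqI)
  show "sigma_finite_measure unit_lborel" "sigma_finite_measure unit_lborel" by unfold_locales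
  show "sets unit_sq = sets (restrict_space lborel square)"
    unfolding sets_unit_sq by (rule sets_restrict_space_cong) simp
  fix A B assume "A \<in> sets unit_lborel" "B \<in> sets unit_lborel"
  then have AB: "A \<in> sets borel" "B \<in> sets borel" "A \<subseteq> {0..1}" "B \<subseteq> {0..1}"
    by (auto simp: sets_restrict_space_iff)
  then have "emeasure (restrict_space lborel square) (A \<times> B) = emeasure (lborel \<Otimes>\<^sub>M lborel) (A \<times> B)"
    by (subst emeasure_restrict_space) (auto simp: lborel_prod)
  also have "\<dots> = emeasure lborel A * emeasure lborel B"
    using AB by (subst lborel.emeasure_pair_measure_Times) auto
  also have "\<dots> = emeasure unit_lborel A * emeasure unit_lborel B"
    using AB by (auto simp: emeasure_restrict_space)
  finally show "emeasure unit_lborel A * emeasure unit_lborel B = emeasure (restrict_space lborel square) (A \<times> B)"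
    by simp
qed

lemma borel_measurable_unit_sq_iff:
  fixes f :: "real \<times> real \<Rightarrow> real"
  shows "f \<in> borel_measurable unit_sq \<longleftrightarrow> (\<lambda>z. indicator square z *\<^sub>R f z) \<in> borel_measurable borel"
  unfolding unit_sq_eq
  by (subst borel_measurable_restrict_space_iff) (auto simp: mult.commute)

lemma borel_measurable_lebesgue_square:
  fixes f :: "real \<times> real \<Rightarrow> real"
  assumes "f \<in> borel_measurable unit_sq"
  shows "f \<in> borel_measurable (lebesgue_on square)"
proof (rule borel_measurable_if_D)
  have "(\<lambda>z. if z \<in> square then f z else 0) = (\<lambda>z. indicator square z *\<^sub>R f z)"
    by (auto simp: indicator_def)
  then show "(\<lambda>z. if z \<in> square then f z else 0) \<in> borel_measurable lebesgue"
    using assms unfolding borel_measurable_unit_sq_iff by (simp add: measurable_completion)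
qed

lemma integral_lebesgue_square:
  fixes f :: "real \<times> real \<Rightarrow> real"
  assumes f: "f \<in> borel_measurable unit_sq"
  shows "integral\<^sup>L (lebesgue_on square) f = integral\<^sup>L unit_sq f"
proof -
  have "integral\<^sup>L (lebesgue_on square) f = integral\<^sup>L lebesgue (\<lambda>z. indicator square z *\<^sub>R f z)"
    by (subst integral_restrict_space) auto
  also have "\<dots> = integral\<^sup>L lborel (\<lambda>z. indicator square z *\<^sub>R f z)"
    using f unfolding borel_measurable_unit_sq_iff by (intro integral_completion) auto
  also have "\<dots> = integral\<^sup>L unit_sq f"
    unfolding unit_sq_eq by (subst integral_restrict_space) auto
  finally show ?thesis .
qed

lemma AE_lebesgue_square: "(AE z in lebesgue_on square. P z) \<longleftrightarrow> (AE z in unit_sq. P z)"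
  unfolding unit_sq_eq
  by (subst (1 2) AE_restrict_space_iff) (auto simp: AE_completion_iff)

lemma AE_unit_sq_swap:
  assumes "AE z in unit_sq. P z" shows "AE z in unit_sq. P (prod.swap z)"
proof -
  have "AE z in distr unit_sq unit_sq (\<lambda>(x, y). (y, x)). P z"
    by (subst sq.distr_pair_swap[symmetric]) (rule assms)
  then have "AE z in unit_sq. P ((\<lambda>(x, y). (y, x)) z)"
    by (rule AE_distrD[rotated]) (simp add: measurable_pair_swap')
  then show ?thesis by (simp add: case_prod_unfold prod.swap_def)
qed

text \<open>A Borel function almost everywhere equal to \<open>W\<close> need be neither symmetric
  nor bounded by 0 and 1. Symmetrising and clamping restore both properties everywhere, and change
  nothing almost everywhere because \<open>W\<close> has them.\<close>

lemma W0_borel_version: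
  assumes "W \<in> W0"
  obtains W' where "W' \<in> W0" "(\<lambda>z. W' (fst z) (snd z)) \<in> borel_measurable unit_sq"
    "AE z in unit_sq. W' (fst z) (snd z) = W (fst z) (snd z)"
proof -
  define f where "f = (\<lambda>z::real \<times> real. if z \<in> square then W (fst z) (snd z) else 0)"
  have "(\<lambda>(x, y). W x y) \<in> borel_measurable (lebesgue_on square)"
    using assms by (auto simp: W0_def)
  then have "f \<in> borel_measurable lebesgue"
    using borel_measurable_if[of square "\<lambda>z. W (fst z) (snd z)"] by (simp add: f_def case_prod_unfold)
  then obtain g where g: "g \<in> borel_measurable lborel" "AE z in lborel. f z = g z"
    using completion_ex_borel_measurable_real[of f lborel] by auto
  have g': "g \<in> borel_measurable unit_sq" using g by (intro borel_measurable_unit_sq) simp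
  have ae: "AE z in unit_sq. W (fst z) (snd z) = g z"
    using g(2) unfolding unit_sq_eq
    by (subst AE_restrict_space_iff) (auto simp: f_def)
  define W' where "W' = (\<lambda>x y. max 0 (min 1 ((g (x, y) + g (y, x)) / 2)))"
  have gs: "(\<lambda>z. g (snd z, fst z)) \<in> borel_measurable unit_sq"
    using measurable_compose[OF measurable_pair_swap' g'] by (simp add: case_prod_unfold)
  have m: "(\<lambda>z. W' (fst z) (snd z)) \<in> borel_measurable unit_sq"
    unfolding W'_def using g' gs by measurable
  have "(\<lambda>z. W' (fst z) (snd z)) \<in> borel_measurable (lebesgue_on square)"
    using m by (rule borel_measurable_lebesgue_square)
  then have "W' \<in> W0"
    by (auto simp: W0_def W'_def case_prod_unfold add.commute)
  moreover have "AE z in unit_sq. W' (fst z) (snd z) = W (fst z) (snd z)"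
    using ae AE_unit_sq_swap[OF ae] AE_space
  proof eventually_elim
    case (elim z)
    obtain x y where z: "z = (x, y)" "x \<in> {0..1}" "y \<in> {0..1}"
      using elim(3) by (cases z) (auto simp: space_unit_sq)
    have "W x y = W y x" "0 \<le> W x y" "W x y \<le> 1"
      using assms z by (auto simp: W0_def)
    then show ?case using elim(1,2) by (simp add: W'_def z(1))
  qed
  ultimately show ?thesis using m that by blast
qed

section \<open>Homomorphism densities ignore null sets\<close>

definition edge_pairs :: "graph \<Rightarrow> (nat \<times> nat) set" where
  "edge_pairs F = {(i, j). i < j \<and> {i, j} \<in> edges F}"

lemma edge_pairs_sub:
  assumes "simple_graph F" "(i, j) \<in> edge_pairs F"
  shows "i \<in> verts F" "j \<in> verts F" "i \<noteq> j"
  using assms by (auto simp: simple_graph_def edge_pairs_def all_pairs_def)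

lemma finite_edge_pairs: "simple_graph F \<Longrightarrow> finite (edge_pairs F)"
  by (rule finite_subset[of _ "verts F \<times> verts F"])
     (use edge_pairs_sub in \<open>auto simp: simple_graph_def\<close>)

text \<open>This carries statements valid almost everywhere on the square over to the single factors
  of a density. It fails for i = j, where the pair stays on the diagonal.\<close>

lemma distr_cube_pair:
  assumes "finite V" "i \<in> V" "j \<in> V" "i \<noteq> j"
  shows "distr (\<Pi>\<^sub>M _\<in>V. unit_lborel) unit_sq (\<lambda>x. (x i, x j)) = unit_sq"
proof (rule pair_measure_eqI[symmetric])
  show "sigma_finite_measure unit_lborel" "sigma_finite_measure unit_lborel" by unfold_locales
  interpret V: product_prob_space "\<lambda>_. unit_lborel" V ..
  fix A B assume AB: "A \<in> sets unit_lborel" "B \<in> sets unit_lborel"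
  have "emeasure (distr (\<Pi>\<^sub>M _\<in>V. unit_lborel) unit_sq (\<lambda>x. (x i, x j))) (A \<times> B) =
        emeasure (\<Pi>\<^sub>M _\<in>V. unit_lborel) {x \<in> space (\<Pi>\<^sub>M _\<in>V. unit_lborel). \<forall>k\<in>{i, j}. x k \<in> (if k = i then A else B)}"
    using assms AB by (subst emeasure_distr) (auto intro!: arg_cong2[where f = emeasure] split: if_splits)
  also have "\<dots> = (\<Prod>k\<in>{i, j}. emeasure unit_lborel (if k = i then A else B))"
    using assms AB by (intro V.emeasure_PiM_Collect) auto
  also have "\<dots> = emeasure unit_lborel A * emeasure unit_lborel B"
    using assms by simp
  finally show "emeasure unit_lborel A * emeasure unit_lborel B =
    emeasure (distr (\<Pi>\<^sub>M _\<in>V. unit_lborel) unit_sq (\<lambda>x. (x i, x j))) (A \<times> B)" by simp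
qed simp

lemma measurable_cube_pair:
  assumes "i \<in> V" "j \<in> V" "(\<lambda>z. W (fst z) (snd z)) \<in> borel_measurable unit_sq"
  shows "(\<lambda>x. W (x i) (x j)) \<in> borel_measurable (\<Pi>\<^sub>M _\<in>V. unit_lborel)"
proof -
  have "(\<lambda>x. (x i, x j)) \<in> (\<Pi>\<^sub>M _\<in>V. unit_lborel) \<rightarrow>\<^sub>M unit_sq"
    using assms(1,2) by simp
  from measurable_compose[OF this assms(3)] show ?thesis by simp
qed

text \<open>Only \<open>W\<close> is assumed to be Borel, so the integrand of \<open>W'\<close> is
  measurable only in the completion. The two integrands agree almost everywhere because each of the
  finitely many factors does.\<close>

lemma t_fun_borel_cong:
  assumes F: "simple_graph F" and W: "(\<lambda>z. W (fst z) (snd z)) \<in> borel_measurable unit_sq"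
    and ae: "AE z in unit_sq. W (fst z) (snd z) = W' (fst z) (snd z)"
  shows "t_fun F W' = (LINT x|(\<Pi>\<^sub>M _\<in>verts F. unit_lborel). (\<Prod>(i, j)\<in>edge_pairs F. W (x i) (x j)))"
proof -
  let ?M = "\<Pi>\<^sub>M _\<in>verts F. unit_lborel"
  let ?f = "\<lambda>W x. \<Prod>(i, j)\<in>edge_pairs F. W (x i) (x j) :: real"
  have V: "finite (verts F)" using F by (simp add: simple_graph_def)
  have fm: "?f W \<in> borel_measurable ?M"
  proof (intro borel_measurable_prod, clarify)
    fix i j assume "(i, j) \<in> edge_pairs F"
    from edge_pairs_sub(1,2)[OF F this] show "(\<lambda>x. W (x i) (x j)) \<in> borel_measurable ?M"
      by (rule measurable_cube_pair[OF _ _ W])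
  qed
  have "AE x in ?M. \<forall>(i, j)\<in>edge_pairs F. W (x i) (x j) = W' (x i) (x j)"
  proof (subst AE_ball_countable, intro countable_finite finite_edge_pairs F, clarify)
    fix i j assume ij: "(i, j) \<in> edge_pairs F"
    have "AE z in distr ?M unit_sq (\<lambda>x. (x i, x j)). W (fst z) (snd z) = W' (fst z) (snd z)"
      using ae unfolding distr_cube_pair[OF V edge_pairs_sub[OF F ij]] .
    from AE_distrD[OF _ this] show "AE x in ?M. W (x i) (x j) = W' (x i) (x j)"
      using edge_pairs_sub[OF F ij] by simp
  qed
  then have aef: "AE x in completion ?M. ?f W x = ?f W' x"
  proof (intro AE_completion, elim eventually_mono)
    fix x assume "\<forall>(i, j)\<in>edge_pairs F. W (x i) (x j) = W' (x i) (x j)"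
    then show "?f W x = ?f W' x" by (intro prod.cong) auto
  qed
  have fc: "?f W \<in> borel_measurable (completion ?M)"
    by (rule measurable_completion) (rule fm)
  \<comment> \<open>In a completion, a set that differs from a measurable set by a null set is
    measurable.\<close>
  have f'c: "?f W' \<in> borel_measurable (completion ?M)"
  proof (rule measurableI)
    fix A :: "real set" assume "A \<in> sets borel"
    with fc have A: "?f W -` A \<inter> space (completion ?M) \<in> sets (completion ?M)"
      by (rule measurable_sets)
    show "?f W' -` A \<inter> space (completion ?M) \<in> sets (completion ?M)"
    proof (rule completion.in_sets_AE[OF _ A])
      show "AE x in completion ?M. (x \<in> ?f W -` A \<inter> space (completion ?M)) = (x \<in> ?f W' -` A \<inter> space (completion ?M))"
        using aef by eventually_elim simp
    qed simp
  qed simp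
  have "t_fun F W' = integral\<^sup>L (completion ?M) (?f W')"
    by (simp add: t_fun_def edge_pairs_def)
  also have "\<dots> = integral\<^sup>L (completion ?M) (?f W)"
    by (intro integral_cong_AE fc f'c, use aef in eventually_elim) simp
  also have "\<dots> = integral\<^sup>L ?M (?f W)"
    by (rule integral_completion[OF fm])
  finally show ?thesis .
qed

section \<open>Cut decompositions of matrices\<close>

text \<open>A bound on the cut norm, not normalised by the number of entries.\<close>

definition cut_le :: "'a set \<Rightarrow> ('a \<Rightarrow> 'a \<Rightarrow> real) \<Rightarrow> real \<Rightarrow> bool" where
  "cut_le V M c \<longleftrightarrow> (\<forall>S\<subseteq>V. \<forall>T\<subseteq>V. \<bar>\<Sum>u\<in>S. \<Sum>v\<in>T. M u v\<bar> \<le> c)"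

text \<open>A linear function of weights in [0, 1] is extremal at weights 0 and 1: take the indices
  with positive coefficients or those with negative ones, according to the sign of the sum.\<close>

lemma weighted_sum_le_subset_sum:
  fixes a F :: "'a \<Rightarrow> real"
  assumes "finite V" "\<And>u. u \<in> V \<Longrightarrow> 0 \<le> F u \<and> F u \<le> 1"
  obtains S where "S \<subseteq> V" "\<bar>\<Sum>u\<in>V. F u * a u\<bar> \<le> \<bar>\<Sum>u\<in>S. a u\<bar>"
proof -
  define P where "P = {u\<in>V. a u > 0}"
  define N where "N = {u\<in>V. a u < 0}"
  have P: "(\<Sum>u\<in>V. F u * a u) \<le> (\<Sum>u\<in>P. a u)"
    unfolding P_def sum.inter_filter[OF assms(1)]
    by (intro sum_mono) (use assms(2) in \<open>auto simp: mult_le_cancel_right1 mult_nonneg_nonpos not_less\<close>)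
  have N: "(\<Sum>u\<in>V. F u * a u) \<ge> (\<Sum>u\<in>N. a u)"
    unfolding N_def sum.inter_filter[OF assms(1)]
    by (intro sum_mono) (use assms(2) in \<open>auto simp: mult_le_cancel_right2 not_less\<close>)
  show ?thesis
  proof (cases "(\<Sum>u\<in>V. F u * a u) \<ge> 0")
    case True
    then show ?thesis using P by (intro that[of P]) (auto simp: P_def)
  next
    case False
    then show ?thesis using N by (intro that[of N]) (auto simp: N_def)
  qed
qed

text \<open>The form is bilinear, so the weights can be rounded to sets on one side at a
  time.\<close>

lemma cut_le_weighted:
  assumes V: "finite V" and c: "cut_le V M c"
    and F: "\<And>u. u \<in> V \<Longrightarrow> 0 \<le> F u \<and> F u \<le> 1" and G: "\<And>u. u \<in> V \<Longrightarrow> 0 \<le> G u \<and> G u \<le> 1"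
  shows "\<bar>\<Sum>u\<in>V. \<Sum>v\<in>V. F u * G v * M u v\<bar> \<le> c"
proof -
  obtain S where S: "S \<subseteq> V" "\<bar>\<Sum>u\<in>V. F u * (\<Sum>v\<in>V. G v * M u v)\<bar> \<le> \<bar>\<Sum>u\<in>S. \<Sum>v\<in>V. G v * M u v\<bar>"
    by (rule weighted_sum_le_subset_sum[OF V F])
  obtain T where T: "T \<subseteq> V" "\<bar>\<Sum>v\<in>V. G v * (\<Sum>u\<in>S. M u v)\<bar> \<le> \<bar>\<Sum>v\<in>T. \<Sum>u\<in>S. M u v\<bar>"
    by (rule weighted_sum_le_subset_sum[OF V G])
  have "(\<Sum>u\<in>S. \<Sum>v\<in>V. G v * M u v) = (\<Sum>v\<in>V. G v * (\<Sum>u\<in>S. M u v))"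
    by (subst sum.swap) (simp add: sum_distrib_left)
  moreover have "(\<Sum>u\<in>V. \<Sum>v\<in>V. F u * G v * M u v) = (\<Sum>u\<in>V. F u * (\<Sum>v\<in>V. G v * M u v))"
    by (simp add: sum_distrib_left mult.assoc)
  moreover have "\<bar>\<Sum>v\<in>T. \<Sum>u\<in>S. M u v\<bar> \<le> c"
    using c S(1) T(1) unfolding cut_le_def by (subst sum.swap) blast
  ultimately show ?thesis using S(2) T(2) by linarith
qed

text \<open>The step of the weak regularity lemma of Frieze and Kannan: subtracting a rectangle that
  witnesses a large cut norm lowers the energy.\<close>

lemma energy_decrement:
  fixes R :: "'a \<Rightarrow> 'a \<Rightarrow> real"
  assumes V: "finite V" "V \<noteq> {}" and ST: "S \<subseteq> V" "T \<subseteq> V"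
    and d: "d = (\<Sum>u\<in>S. \<Sum>v\<in>T. R u v) / (real (card V))\<^sup>2"
  shows "(\<Sum>u\<in>V. \<Sum>v\<in>V. (R u v - d * of_bool (u \<in> S) * of_bool (v \<in> T))\<^sup>2) \<le>
    (\<Sum>u\<in>V. \<Sum>v\<in>V. (R u v)\<^sup>2) - d\<^sup>2 * (real (card V))\<^sup>2"
proof -
  have n: "real (card V) > 0" using V by (simp add: card_gt_0_iff)
  have *: "(\<Sum>u\<in>V. \<Sum>v\<in>V. of_bool (u \<in> S) * (of_bool (v \<in> T) * f u v)) = (\<Sum>u\<in>S. \<Sum>v\<in>T. f u v)"
    for f :: "'a \<Rightarrow> 'a \<Rightarrow> real"
  proof -
    have "(\<Sum>v\<in>V. of_bool (v \<in> T) * g v) = (\<Sum>v\<in>T. g v)" for g :: "'a \<Rightarrow> real"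
      using ST by (intro sum.mono_neutral_cong_right V) auto
    moreover have "(\<Sum>v\<in>V. of_bool (v \<in> S) * g v) = (\<Sum>v\<in>S. g v)" for g :: "'a \<Rightarrow> real"
      using ST by (intro sum.mono_neutral_cong_right V) auto
    ultimately show ?thesis by (simp flip: sum_distrib_left)
  qed
  have sq: "(R u v - d * of_bool (u \<in> S) * of_bool (v \<in> T))\<^sup>2 =
      (R u v)\<^sup>2 - 2 * d * (of_bool (u \<in> S) * (of_bool (v \<in> T) * R u v)) + d\<^sup>2 * (of_bool (u \<in> S) * (of_bool (v \<in> T) * 1))" for u v
    by (cases "u \<in> S"; cases "v \<in> T") (simp_all add: power2_eq_square algebra_simps)
  have "(\<Sum>u\<in>V. \<Sum>v\<in>V. (R u v - d * of_bool (u \<in> S) * of_bool (v \<in> T))\<^sup>2) =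
    (\<Sum>u\<in>V. \<Sum>v\<in>V. (R u v)\<^sup>2) - 2 * d * (\<Sum>u\<in>S. \<Sum>v\<in>T. R u v) + d\<^sup>2 * (\<Sum>u\<in>S. \<Sum>v\<in>T. 1)"
  proof -
    have a: "(\<Sum>u\<in>V. \<Sum>v\<in>V. x u v - e * y u v + f * z u v) =
      (\<Sum>u\<in>V. \<Sum>v\<in>V. x u v) - e * (\<Sum>u\<in>V. \<Sum>v\<in>V. y u v) + f * (\<Sum>u\<in>V. \<Sum>v\<in>V. z u v)"
      for x y z :: "'a \<Rightarrow> 'a \<Rightarrow> real" and e f
      unfolding sum.distrib sum_subtractf sum_distrib_left ..
    show ?thesis unfolding sq a * ..
  qed
  \<comment> \<open>Because \<open>d\<close> is the sum divided by n^2 and not by |S||T|, the mixed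
    term is exactly twice d^2 n^2. The square term is at most d^2 n^2, so one such unit is
    gained.\<close>
  also have "\<dots> = (\<Sum>u\<in>V. \<Sum>v\<in>V. (R u v)\<^sup>2) - 2 * d\<^sup>2 * (real (card V))\<^sup>2 + d\<^sup>2 * (real (card S) * real (card T))"
    using n by (simp add: d power2_eq_square)
  also have "real (card S) * real (card T) \<le> (real (card V))\<^sup>2"
    unfolding power2_eq_square using V ST by (intro mult_mono) (auto intro: card_mono)
  finally show ?thesis by (simp add: mult_left_mono)
qed

text \<open>Here \<open>k\<close> is the energy budget in units of c^2 n^2. A rectangle that
  violates the cut bound has coefficient at least \<open>c\<close> in modulus and uses up a whole
  unit, so after \<open>k\<close> rectangles no energy is left. As the energy stays nonnegative, the
  budget also bounds each coefficient.\<close>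

lemma cut_decomposition_aux:
  fixes R :: "'a \<Rightarrow> 'a \<Rightarrow> real"
  assumes "finite V" "c \<ge> 0" "(\<Sum>u\<in>V. \<Sum>v\<in>V. (R u v)\<^sup>2) \<le> real k * c\<^sup>2 * (real (card V))\<^sup>2"
  shows "\<exists>d S T. (\<forall>i<k. (d i)\<^sup>2 \<le> real k * c\<^sup>2) \<and>
    cut_le V (\<lambda>u v. R u v - (\<Sum>i<k. d i * of_bool (u \<in> S i) * of_bool (v \<in> T i))) (c * (real (card V))\<^sup>2)"
  using assms(3)
proof (induction k arbitrary: R)
  case 0
  then have "(\<Sum>u\<in>V. \<Sum>v\<in>V. (R u v)\<^sup>2) = 0"
    by (intro antisym sum_nonneg) simp_all
  then have "\<And>u v. u \<in> V \<Longrightarrow> v \<in> V \<Longrightarrow> R u v = 0"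
    using assms(1) by (simp add: sum_nonneg_eq_0_iff sum_nonneg)
  then have "(\<Sum>u\<in>S. \<Sum>v\<in>T. R u v) = 0" if "S \<subseteq> V" "T \<subseteq> V" for S T
    using that by (intro sum.neutral ballI) auto
  then show ?case using assms(2) by (auto simp: cut_le_def)
next
  case (Suc k)
  let ?n = "real (card V)"
  show ?case
  proof (cases "cut_le V R (c * ?n\<^sup>2)")
    case True
    \<comment> \<open>If the process stops early, zero coefficients fill up the sum, so that the
      number of terms does not depend on the matrix.\<close>
    then show ?thesis
      by (intro exI[of _ "\<lambda>_. 0"] exI[of _ "\<lambda>_. {}"]) auto
  next
    case False
    then obtain S T where ST: "S \<subseteq> V" "T \<subseteq> V" "\<bar>\<Sum>u\<in>S. \<Sum>v\<in>T. R u v\<bar> > c * ?n\<^sup>2"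
      unfolding cut_le_def by (auto simp: not_le)
    then have "V \<noteq> {}" by auto
    then have n: "?n > 0" using assms(1) by (simp add: card_gt_0_iff)
    define d where "d = (\<Sum>u\<in>S. \<Sum>v\<in>T. R u v) / ?n\<^sup>2"
    define R' where "R' u v = R u v - d * of_bool (u \<in> S) * of_bool (v \<in> T)" for u v
    have le: "(\<Sum>u\<in>V. \<Sum>v\<in>V. (R' u v)\<^sup>2) \<le> (\<Sum>u\<in>V. \<Sum>v\<in>V. (R u v)\<^sup>2) - d\<^sup>2 * ?n\<^sup>2"
      unfolding R'_def using assms(1) \<open>V \<noteq> {}\<close> ST(1,2) d_def by (rule energy_decrement)
    have "c \<le> \<bar>d\<bar>" using ST(3) n by (simp add: d_def abs_divide pos_le_divide_eq)
    then have "c\<^sup>2 \<le> d\<^sup>2" using assms(2) by (metis power2_abs power_mono)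
    then have "c\<^sup>2 * ?n\<^sup>2 \<le> d\<^sup>2 * ?n\<^sup>2" by (simp add: mult_right_mono)
    with le Suc.prems have "(\<Sum>u\<in>V. \<Sum>v\<in>V. (R' u v)\<^sup>2) \<le> real k * c\<^sup>2 * ?n\<^sup>2"
      by (simp add: algebra_simps)
    from Suc.IH[OF this] obtain d' S' T' where IH: "\<forall>i<k. (d' i)\<^sup>2 \<le> real k * c\<^sup>2"
      "cut_le V (\<lambda>u v. R' u v - (\<Sum>i<k. d' i * of_bool (u \<in> S' i) * of_bool (v \<in> T' i))) (c * ?n\<^sup>2)"
      by blast
    have "0 \<le> (\<Sum>u\<in>V. \<Sum>v\<in>V. (R' u v)\<^sup>2)" by (intro sum_nonneg) auto
    with le Suc.prems have "d\<^sup>2 * ?n\<^sup>2 \<le> (real (Suc k) * c\<^sup>2) * ?n\<^sup>2" by linarith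
    then have d: "d\<^sup>2 \<le> real (Suc k) * c\<^sup>2" using n by (simp only: mult_le_cancel_right) auto
    have "R u v - (\<Sum>i<Suc k. (d'(k := d)) i * of_bool (u \<in> (S'(k := S)) i) * of_bool (v \<in> (T'(k := T)) i)) =
      R' u v - (\<Sum>i<k. d' i * of_bool (u \<in> S' i) * of_bool (v \<in> T' i))" for u v
      by (simp add: R'_def)
    note eq = this
    have "cut_le V (\<lambda>u v. R u v - (\<Sum>i<Suc k. (d'(k := d)) i * of_bool (u \<in> (S'(k := S)) i) *
      of_bool (v \<in> (T'(k := T)) i))) (c * ?n\<^sup>2)" unfolding eq by (rule IH(2))
    moreover have "real k * c\<^sup>2 \<le> real (Suc k) * c\<^sup>2" by (intro mult_right_mono) auto
    then have "\<forall>i<Suc k. ((d'(k := d)) i)\<^sup>2 \<le> real (Suc k) * c\<^sup>2"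
      using IH(1) d by (metis fun_upd_apply less_SucE order_trans)
    ultimately show ?thesis
      by (intro exI[of _ "d'(k := d)"] exI[of _ "S'(k := S)"] exI[of _ "T'(k := T)"] conjI)
  qed
qed

text \<open>With c = 1/(m+1) and (m+1)^2 rectangles the budget is exactly n^2, which bounds the
  energy of a matrix with entries in [-1, 1]. Number of terms and size of the coefficients depend on
  \<open>m\<close> only and not on \<open>V\<close>; the compactness argument rests on this.\<close>

lemma cut_decomposition:
  fixes R :: "'a \<Rightarrow> 'a \<Rightarrow> real"
  assumes V: "finite V" and R: "\<And>u v. \<bar>R u v\<bar> \<le> 1"
  shows "\<exists>d S T. (\<forall>i. \<bar>d i\<bar> \<le> 1) \<and>
    cut_le V (\<lambda>u v. R u v - (\<Sum>i<(Suc m)\<^sup>2. d i * of_bool (u \<in> S i) * of_bool (v \<in> T i)))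
      ((real (card V))\<^sup>2 / real (Suc m))"
proof -
  let ?n = "real (card V)" and ?c = "1 / real (Suc m)"
  have k: "real ((Suc m)\<^sup>2) * ?c\<^sup>2 = 1" by (simp add: power_divide del: of_nat_Suc)
  have R2: "(R u v)\<^sup>2 \<le> 1" for u v using R[of u v] by (simp add: abs_square_le_1)
  have "(\<Sum>u\<in>V. \<Sum>v\<in>V. (R u v)\<^sup>2) \<le> (\<Sum>u\<in>V. \<Sum>v\<in>V. 1)"
    using R2 by (intro sum_mono)
  also have "\<dots> = ?n\<^sup>2" by (simp add: power2_eq_square)
  also have "\<dots> = real ((Suc m)\<^sup>2) * ?c\<^sup>2 * ?n\<^sup>2" unfolding k by simp
  finally have le: "(\<Sum>u\<in>V. \<Sum>v\<in>V. (R u v)\<^sup>2) \<le> real ((Suc m)\<^sup>2) * ?c\<^sup>2 * ?n\<^sup>2" .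
  have "0 \<le> ?c" by simp
  from cut_decomposition_aux[OF V this le] obtain d S T where dST: "\<forall>i<(Suc m)\<^sup>2. (d i)\<^sup>2 \<le> real ((Suc m)\<^sup>2) * ?c\<^sup>2"
    "cut_le V (\<lambda>u v. R u v - (\<Sum>i<(Suc m)\<^sup>2. d i * of_bool (u \<in> S i) * of_bool (v \<in> T i))) (?c * ?n\<^sup>2)"
    by (elim exE conjE) (rule that)
  \<comment> \<open>Zero beyond the last term, so that the coefficient bound holds at every
    index.\<close>
  define d' where "d' i = (if i < (Suc m)\<^sup>2 then d i else 0)" for i
  have "\<bar>d' i\<bar> \<le> 1" for i
    using dST(1) unfolding k by (auto simp: d'_def abs_square_le_1)
  moreover have "(\<Sum>i<(Suc m)\<^sup>2. d i * of_bool (u \<in> S i) * of_bool (v \<in> T i)) =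
    (\<Sum>i<(Suc m)\<^sup>2. d' i * of_bool (u \<in> S i) * of_bool (v \<in> T i))" for u v
    by (intro sum.cong) (auto simp: d'_def)
  ultimately have "cut_le V (\<lambda>u v. R u v - (\<Sum>i<(Suc m)\<^sup>2. d' i * of_bool (u \<in> S i) * of_bool (v \<in> T i))) (?n\<^sup>2 / real (Suc m))"
    using dST(2) by (simp del: of_nat_Suc)
  then show ?thesis using \<open>\<And>i. \<bar>d' i\<bar> \<le> 1\<close> by blast
qed

section \<open>Weak limits and the cut norm\<close>

lemma abs_mult_le_left:
  fixes a b c :: real
  assumes "\<bar>a\<bar> \<le> c" "\<bar>b\<bar> \<le> 1" shows "\<bar>a * b\<bar> \<le> c"
  using mult_mono[OF assms] assms by (simp add: abs_mult)

lemma integrable_sq: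
  fixes f :: "real \<times> real \<Rightarrow> real"
  assumes "f \<in> borel_measurable unit_sq" "\<And>z. z \<in> square \<Longrightarrow> \<bar>f z\<bar> \<le> B"
  shows "integrable unit_sq f"
  by (rule sq.P.integrable_const_bound[of _ B]) (use assms in \<open>auto simp: space_unit_sq intro!: AE_I2\<close>)

lemma integral_sq_bound:
  fixes f :: "real \<times> real \<Rightarrow> real"
  assumes "f \<in> borel_measurable unit_sq" "\<And>z. z \<in> square \<Longrightarrow> \<bar>f z\<bar> \<le> B"
  shows "\<bar>integral\<^sup>L unit_sq f\<bar> \<le> B"
proof -
  have "\<bar>integral\<^sup>L unit_sq f\<bar> \<le> (LINT z|unit_sq. \<bar>f z\<bar>)"
    using integral_norm_bound[of unit_sq f] by simp
  also have "\<dots> \<le> (LINT z|unit_sq. B)"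
    using assms by (intro integral_mono integrable_sq[of _ B] sq.P.integrable_const) (auto simp: space_unit_sq)
  finally show ?thesis using sq.P.prob_space by simp
qed

lemma integral_indicator_sq_bound:
  fixes f :: "real \<times> real \<Rightarrow> real"
  assumes f: "f \<in> borel_measurable unit_sq" and A: "A \<in> sets unit_sq" and B: "\<And>z. z \<in> square \<Longrightarrow> \<bar>f z\<bar> \<le> 1"
  shows "\<bar>LINT z|unit_sq. indicator A z * f z\<bar> \<le> measure unit_sq A"
proof -
  have "\<bar>LINT z|unit_sq. indicator A z * f z\<bar> \<le> (LINT z|unit_sq. \<bar>indicator A z * f z\<bar>)"
    using integral_norm_bound[of unit_sq "\<lambda>z. indicator A z * f z"] by simp
  also have "\<dots> \<le> (LINT z|unit_sq. indicator A z)"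
    using assms by (intro integral_mono integrable_sq[of _ 1])
      (auto simp: space_unit_sq abs_mult indicator_def split: if_splits)
  finally show ?thesis using A sets.sets_into_space[OF A] by (simp add: Int_absorb2)
qed

lemma measure_remainder_tendsto_0:
  fixes A :: "nat \<Rightarrow> (real \<times> real) set"
  assumes A: "range A \<subseteq> sets unit_sq"
  shows "(\<lambda>N. measure unit_sq ((\<Union>i. A i) - (\<Union>i<N. A i))) \<longlonglongrightarrow> 0"
proof -
  have "(\<lambda>N. measure unit_sq (\<Union>i<N. A i)) \<longlonglongrightarrow> measure unit_sq (\<Union>N. \<Union>i<N. A i)"
    using A by (intro sq.P.finite_Lim_measure_incseq) (auto simp: incseq_def intro!: sets.finite_UN, fastforce)
  also have "(\<Union>N. \<Union>i<N. A i) = (\<Union>i. A i)" by auto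
  finally have "(\<lambda>N. measure unit_sq (\<Union>i. A i) - measure unit_sq (\<Union>i<N. A i)) \<longlonglongrightarrow> 
     measure unit_sq (\<Union>i. A i) - measure unit_sq (\<Union>i. A i)"
    by (intro tendsto_diff tendsto_const)
  moreover have "measure unit_sq ((\<Union>i. A i) - (\<Union>i<N. A i)) =
    measure unit_sq (\<Union>i. A i) - measure unit_sq (\<Union>i<N. A i)" for N
    using A by (intro sq.P.finite_measure_Diff) auto
  ultimately show ?thesis by simp
qed

text \<open>Rectangles are closed under intersection and generate the Borel sets, so it suffices to
  pass to complements and disjoint unions. In a union the tail contributes at most its measure,
  uniformly in i, since \<open>D\<close> is bounded. The filter is general so that the lemma covers
  pairs of indices, hence Cauchy sequences.\<close>

lemma weakly_null_sets:
  fixes D :: "'i \<Rightarrow> real \<times> real \<Rightarrow> real"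
  assumes D[measurable]: "\<And>i. D i \<in> borel_measurable unit_sq" and bd: "\<And>i z. z \<in> square \<Longrightarrow> \<bar>D i z\<bar> \<le> 1"
    and rect: "\<And>S T. S \<in> sets unit_lborel \<Longrightarrow> T \<in> sets unit_lborel \<Longrightarrow>
      ((\<lambda>i. LINT z|unit_sq. indicator (S \<times> T) z * D i z) \<longlongrightarrow> 0) F"
    and A: "A \<in> sets unit_sq"
  shows "((\<lambda>i. LINT z|unit_sq. indicator A z * D i z) \<longlongrightarrow> 0) F"
proof -
  let ?G = "{a \<times> b |a b. a \<in> sets unit_lborel \<and> b \<in> sets unit_lborel}"
  have int: "integrable unit_sq (\<lambda>z. indicator B z * D i z)" if "B \<in> sets unit_sq" for B i
    using that bd by (intro integrable_sq[of _ 1]) (auto simp: abs_mult indicator_def)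
  have eq: "sets unit_sq = sigma_sets (space unit_lborel \<times> space unit_lborel) ?G"
    by (rule sets_pair_measure)
  have A': "A \<in> sigma_sets (space unit_lborel \<times> space unit_lborel) ?G" using A eq by simp
  show ?thesis
  proof (rule sigma_sets_induct_disjoint[OF Int_stable_pair_measure_generator _ A'])
    show "?G \<subseteq> Pow (space unit_lborel \<times> space unit_lborel)"
      by (rule pair_measure_closed)
  next
    fix B assume "B \<in> ?G"
    then show "((\<lambda>i. LINT z|unit_sq. indicator B z * D i z) \<longlongrightarrow> 0) F" using rect by auto
  next
    show "((\<lambda>i. LINT z|unit_sq. indicator {} z * D i z) \<longlongrightarrow> 0) F" by simp
  next
    fix B assume B: "B \<in> sigma_sets (space unit_lborel \<times> space unit_lborel) ?G"
      and lim: "((\<lambda>i. LINT z|unit_sq. indicator B z * D i z) \<longlongrightarrow> 0) F"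
    have B': "B \<in> sets unit_sq" using B eq by simp
    have "(LINT z|unit_sq. indicator (space unit_lborel \<times> space unit_lborel) z * D i z) -
      (LINT z|unit_sq. indicator B z * D i z) =
      (LINT z|unit_sq. indicator (space unit_lborel \<times> space unit_lborel - B) z * D i z)" for i
    proof -
      have "space unit_lborel \<times> space unit_lborel \<in> sets unit_sq"
        by (rule pair_measureI[OF sets.top sets.top])
      moreover have "indicator (space unit_lborel \<times> space unit_lborel - B) z * D i z =
        indicator (space unit_lborel \<times> space unit_lborel) z * D i z - indicator B z * D i z" for z
        using sets.sets_into_space[OF B'] by (auto simp: indicator_def space_pair_measure)
      ultimately show ?thesis
        by (simp only: Bochner_Integration.integral_diff[OF int int[OF B']])
    qed
    moreover have "((\<lambda>i. (LINT z|unit_sq. indicator (space unit_lborel \<times> space unit_lborel) z * D i z) -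
      (LINT z|unit_sq. indicator B z * D i z)) \<longlongrightarrow> 0 - 0) F"
      by (intro tendsto_diff lim rect sets.top)
    ultimately show "((\<lambda>i. LINT z|unit_sq. indicator (space unit_lborel \<times> space unit_lborel - B) z * D i z) \<longlongrightarrow> 0) F"
      by simp
  next
    fix B :: "nat \<Rightarrow> (real \<times> real) set"
    assume dis: "disjoint_family B" and B: "range B \<subseteq> sigma_sets (space unit_lborel \<times> space unit_lborel) ?G"
      and lim: "\<And>n. ((\<lambda>i. LINT z|unit_sq. indicator (B n) z * D i z) \<longlongrightarrow> 0) F"
    have B': "range B \<subseteq> sets unit_sq" using B eq by simp
    then have Bn: "B n \<in> sets unit_sq" for n by auto
    show "((\<lambda>i. LINT z|unit_sq. indicator (\<Union>n. B n) z * D i z) \<longlongrightarrow> 0) F"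
    proof (rule tendstoI)
      fix e :: real assume "e > 0"
      obtain N where N: "measure unit_sq ((\<Union>n. B n) - (\<Union>n<N. B n)) < e / 2"
        using order_tendstoD(2)[OF measure_remainder_tendsto_0[OF B'], of "e / 2"] \<open>e > 0\<close>
        by (auto simp: eventually_sequentially)
      let ?R = "(\<Union>n. B n) - (\<Union>n<N. B n)"
      have R: "?R \<in> sets unit_sq" using Bn by auto
      have split: "indicator (\<Union>n. B n) z = (\<Sum>n<N. indicator (B n) z) + (indicator ?R z :: real)" for z
      proof -
        have "indicator (\<Union>n. B n) z = indicator (\<Union>n<N. B n) z + (indicator ?R z :: real)"
          by (auto simp: indicator_def)
        also have "indicator (\<Union>n<N. B n) z = (\<Sum>n<N. indicator (B n) z :: real)"
          using dis by (intro indicator_UN_disjoint) (auto simp: disjoint_family_on_def)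
        finally show ?thesis .
      qed
      have int_eq: "(LINT z|unit_sq. indicator (\<Union>n. B n) z * D i z) =
        (\<Sum>n<N. LINT z|unit_sq. indicator (B n) z * D i z) + (LINT z|unit_sq. indicator ?R z * D i z)" for i
      proof -
        have "integrable unit_sq (\<lambda>z. \<Sum>n<N. indicator (B n) z * D i z)"
          by (intro Bochner_Integration.integrable_sum int Bn)
        from Bochner_Integration.integral_add[OF this int[OF R]]
          Bochner_Integration.integral_sum[of "{..<N}" unit_sq "\<lambda>n z. indicator (B n) z * D i z", OF int[OF Bn]]
        show ?thesis unfolding split distrib_right sum_distrib_right by simp
      qed
      have "((\<lambda>i. \<Sum>n<N. LINT z|unit_sq. indicator (B n) z * D i z) \<longlongrightarrow> 0) F"
        by (rule tendsto_null_sum) (rule lim)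
      from tendstoD[OF this, of "e / 2"] \<open>e > 0\<close>
      have "\<forall>\<^sub>F i in F. dist (\<Sum>n<N. LINT z|unit_sq. indicator (B n) z * D i z) 0 < e / 2" by simp
      then show "\<forall>\<^sub>F i in F. dist (LINT z|unit_sq. indicator (\<Union>n. B n) z * D i z) 0 < e"
      proof eventually_elim
        case (elim i)
        have "\<bar>LINT z|unit_sq. indicator ?R z * D i z\<bar> < e / 2"
          using integral_indicator_sq_bound[OF D R bd, of i] N by simp
        then show ?case using elim unfolding int_eq by (simp add: dist_real_def)
      qed
    qed
  qed
qed

text \<open>On the square \<open>h\<close> is within 1/n of the average of the indicators of its
  level sets {h \<ge> j/n}, j = 1, ..., n.\<close>

lemma weakly_null_functions:
  fixes D :: "'i \<Rightarrow> real \<times> real \<Rightarrow> real" and h :: "real \<times> real \<Rightarrow> real"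
  assumes D[measurable]: "\<And>i. D i \<in> borel_measurable unit_sq" and bd: "\<And>i z. z \<in> square \<Longrightarrow> \<bar>D i z\<bar> \<le> 1"
    and sets: "\<And>A. A \<in> sets unit_sq \<Longrightarrow> ((\<lambda>i. LINT z|unit_sq. indicator A z * D i z) \<longlongrightarrow> 0) F"
    and h[measurable]: "h \<in> borel_measurable unit_sq" and h01: "\<And>z. z \<in> square \<Longrightarrow> 0 \<le> h z \<and> h z \<le> 1"
  shows "((\<lambda>i. LINT z|unit_sq. h z * D i z) \<longlongrightarrow> 0) F"
proof (rule tendstoI)
  fix e :: real assume "e > 0"
  define n where "n = nat \<lceil>2 / e\<rceil> + 1"
  have n: "n > 0" "1 / real n < e / 2"
  proof -
    have "2 / e < real n" unfolding n_def using \<open>e > 0\<close> by (simp add: of_nat_nat) linarith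
    moreover have "real n > 0" by (simp add: n_def)
    ultimately show "1 / real n < e / 2" using \<open>e > 0\<close> by (simp add: field_simps)
  qed (simp add: n_def)
  define L where "L j = {z \<in> space unit_sq. real j \<le> real n * h z}" for j :: nat
  have L[measurable]: "L j \<in> sets unit_sq" for j unfolding L_def by measurable
  define g where "g z = (\<Sum>j=1..n. indicator (L j) z) / real n" for z
  have g[measurable]: "g \<in> borel_measurable unit_sq" unfolding g_def by measurable
  have gh: "\<bar>h z - g z\<bar> \<le> 1 / real n" if z: "z \<in> square" for z
  proof -
    \<comment> \<open>Exactly the first \<open>m\<close> level sets contain z.\<close>
    define m where "m = nat \<lfloor>real n * h z\<rfloor>"
    have m: "real m \<le> real n * h z" "real n * h z < real m + 1"
      using h01[OF z] n by (auto simp: m_def of_nat_nat)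
    have "real n * h z \<le> real n" using h01[OF z] by (simp add: mult_left_le)
    then have "m \<le> n" using m(1) by linarith
    have "real j \<le> real n * h z \<longleftrightarrow> j \<le> m" for j
      using m by linarith
    then have "(\<Sum>j=1..n. indicator (L j) z :: real) = (\<Sum>j=1..n. if j \<le> m then 1 else 0)"
      using z by (intro sum.cong) (auto simp: L_def indicator_def space_unit_sq)
    also have "\<dots> = (\<Sum>j\<in>{1..m}. 1)"
      using \<open>m \<le> n\<close> by (intro sum.mono_neutral_cong_right) auto
    finally have "g z = real m / real n" by (simp add: g_def)
    then have "h z - g z = (real n * h z - real m) / real n" using n by (simp add: field_simps)
    then show ?thesis using m n by (simp add: abs_divide divide_right_mono)
  qed
  have int: "integrable unit_sq (\<lambda>z. indicator B z * D i z)" if "B \<in> sets unit_sq" for B i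
    using that bd by (intro integrable_sq[of _ 1]) (auto simp: abs_mult indicator_def)
  have "((\<lambda>i. (\<Sum>j=1..n. LINT z|unit_sq. indicator (L j) z * D i z) / real n) \<longlongrightarrow> 0 / real n) F"
    using n by (intro tendsto_divide tendsto_null_sum sets L tendsto_const) auto
  moreover have eq: "(LINT z|unit_sq. g z * D i z) = (\<Sum>j=1..n. LINT z|unit_sq. indicator (L j) z * D i z) / real n" for i
  proof -
    have "(\<Sum>j=1..n. LINT z|unit_sq. indicator (L j) z * D i z) = (LINT z|unit_sq. (\<Sum>j=1..n. indicator (L j) z * D i z))"
      by (intro Bochner_Integration.integral_sum[symmetric] int L)
    moreover have "g z * D i z = (\<Sum>j=1..n. indicator (L j) z * D i z) / real n" for z
      by (simp add: g_def sum_distrib_right)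
    ultimately show ?thesis by simp
  qed
  ultimately have "((\<lambda>i. LINT z|unit_sq. g z * D i z) \<longlongrightarrow> 0) F" by simp
  from tendstoD[OF this, of "e / 2"] \<open>e > 0\<close>
  have "\<forall>\<^sub>F i in F. dist (LINT z|unit_sq. g z * D i z) 0 < e / 2" by simp
  then show "\<forall>\<^sub>F i in F. dist (LINT z|unit_sq. h z * D i z) 0 < e"
  proof eventually_elim
    case (elim i)
    have gb: "\<bar>g z\<bar> \<le> 2" if "z \<in> square" for z
      using gh[OF that] h01[OF that] n by (smt (verit) divide_le_eq_1_pos of_nat_0_less_iff of_nat_1 of_nat_le_iff One_nat_def Suc_leI)
    have hb: "\<bar>h z\<bar> \<le> 2" if "z \<in> square" for z
      using h01[OF that] by auto
    have "integrable unit_sq (\<lambda>z. h z * D i z)" "integrable unit_sq (\<lambda>z. g z * D i z)"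
      by (intro integrable_sq[of _ 2] abs_mult_le_left hb gb bd; measurable)+
    then have "(LINT z|unit_sq. h z * D i z) - (LINT z|unit_sq. g z * D i z) = (LINT z|unit_sq. (h z - g z) * D i z)"
      by (simp add: left_diff_distrib)
    moreover have "\<bar>LINT z|unit_sq. (h z - g z) * D i z\<bar> \<le> 1 / real n"
      by (intro integral_sq_bound abs_mult_le_left gh bd) measurable
    ultimately show ?case using elim n by (simp add: dist_real_def)
  qed
qed

text \<open>Convergence spreads from rectangles to all Borel sets. The limits of the integrals form
  a measure dominated by Lebesgue measure, and its Radon-Nikodym density is the weak limit.\<close>

lemma weak_limit_exists:
  fixes W :: "nat \<Rightarrow> real \<times> real \<Rightarrow> real"
  assumes W[measurable]: "\<And>k. W k \<in> borel_measurable unit_sq"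
    and W01: "\<And>k z. z \<in> square \<Longrightarrow> 0 \<le> W k z \<and> W k z \<le> 1"
    and rect: "\<And>S T. S \<in> sets unit_lborel \<Longrightarrow> T \<in> sets unit_lborel \<Longrightarrow>
      Cauchy (\<lambda>k. LINT z|unit_sq. indicator (S \<times> T) z * W k z)"
  obtains U where "U \<in> borel_measurable unit_sq" "\<And>z. 0 \<le> U z \<and> U z \<le> 1"
    "\<And>A. A \<in> sets unit_sq \<Longrightarrow>
      (\<lambda>k. LINT z|unit_sq. indicator A z * W k z) \<longlonglongrightarrow> (LINT z|unit_sq. indicator A z * U z)"
proof -
  let ?J = "\<lambda>A k. LINT z|unit_sq. indicator A z * W k z"
  have int: "integrable unit_sq (\<lambda>z. indicator B z * W k z)" if "B \<in> sets unit_sq" for B k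
    using that W01 by (intro integrable_sq[of _ 1]) (auto simp: abs_mult indicator_def)
  have diff: "(LINT z|unit_sq. indicator A z * (W k z - W l z)) = ?J A k - ?J A l" if "A \<in> sets unit_sq" for A k l
    using int[OF that] by (simp add: right_diff_distrib)
  \<comment> \<open>A sequence of integrals is Cauchy iff the differences, indexed by pairs (k, l),
    tend to 0 along the product filter.\<close>
  define D where "D = (\<lambda>(k, l) z. W k z - W l z)"
  have Cau: "Cauchy (?J A) \<longleftrightarrow> (((\<lambda>i. LINT z|unit_sq. indicator A z * D i z) \<longlongrightarrow> 0) (sequentially \<times>\<^sub>F sequentially))"
    if "A \<in> sets unit_sq" for A
  proof -
    have "(LINT z|unit_sq. indicator A z * D i z) = ?J A (fst i) - ?J A (snd i)" for i
      using diff[OF that] by (simp add: D_def case_prod_unfold)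
    then show ?thesis
      unfolding Cauchy_def tendsto_iff eventually_prod_sequentially dist_real_def
      by simp (meson order_trans)
  qed
  have "((\<lambda>i. LINT z|unit_sq. indicator A z * D i z) \<longlongrightarrow> 0) (sequentially \<times>\<^sub>F sequentially)"
    if A: "A \<in> sets unit_sq" for A
  proof (rule weakly_null_sets[OF _ _ _ A])
    show "D i \<in> borel_measurable unit_sq" for i by (simp add: D_def case_prod_unfold)
    show "\<bar>D i z\<bar> \<le> 1" if "z \<in> square" for i z
      using W01[OF that, of "fst i"] W01[OF that, of "snd i"] by (auto simp: D_def case_prod_unfold)
    fix S T assume "S \<in> sets unit_lborel" "T \<in> sets unit_lborel"
    then show "((\<lambda>i. LINT z|unit_sq. indicator (S \<times> T) z * D i z) \<longlongrightarrow> 0) (sequentially \<times>\<^sub>F sequentially)"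
      using rect by (subst Cau[symmetric]) auto
  qed
  with Cau have "Cauchy (?J A)" if "A \<in> sets unit_sq" for A using that by blast
  then have conv: "convergent (?J A)" if "A \<in> sets unit_sq" for A using that by (simp add: Cauchy_convergent)
  define \<nu> where "\<nu> A = lim (?J A)" for A
  have lim: "?J A \<longlonglongrightarrow> \<nu> A" if "A \<in> sets unit_sq" for A
    using conv[OF that] unfolding \<nu>_def by (simp add: convergent_LIMSEQ_iff)
  have J_bounds: "0 \<le> ?J A k" "?J A k \<le> measure unit_sq A" if "A \<in> sets unit_sq" for A k
  proof -
    show "0 \<le> ?J A k" using W01 by (intro integral_nonneg_AE AE_I2) (auto simp: space_unit_sq)
    show "?J A k \<le> measure unit_sq A"
      using integral_indicator_sq_bound[OF W that, of k] W01 by fastforce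
  qed
  have \<nu>_bounds: "0 \<le> \<nu> A" "\<nu> A \<le> measure unit_sq A" if "A \<in> sets unit_sq" for A
    using J_bounds[OF that] lim[OF that] by (auto intro: LIMSEQ_le_const LIMSEQ_le_const2)
  have \<nu>_Un: "\<nu> (A \<union> B) = \<nu> A + \<nu> B" if "A \<in> sets unit_sq" "B \<in> sets unit_sq" "A \<inter> B = {}" for A B
  proof -
    have "?J (A \<union> B) k = ?J A k + ?J B k" for k
      using that int by (simp add: indicator_disj_union distrib_right)
    then show ?thesis
      using LIMSEQ_unique[OF lim[of "A \<union> B"]] tendsto_add[OF lim[OF that(1)] lim[OF that(2)]] that by simp
  qed
  have \<nu>_empty: "\<nu> {} = 0" using \<nu>_bounds[of "{}"] by simp
  define N where "N = measure_of (space unit_sq) (sets unit_sq) (\<lambda>A. ennreal (\<nu> A))"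
  have "countably_additive (sets unit_sq) (\<lambda>A. ennreal (\<nu> A))"
  proof (rule countably_additiveI)
    fix A :: "nat \<Rightarrow> (real \<times> real) set"
    assume A: "range A \<subseteq> sets unit_sq" and dis: "disjoint_family A"
    have An: "A n \<in> sets unit_sq" for n using A by auto
    have fin: "\<nu> (\<Union>n<N. A n) = (\<Sum>n<N. \<nu> (A n))" for N
    proof (induction N)
      case (Suc N)
      have "(\<Union>n<Suc N. A n) = (\<Union>n<N. A n) \<union> A N" by (auto simp: less_Suc_eq)
      moreover have "A n \<inter> A N = {}" if "n < N" for n
        using dis that by (simp add: disjoint_family_on_def)
      then have "(\<Union>n<N. A n) \<inter> A N = {}" by blast
      moreover have "(\<Union>n<N. A n) \<in> sets unit_sq" using An by (intro sets.finite_UN) simp_all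
      ultimately show ?case using Suc \<nu>_Un[of "\<Union>n<N. A n" "A N", OF _ An] by simp
    qed (simp add: \<nu>_empty)
    let ?R = "\<lambda>N. (\<Union>n. A n) - (\<Union>n<N. A n)"
    have "\<nu> (\<Union>n. A n) = (\<Sum>n<N. \<nu> (A n)) + \<nu> (?R N)" for N
    proof -
      have "\<nu> ((\<Union>n<N. A n) \<union> ?R N) = \<nu> (\<Union>n<N. A n) + \<nu> (?R N)"
        using An by (intro \<nu>_Un sets.Diff sets.countable_UN' sets.finite_UN) auto
      moreover have "(\<Union>n<N. A n) \<union> ?R N = (\<Union>n. A n)" by auto
      ultimately show ?thesis by (simp add: fin)
    qed
    then have eq: "(\<Sum>n<N. \<nu> (A n)) = \<nu> (\<Union>n. A n) - \<nu> (?R N)" for N by (simp add: algebra_simps)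
    have "?R N \<in> sets unit_sq" for N
      using An by (intro sets.Diff sets.countable_UN' sets.finite_UN) auto
    \<comment> \<open>The remainder of the union has small Lebesgue measure, which dominates \<nu>.
      This turns finite additivity into countable additivity.\<close>
    then have "(\<lambda>N. \<nu> (?R N)) \<longlonglongrightarrow> 0"
      using \<nu>_bounds by (intro tendsto_sandwich[OF _ _ tendsto_const measure_remainder_tendsto_0[OF A]]) auto
    from tendsto_diff[OF tendsto_const this] have "(\<lambda>n. \<nu> (A n)) sums \<nu> (\<Union>n. A n)"
      unfolding sums_def eq by simp
    then show "(\<Sum>n. ennreal (\<nu> (A n))) = ennreal (\<nu> (\<Union>n. A n))"
      using \<nu>_bounds(1)[OF An] by (subst suminf_ennreal2) (auto simp: sums_iff)
  qed
  then have emN: "emeasure N A = ennreal (\<nu> A)" if "A \<in> sets unit_sq" for A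
    unfolding N_def using that
    by (intro emeasure_measure_of_sigma sets.sigma_algebra_axioms) (auto simp: positive_def \<nu>_empty)
  have setsN: "sets N = sets unit_sq" by (simp add: N_def sets.space_closed sets.sigma_sets_eq)
  have "absolutely_continuous unit_sq N"
    unfolding absolutely_continuous_def
  proof
    fix A assume A: "A \<in> null_sets unit_sq"
    then have "A \<in> sets unit_sq" "measure unit_sq A = 0" by (auto simp: null_sets_def measure_def)
    with \<nu>_bounds[of A] show "A \<in> null_sets N" by (auto simp: null_sets_def emN setsN)
  qed
  from sq.P.Radon_Nikodym[OF this setsN] obtain f where f[measurable]: "f \<in> borel_measurable unit_sq"
    and df: "density unit_sq f = N" by blast
  have f_int: "(\<integral>\<^sup>+z. f z * indicator A z \<partial>unit_sq) = ennreal (\<nu> A)" if "A \<in> sets unit_sq" for A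
    using emeasure_density[OF f that] emN[OF that] df by simp
  have f1: "AE z in unit_sq. f z \<le> 1"
  proof -
    \<comment> \<open>If the set where f exceeds 1 were not null, its \<nu>-value would exceed its
      measure.\<close>
    let ?B = "{z \<in> space unit_sq. 1 < f z}"
    have B: "?B \<in> sets unit_sq" by measurable
    have le: "(\<integral>\<^sup>+z. f z * indicator ?B z \<partial>unit_sq) \<le> (\<integral>\<^sup>+z. indicator ?B z \<partial>unit_sq)"
      unfolding f_int[OF B] nn_integral_indicator[OF B] sq.P.emeasure_eq_measure
      using \<nu>_bounds(2)[OF B] by (rule ennreal_leI)
    have "(\<integral>\<^sup>+z. f z * indicator ?B z - indicator ?B z \<partial>unit_sq) =
      (\<integral>\<^sup>+z. f z * indicator ?B z \<partial>unit_sq) - (\<integral>\<^sup>+z. indicator ?B z \<partial>unit_sq)"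
    proof (rule nn_integral_diff)
      show "(\<integral>\<^sup>+z. indicator ?B z \<partial>unit_sq) \<noteq> \<infinity>"
        using B by (simp add: sq.P.emeasure_eq_measure)
      show "AE z in unit_sq. indicator ?B z \<le> f z * indicator ?B z"
        by (rule AE_I2) (simp split: split_indicator add: less_imp_le)
    qed (use B in measurable)
    also have "\<dots> = 0"
      using le f_int[OF B] by (simp add: diff_eq_0_iff_ennreal)
    finally have "AE z in unit_sq. f z * indicator ?B z - indicator ?B z = 0"
      by (subst (asm) nn_integral_0_iff_AE) (use B in measurable)
    then show ?thesis
    proof (rule AE_mp, intro AE_I2 impI)
      fix z assume "z \<in> space unit_sq" and "f z * indicator ?B z - indicator ?B z = 0"
      then have "f z * indicator ?B z \<le> indicator ?B z" by (simp add: diff_eq_0_iff_ennreal)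
      then show "f z \<le> 1" using \<open>z \<in> space unit_sq\<close> by (cases "f z \<le> 1") (auto simp: not_le)
    qed
  qed
  \<comment> \<open>A real version of the extended density, with the bound 1 at every point.\<close>
  define U where "U z = min 1 (enn2real (f z))" for z
  have U[measurable]: "U \<in> borel_measurable unit_sq" unfolding U_def by measurable
  have U01: "0 \<le> U z \<and> U z \<le> 1" for z by (simp add: U_def)
  have U_int: "(LINT z|unit_sq. indicator A z * U z) = \<nu> A" if A: "A \<in> sets unit_sq" for A
  proof (rule integral_eq_nn_integral[THEN trans])
    have "(\<integral>\<^sup>+ z. ennreal (indicator A z * U z) \<partial>unit_sq) = (\<integral>\<^sup>+z. f z * indicator A z \<partial>unit_sq)"
      using f1
    proof (intro nn_integral_cong_AE, eventually_elim)
      case (elim z)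
      then have "f z < top" by (simp add: order_le_less_trans)
      then have "ennreal (U z) = f z"
        using elim by (cases "f z") (auto simp: U_def min_def)
      then show ?case by (simp split: split_indicator)
    qed
    then show "enn2real (\<integral>\<^sup>+ z. ennreal (indicator A z * U z) \<partial>unit_sq) = \<nu> A"
      using \<nu>_bounds[OF A] by (simp add: f_int[OF A])
  qed (use A U01 in auto)
  show ?thesis by (rule that[OF U U01]) (simp add: U_int lim)
qed

section \<open>The cut norm and limits in it\<close>

lemma integral_sq_swap:
  fixes f :: "real \<times> real \<Rightarrow> real"
  assumes "f \<in> borel_measurable unit_sq"
  shows "(LINT z|unit_sq. f (snd z, fst z)) = integral\<^sup>L unit_sq f"
proof -
  have "integral\<^sup>L (distr unit_sq unit_sq (\<lambda>(x, y). (y, x))) f = (LINT z|unit_sq. f ((\<lambda>(x, y). (y, x)) z))"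
    by (rule integral_distr[OF measurable_pair_swap' assms])
  then show ?thesis using sq.distr_pair_swap by (simp add: case_prod_unfold)
qed

text \<open>Weights in [0, 1] stand in place of sets because products of edge factors occur as
  weights in the counting lemma.\<close>

definition cut_norm_le :: "(real \<times> real \<Rightarrow> real) \<Rightarrow> real \<Rightarrow> bool" where
  "cut_norm_le D e \<longleftrightarrow> (\<forall>f\<in>borel_measurable unit_lborel. \<forall>g\<in>borel_measurable unit_lborel.
    (\<forall>x. 0 \<le> f x \<and> f x \<le> 1) \<longrightarrow> (\<forall>x. 0 \<le> g x \<and> g x \<le> 1) \<longrightarrow>
    \<bar>LINT z|unit_sq. f (fst z) * g (snd z) * D z\<bar> \<le> e)"

lemma cut_norm_leD:
  assumes "cut_norm_le D e" "f \<in> borel_measurable unit_lborel" "g \<in> borel_measurable unit_lborel"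
    "\<And>x. 0 \<le> f x \<and> f x \<le> 1" "\<And>x. 0 \<le> g x \<and> g x \<le> 1"
  shows "\<bar>LINT z|unit_sq. f (fst z) * g (snd z) * D z\<bar> \<le> e"
  using assms unfolding cut_norm_le_def by blast

lemma cut_norm_le_rectangle:
  assumes "cut_norm_le D e" "S \<in> sets unit_lborel" "T \<in> sets unit_lborel"
  shows "\<bar>LINT z|unit_sq. indicator (S \<times> T) z * D z\<bar> \<le> e"
  unfolding indicator_times using assms by (intro cut_norm_leD[OF assms(1)]) (auto simp: indicator_def)

text \<open>Completeness in the cut norm. Rectangles are tests for the cut norm, so a weak limit
  exists. The Cauchy bound passes to this limit for each pair of weights, and its threshold does not
  depend on the weights.\<close>

lemma cut_limit_exists:
  fixes W :: "nat \<Rightarrow> real \<times> real \<Rightarrow> real"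
  assumes W[measurable]: "\<And>k. W k \<in> borel_measurable unit_sq"
    and W01: "\<And>k z. 0 \<le> W k z \<and> W k z \<le> 1"
    and sym: "\<And>k x y. W k (x, y) = W k (y, x)"
    and cau: "\<And>e. e > 0 \<Longrightarrow> \<exists>K. \<forall>k\<ge>K. \<forall>l\<ge>K. cut_norm_le (\<lambda>z. W k z - W l z) e"
  obtains U :: "real \<Rightarrow> real \<Rightarrow> real" where "(\<lambda>z. U (fst z) (snd z)) \<in> borel_measurable unit_sq"
    "\<And>x y. 0 \<le> U x y \<and> U x y \<le> 1" "\<And>x y. U x y = U y x"
    "\<And>A. A \<in> sets unit_sq \<Longrightarrow>
      (\<lambda>k. LINT z|unit_sq. indicator A z * W k z) \<longlonglongrightarrow> (LINT z|unit_sq. indicator A z * U (fst z) (snd z))"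
    "\<And>e. e > 0 \<Longrightarrow> \<exists>K. \<forall>k\<ge>K. cut_norm_le (\<lambda>z. W k z - U (fst z) (snd z)) e"
proof -
  have rect: "Cauchy (\<lambda>k. LINT z|unit_sq. indicator (S \<times> T) z * W k z)"
    if ST: "S \<in> sets unit_lborel" "T \<in> sets unit_lborel" for S T
  proof (rule metric_CauchyI)
    fix e :: real assume "e > 0"
    obtain K where K: "\<forall>k\<ge>K. \<forall>l\<ge>K. cut_norm_le (\<lambda>z. W k z - W l z) (e / 2)"
      using cau[of "e / 2"] \<open>e > 0\<close> by auto
    show "\<exists>K. \<forall>m\<ge>K. \<forall>n\<ge>K. dist (LINT z|unit_sq. indicator (S \<times> T) z * W m z)
      (LINT z|unit_sq. indicator (S \<times> T) z * W n z) < e"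
    proof (intro exI[of _ K] allI impI)
      fix m n assume "m \<ge> K" "n \<ge> K"
      with K have "cut_norm_le (\<lambda>z. W m z - W n z) (e / 2)" by simp
      from cut_norm_le_rectangle[OF this ST]
      have *: "\<bar>LINT z|unit_sq. indicator (S \<times> T) z * (W m z - W n z)\<bar> \<le> e / 2" .
      have int: "integrable unit_sq (\<lambda>z. indicator (S \<times> T) z * W k z)" for k
        using ST W01 by (intro integrable_sq[of _ 1]) (auto simp: indicator_def)
      have "(LINT z|unit_sq. indicator (S \<times> T) z * W m z) - (LINT z|unit_sq. indicator (S \<times> T) z * W n z) =
        (LINT z|unit_sq. indicator (S \<times> T) z * (W m z - W n z))"
        using int by (simp add: right_diff_distrib)
      then show "dist (LINT z|unit_sq. indicator (S \<times> T) z * W m z)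
        (LINT z|unit_sq. indicator (S \<times> T) z * W n z) < e"
        using * \<open>e > 0\<close> by (simp add: dist_real_def)
    qed
  qed
  have W01': "0 \<le> W k z \<and> W k z \<le> 1" if "z \<in> square" for k z by (rule W01)
  obtain V where V[measurable]: "V \<in> borel_measurable unit_sq" and V01: "\<And>z. 0 \<le> V z \<and> V z \<le> 1"
    and V_lim: "\<And>A. A \<in> sets unit_sq \<Longrightarrow>
      (\<lambda>k. LINT z|unit_sq. indicator A z * W k z) \<longlonglongrightarrow> (LINT z|unit_sq. indicator A z * V z)"
    using weak_limit_exists[OF W W01' rect] by blast
  \<comment> \<open>The weak limit is fixed only up to null sets and need not be symmetric. Since
    the \<open>W k\<close> are symmetric, testing with transposed sets gives the same limits, so
    averaging with the transpose is harmless.\<close>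
  define U where "U x y = (V (x, y) + V (y, x)) / 2" for x y
  have U[measurable]: "(\<lambda>z. U (fst z) (snd z)) \<in> borel_measurable unit_sq"
    unfolding U_def by measurable
  have U01: "0 \<le> U x y \<and> U x y \<le> 1" for x y
    using V01[of "(x, y)"] V01[of "(y, x)"] by (auto simp: U_def)
  have U_sym: "U x y = U y x" for x y by (simp add: U_def add.commute)
  have U_lim: "(\<lambda>k. LINT z|unit_sq. indicator A z * W k z) \<longlonglongrightarrow> (LINT z|unit_sq. indicator A z * U (fst z) (snd z))"
    if A[measurable]: "A \<in> sets unit_sq" for A
  proof -
    define A' where "A' = (\<lambda>(x, y). (y, x)) -` A \<inter> space unit_sq"
    have A'[measurable]: "A' \<in> sets unit_sq"
      unfolding A'_def by (rule measurable_sets[OF measurable_pair_swap' A])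
    have A'_iff: "z \<in> A' \<longleftrightarrow> (snd z, fst z) \<in> A" for z
      using sets.sets_into_space[OF A] by (cases z) (auto simp: A'_def space_unit_sq)
    have "(LINT z|unit_sq. indicator A z * W k z) = (LINT z|unit_sq. indicator A' z * W k z)" for k
      using integral_sq_swap[of "\<lambda>z. indicator A z * W k z"] sym[of k]
      by (simp add: indicator_def A'_iff)
    with V_lim[OF A'] have *: "(\<lambda>k. LINT z|unit_sq. indicator A z * W k z) \<longlonglongrightarrow> (LINT z|unit_sq. indicator A' z * V z)"
      by simp
    have "(LINT z|unit_sq. indicator A' z * V z) = (LINT z|unit_sq. indicator A z * V (snd z, fst z))"
      using integral_sq_swap[of "\<lambda>z. indicator A' z * V z"] by (simp add: indicator_def A'_iff)
    with LIMSEQ_unique[OF V_lim[OF A] *] have eq: "(LINT z|unit_sq. indicator A z * V (snd z, fst z)) = (LINT z|unit_sq. indicator A z * V z)"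
      by simp
    have "integrable unit_sq (\<lambda>z. indicator A z * V z)" "integrable unit_sq (\<lambda>z. indicator A z * V (snd z, fst z))"
      using V01 by (auto intro!: integrable_sq[of _ 1] simp: indicator_def)
    then have "(LINT z|unit_sq. indicator A z * U (fst z) (snd z)) =
      ((LINT z|unit_sq. indicator A z * V z) + (LINT z|unit_sq. indicator A z * V (snd z, fst z))) / 2"
      by (simp add: U_def distrib_left add_divide_distrib)
    then show ?thesis using V_lim[OF A] eq by simp
  qed
  have fg_lim: "(\<lambda>k. LINT z|unit_sq. h z * (W k z - U (fst z) (snd z))) \<longlonglongrightarrow> 0"
    if h: "h \<in> borel_measurable unit_sq" "\<And>z. 0 \<le> h z \<and> h z \<le> 1" for h
  proof (rule weakly_null_functions)
    show "\<bar>W k z - U (fst z) (snd z)\<bar> \<le> 1" for k z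
      using W01[of k z] U01[of "fst z" "snd z"] by auto
    fix A assume A[measurable]: "A \<in> sets unit_sq"
    have "integrable unit_sq (\<lambda>z. indicator A z * W k z)" "integrable unit_sq (\<lambda>z. indicator A z * U (fst z) (snd z))" for k
      using W01 U01 by (auto intro!: integrable_sq[of _ 1] simp: indicator_def)
    then have "(LINT z|unit_sq. indicator A z * (W k z - U (fst z) (snd z))) =
      (LINT z|unit_sq. indicator A z * W k z) - (LINT z|unit_sq. indicator A z * U (fst z) (snd z))" for k
      by (simp add: right_diff_distrib)
    then show "(\<lambda>k. LINT z|unit_sq. indicator A z * (W k z - U (fst z) (snd z))) \<longlonglongrightarrow> 0"
      using U_lim[OF A] by (simp add: LIM_zero)
  qed (use h in auto)
  show ?thesis
  proof (rule that[OF U U01 U_sym U_lim])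
    fix e :: real assume "e > 0"
    then obtain K where K: "\<forall>k\<ge>K. \<forall>l\<ge>K. cut_norm_le (\<lambda>z. W k z - W l z) e"
      using cau by blast
    show "\<exists>K. \<forall>k\<ge>K. cut_norm_le (\<lambda>z. W k z - U (fst z) (snd z)) e"
      unfolding cut_norm_le_def
    proof (intro exI[of _ K] allI impI ballI)
      fix k and f g :: "real \<Rightarrow> real"
      assume k: "k \<ge> K" and [measurable]: "f \<in> borel_measurable unit_lborel" "g \<in> borel_measurable unit_lborel"
        and fg: "\<forall>x. 0 \<le> f x \<and> f x \<le> 1" "\<forall>x. 0 \<le> g x \<and> g x \<le> 1"
      let ?h = "\<lambda>z. f (fst z) * g (snd z)"
      have h: "?h \<in> borel_measurable unit_sq" by measurable
      have h01: "0 \<le> ?h z \<and> ?h z \<le> 1" for z using fg by (simp add: mult_le_one)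
      have int: "integrable unit_sq (\<lambda>z. ?h z * W k z)" "integrable unit_sq (\<lambda>z. ?h z * U (fst z) (snd z))" for k
      proof -
        have b: "\<bar>?h z\<bar> \<le> 1" "\<bar>W k z\<bar> \<le> 1" "\<bar>U (fst z) (snd z)\<bar> \<le> 1" for z
          using h01[of z] W01[of k z] U01[of "fst z" "snd z"] by auto
        show "integrable unit_sq (\<lambda>z. ?h z * W k z)" "integrable unit_sq (\<lambda>z. ?h z * U (fst z) (snd z))"
          by (intro integrable_sq[of _ 1] abs_mult_le_left b; measurable)+
      qed
      have eq: "(LINT z|unit_sq. ?h z * (W k z - U (fst z) (snd z))) - (LINT z|unit_sq. ?h z * (W l z - U (fst z) (snd z))) =
        (LINT z|unit_sq. ?h z * (W k z - W l z))" for l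
        using int by (simp add: right_diff_distrib)
      \<comment> \<open>Let l tend to infinity while k and the weights stay fixed.\<close>
      have "(\<lambda>l. LINT z|unit_sq. ?h z * (W k z - W l z)) \<longlonglongrightarrow> (LINT z|unit_sq. ?h z * (W k z - U (fst z) (snd z))) - 0"
        unfolding eq[symmetric] by (intro tendsto_diff tendsto_const fg_lim h h01)
      then have "(\<lambda>l. \<bar>LINT z|unit_sq. ?h z * (W k z - W l z)\<bar>) \<longlonglongrightarrow> \<bar>LINT z|unit_sq. ?h z * (W k z - U (fst z) (snd z))\<bar>"
        by (simp add: tendsto_rabs)
      moreover have "\<bar>LINT z|unit_sq. ?h z * (W k z - W l z)\<bar> \<le> e" if "l \<ge> K" for l
      proof -
        have "cut_norm_le (\<lambda>z. W k z - W l z) e" using K k that by simp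
        from cut_norm_leD[OF this, of f g] show ?thesis using fg by simp
      qed
      ultimately show "\<bar>LINT z|unit_sq. ?h z * (W k z - U (fst z) (snd z))\<bar> \<le> e"
        by (intro LIMSEQ_le_const2) auto
    qed
  qed
qed

section \<open>The counting lemma\<close>

text \<open>The integral of a non-integrable function is 0, so the bound holds in any case. This
  allows an inner integral in the counting step to be bounded without examining its
  measurability.\<close>

lemma (in prob_space) abs_integral_le:
  fixes f :: "'a \<Rightarrow> real"
  assumes "\<And>x. x \<in> space M \<Longrightarrow> \<bar>f x\<bar> \<le> e" "0 \<le> e"
  shows "\<bar>integral\<^sup>L M f\<bar> \<le> e"
proof (cases "integrable M f")
  case True
  have "\<bar>integral\<^sup>L M f\<bar> \<le> (\<integral>x. \<bar>f x\<bar> \<partial>M)"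
    using integral_norm_bound[of M f] by simp
  also have "\<dots> \<le> (\<integral>x. e \<partial>M)"
    using True assms by (intro integral_mono) auto
  finally show ?thesis by (simp add: prob_space)
qed (simp add: not_integrable_integral_eq assms)

lemma cut_norm_le_nonneg: "cut_norm_le D e \<Longrightarrow> 0 \<le> e"
  using cut_norm_leD[of D e "\<lambda>_. 0" "\<lambda>_. 0"] by simp

text \<open>Fix all coordinates except a and b. As {a, b} is not an edge in \<open>E\<close>, no
  factor depends on both of them, and the product splits into a weight in x a times a weight in x b.
  The cut norm bounds the remaining double integral.\<close>

lemma counting_step:
  fixes h :: "nat \<times> nat \<Rightarrow> real \<Rightarrow> real \<Rightarrow> real"
  assumes V: "finite V" "a \<in> V" "b \<in> V" "a \<noteq> b"
    and E: "finite E" "\<And>e. e \<in> E \<Longrightarrow> fst e \<in> V \<and> snd e \<in> V \<and> fst e < snd e \<and> {fst e, snd e} \<noteq> {a, b}"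
    and h: "\<And>e. (\<lambda>z. h e (fst z) (snd z)) \<in> borel_measurable unit_sq" and h01: "\<And>e x y. 0 \<le> h e x y \<and> h e x y \<le> 1"
    and D: "D \<in> borel_measurable unit_sq" "\<And>z. \<bar>D z\<bar> \<le> 1" and cut: "cut_norm_le D c"
  shows "\<bar>LINT x|(\<Pi>\<^sub>M _\<in>V. unit_lborel). D (x a, x b) * (\<Prod>e\<in>E. h e (x (fst e)) (x (snd e)))\<bar> \<le> c"
proof -
  let ?P = "\<lambda>V. \<Pi>\<^sub>M _\<in>V::nat set. unit_lborel"
  define J where "J = {a, b}"
  define I where "I = V - J"
  have IJ: "I \<inter> J = {}" "I \<union> J = V" "finite I" "finite J"
    using V by (auto simp: I_def J_def)
  interpret V: product_prob_space "\<lambda>_. unit_lborel" V ..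
  interpret I: product_prob_space "\<lambda>_. unit_lborel" I ..
  let ?G = "\<lambda>x. D (x a, x b) * (\<Prod>e\<in>E. h e (x (fst e)) (x (snd e)))"
  have prod01: "0 \<le> (\<Prod>e\<in>E'. h e (f e) (g e)) \<and> (\<Prod>e\<in>E'. h e (f e) (g e)) \<le> 1" for E' f g
    using h01 by (auto intro!: prod_nonneg prod_le_1)
  have Gm: "?G \<in> borel_measurable (?P V)"
  proof (intro borel_measurable_times borel_measurable_prod)
    show "(\<lambda>x. D (x a, x b)) \<in> borel_measurable (?P V)"
      using measurable_cube_pair[OF V(2,3), of "curry D"] D(1) by simp
    show "(\<lambda>x. h e (x (fst e)) (x (snd e))) \<in> borel_measurable (?P V)" if "e \<in> E" for e
      using E(2)[OF that] by (intro measurable_cube_pair h) auto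
  qed
  have Gb: "\<bar>?G x\<bar> \<le> 1" for x
    using prod01[of "\<lambda>e. x (fst e)" "\<lambda>e. x (snd e)" E] D(2) by (intro abs_mult_le_left) auto
  have Gi: "integrable (?P (I \<union> J)) ?G"
    unfolding IJ by (rule V.P.integrable_const_bound[of _ 1]) (use Gm Gb in auto)
  have inner: "\<bar>LINT y|?P J. ?G (merge I J (x, y))\<bar> \<le> c" if x: "x \<in> space (?P I)" for x
  proof -
    \<comment> \<open>The fixed point with s and t inserted at a and b. A factor that sees only one
      of them may be evaluated with 0 in place of the other.\<close>
    define m where "m s t v = (if v = a then s else if v = b then t else x v)" for s t :: real and v
    have m_meas: "(\<lambda>s. m s 0 v) \<in> unit_lborel \<rightarrow>\<^sub>M unit_lborel" "(\<lambda>t. m 0 t v) \<in> unit_lborel \<rightarrow>\<^sub>M unit_lborel"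
      if "v \<in> V" for v
    proof -
      have "x v \<in> space unit_lborel" if "v \<noteq> a" "v \<noteq> b"
        using x \<open>v \<in> V\<close> that by (auto simp: space_PiM I_def J_def PiE_def Pi_def)
      moreover have "0 \<in> space unit_lborel" by simp
      ultimately show "(\<lambda>s. m s 0 v) \<in> unit_lborel \<rightarrow>\<^sub>M unit_lborel" "(\<lambda>t. m 0 t v) \<in> unit_lborel \<rightarrow>\<^sub>M unit_lborel"
        by (cases "v = a"; cases "v = b"; simp add: m_def)+
    qed
    have pair_meas: "(\<lambda>s. h e (f s (fst e)) (f s (snd e))) \<in> borel_measurable unit_lborel"
      if "e \<in> E" "\<And>v. v \<in> V \<Longrightarrow> (\<lambda>s. f s v) \<in> unit_lborel \<rightarrow>\<^sub>M unit_lborel" for e f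
    proof -
      have "(\<lambda>s. (f s (fst e), f s (snd e))) \<in> unit_lborel \<rightarrow>\<^sub>M unit_sq"
        using that E(2) by (intro measurable_Pair) auto
      from measurable_compose[OF this h[of e]] show ?thesis by simp
    qed
    \<comment> \<open>Factors that involve neither a nor b are put with those at b.\<close>
    define Ea where "Ea = {e \<in> E. a \<in> {fst e, snd e}}"
    define f where "f s = (\<Prod>e\<in>Ea. h e (m s 0 (fst e)) (m s 0 (snd e)))" for s
    define g where "g t = (\<Prod>e\<in>E - Ea. h e (m 0 t (fst e)) (m 0 t (snd e)))" for t
    have f: "f \<in> borel_measurable unit_lborel"
      unfolding f_def by (intro borel_measurable_prod pair_meas m_meas) (auto simp: Ea_def)
    have g: "g \<in> borel_measurable unit_lborel"
      unfolding g_def by (intro borel_measurable_prod pair_meas m_meas) auto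
    have fg: "(\<Prod>e\<in>E. h e (m s t (fst e)) (m s t (snd e))) = f s * g t" for s t
    proof -
      have "(\<Prod>e\<in>E. h e (m s t (fst e)) (m s t (snd e))) =
        (\<Prod>e\<in>E - Ea. h e (m s t (fst e)) (m s t (snd e))) * (\<Prod>e\<in>Ea. h e (m s t (fst e)) (m s t (snd e)))"
        by (rule prod.subset_diff) (auto simp: Ea_def E)
      also have "(\<Prod>e\<in>Ea. h e (m s t (fst e)) (m s t (snd e))) = f s"
        unfolding f_def using E(2) by (intro prod.cong) (fastforce simp: Ea_def m_def)+
      also have "(\<Prod>e\<in>E - Ea. h e (m s t (fst e)) (m s t (snd e))) = g t"
        unfolding g_def by (intro prod.cong) (auto simp: Ea_def m_def)
      finally show ?thesis by simp
    qed
    have "merge I J (x, y) v = m (y a) (y b) v" if "v \<in> V" for y v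
      using that IJ by (auto simp: merge_def m_def I_def J_def)
    then have "?G (merge I J (x, y)) = f (y a) * g (y b) * D (y a, y b)" for y
      using E(2) V fg[of "y a" "y b"] by (simp add: m_def[of _ _ a] m_def[of _ _ b] cong: prod.cong)
    then have "(LINT y|?P J. ?G (merge I J (x, y))) = (LINT y|?P J. (\<lambda>z. f (fst z) * g (snd z) * D z) (y a, y b))"
      by simp
    also have "\<dots> = (LINT z|distr (?P J) unit_sq (\<lambda>y. (y a, y b)). f (fst z) * g (snd z) * D z)"
      using f g D by (intro integral_distr[symmetric]) (auto simp: J_def)
    also have "distr (?P J) unit_sq (\<lambda>y. (y a, y b)) = unit_sq"
      using V by (intro distr_cube_pair) (auto simp: J_def)
    finally have "(LINT y|?P J. ?G (merge I J (x, y))) = (LINT z|unit_sq. f (fst z) * g (snd z) * D z)" .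
    moreover have "\<bar>LINT z|unit_sq. f (fst z) * g (snd z) * D z\<bar> \<le> c"
      by (rule cut_norm_leD[OF cut f g]) (auto simp: f_def g_def prod01)
    ultimately show ?thesis by simp
  qed
  have "(LINT x|?P V. ?G x) = (LINT x|?P I. LINT y|?P J. ?G (merge I J (x, y)))"
    using cube.product_integral_fold[OF IJ(1,3,4) Gi] IJ(2) by simp
  then show ?thesis
    using I.P.abs_integral_le[OF inner cut_norm_le_nonneg[OF cut]] by simp
qed

text \<open>Telescoping: edges in \<open>A\<close> carry W and edges in \<open>B\<close> carry U,
  and moving one edge from \<open>A\<close> to \<open>B\<close> costs at most c.\<close>

lemma counting_aux:
  fixes U W :: "real \<Rightarrow> real \<Rightarrow> real" and A B :: "(nat \<times> nat) set"
  assumes V: "finite V" and E: "finite A" "finite B" "A \<inter> B = {}" "\<And>e. e \<in> A \<union> B \<Longrightarrow> fst e \<in> V \<and> snd e \<in> V \<and> fst e < snd e"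
    and U: "(\<lambda>z. U (fst z) (snd z)) \<in> borel_measurable unit_sq" "\<And>x y. 0 \<le> U x y \<and> U x y \<le> 1"
    and W: "(\<lambda>z. W (fst z) (snd z)) \<in> borel_measurable unit_sq" "\<And>x y. 0 \<le> W x y \<and> W x y \<le> 1"
    and cut: "cut_norm_le (\<lambda>z. W (fst z) (snd z) - U (fst z) (snd z)) c"
  shows "\<bar>(LINT x|(\<Pi>\<^sub>M _\<in>V. unit_lborel). (\<Prod>e\<in>A. W (x (fst e)) (x (snd e))) * (\<Prod>e\<in>B. U (x (fst e)) (x (snd e)))) -
    (LINT x|(\<Pi>\<^sub>M _\<in>V. unit_lborel). (\<Prod>e\<in>A \<union> B. U (x (fst e)) (x (snd e))))\<bar> \<le> real (card A) * c"
  using E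
proof (induction A arbitrary: B rule: finite_induct)
  case empty
  then show ?case by simp
next
  case (insert p A)
  let ?M = "\<Pi>\<^sub>M _\<in>V. unit_lborel"
  interpret V: product_prob_space "\<lambda>_. unit_lborel" V ..
  let ?w = "\<lambda>(A :: (nat \<times> nat) set) x. \<Prod>e\<in>A. W (x (fst e)) (x (snd e))" and ?u = "\<lambda>(A :: (nat \<times> nat) set) x. \<Prod>e\<in>A. U (x (fst e)) (x (snd e))"
  have int: "integrable ?M (\<lambda>x. ?w A' x * ?u B' x)" if "A' \<subseteq> insert p A \<union> B" "B' \<subseteq> insert p A \<union> B" for A' B'
  proof (rule V.P.integrable_const_bound[of _ 1])
    show "(\<lambda>x. ?w A' x * ?u B' x) \<in> borel_measurable ?M"
      using insert.prems(3) that by (intro borel_measurable_times borel_measurable_prod measurable_cube_pair U W) blast+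
    show "AE x in ?M. norm (?w A' x * ?u B' x) \<le> 1"
      using U(2) W(2) by (intro AE_I2) (simp add: abs_mult abs_prod mult_le_one prod_le_1 prod_nonneg)
  qed
  have IH: "\<bar>(LINT x|?M. ?w A x * ?u (insert p B) x) - (LINT x|?M. ?u (A \<union> insert p B) x)\<bar> \<le> real (card A) * c"
    using insert.hyps insert.prems by (intro insert.IH) auto
  define h where "h e = (if e \<in> A then W else U)" for e
  have "(LINT x|?M. ?w (insert p A) x * ?u B x) - (LINT x|?M. ?w A x * ?u (insert p B) x) =
    (LINT x|?M. ?w (insert p A) x * ?u B x - ?w A x * ?u (insert p B) x)"
    by (intro Bochner_Integration.integral_diff[symmetric] int) auto
  also have "\<dots> = (LINT x|?M. (\<lambda>z. W (fst z) (snd z) - U (fst z) (snd z)) (x (fst p), x (snd p)) *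
    (\<Prod>e\<in>A \<union> B. h e (x (fst e)) (x (snd e))))"
  proof (intro Bochner_Integration.integral_cong refl)
    fix x :: "nat \<Rightarrow> real"
    have "(\<Prod>e\<in>A \<union> B. h e (x (fst e)) (x (snd e))) = (\<Prod>e\<in>A. h e (x (fst e)) (x (snd e))) * (\<Prod>e\<in>B. h e (x (fst e)) (x (snd e)))"
      using insert.prems insert.hyps by (intro prod.union_disjoint) auto
    also have "\<dots> = ?w A x * ?u B x"
      using insert.prems(2) by (intro arg_cong2[of _ _ _ _ times] prod.cong) (auto simp: h_def)
    finally show "?w (insert p A) x * ?u B x - ?w A x * ?u (insert p B) x =
      (\<lambda>z. W (fst z) (snd z) - U (fst z) (snd z)) (x (fst p), x (snd p)) * (\<Prod>e\<in>A \<union> B. h e (x (fst e)) (x (snd e)))"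
      using insert.prems insert.hyps by (simp add: algebra_simps)
  qed
  also have "\<bar>\<dots>\<bar> \<le> c"
  proof (rule counting_step[OF V])
    show "(\<lambda>z. W (fst z) (snd z) - U (fst z) (snd z)) \<in> borel_measurable unit_sq" using U(1) W(1) by simp
    show "\<bar>W (fst z) (snd z) - U (fst z) (snd z)\<bar> \<le> 1" for z
      using U(2)[of "fst z" "snd z"] W(2)[of "fst z" "snd z"] by auto
    show "fst e \<in> V \<and> snd e \<in> V \<and> fst e < snd e \<and> {fst e, snd e} \<noteq> {fst p, snd p}" if "e \<in> A \<union> B" for e
    proof -
      have "e \<noteq> p" using that insert.hyps insert.prems by auto
      moreover have "fst e < snd e" "fst p < snd p" "fst e \<in> V" "snd e \<in> V" using that insert.prems(3) by auto
      ultimately show ?thesis by (auto simp: doubleton_eq_iff prod_eq_iff)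
    qed
    show "(\<lambda>z. h e (fst z) (snd z)) \<in> borel_measurable unit_sq" for e using U W by (simp add: h_def)
    show "0 \<le> h e x y \<and> h e x y \<le> 1" for e x y using U(2) W(2) by (simp add: h_def)
  qed (use insert.prems insert.hyps cut in \<open>auto simp: less_imp_neq\<close>)
  finally have "\<bar>(LINT x|?M. ?w (insert p A) x * ?u B x) - (LINT x|?M. ?w A x * ?u (insert p B) x)\<bar> \<le> c" .
  moreover have "A \<union> insert p B = insert p A \<union> B" by auto
  ultimately show ?case using IH insert.hyps by (simp add: distrib_right)
qed

lemma counting_lemma:
  fixes U W :: "real \<Rightarrow> real \<Rightarrow> real"
  assumes F: "simple_graph F"
    and U: "(\<lambda>z. U (fst z) (snd z)) \<in> borel_measurable unit_sq" "\<And>x y. 0 \<le> U x y \<and> U x y \<le> 1"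
    and W: "(\<lambda>z. W (fst z) (snd z)) \<in> borel_measurable unit_sq" "\<And>x y. 0 \<le> W x y \<and> W x y \<le> 1"
    and cut: "cut_norm_le (\<lambda>z. W (fst z) (snd z) - U (fst z) (snd z)) c"
  shows "\<bar>t_fun F W - t_fun F U\<bar> \<le> real (card (edge_pairs F)) * c"
proof -
  have "fst e \<in> verts F \<and> snd e \<in> verts F \<and> fst e < snd e" if "e \<in> edge_pairs F" for e
    using edge_pairs_sub[OF F, of "fst e" "snd e"] that by (auto simp: edge_pairs_def)
  then show ?thesis
    using counting_aux[of "verts F" "edge_pairs F" "{}", OF _ finite_edge_pairs[OF F] _ _ _ U W cut] F
    by (simp add: t_fun_borel_cong[OF F U(1)] t_fun_borel_cong[OF F W(1)] case_prod_unfold simple_graph_def)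
qed

section \<open>Step functions and graphs\<close>

text \<open>The ceiling gives cells closed on the right, as in \<open>W_graph\<close>. Clamping puts
  the point 0 into the first cell and gives every real number an index.\<close>

definition cell :: "nat \<Rightarrow> real \<Rightarrow> nat" where
  "cell n x = nat (max 1 (min (int n) \<lceil>real n * x\<rceil>))"

lemma cell_range: "n > 0 \<Longrightarrow> cell n x \<in> {1..n}"
  by (auto simp: cell_def)

lemma cell_eq_iff:
  assumes "i \<in> {1..n}" "x \<in> {0<..1}"
  shows "cell n x = i \<longleftrightarrow> x \<in> {(real i - 1) / real n <.. real i / real n}"
proof -
  have n: "real n > 0" using assms by auto
  have "0 < real n * x" "real n * x \<le> real n" using assms n by (auto simp: mult_left_le)
  then have "1 \<le> \<lceil>real n * x\<rceil>" "\<lceil>real n * x\<rceil> \<le> int n" by (simp_all add: ceiling_le_iff)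
  then have "cell n x = nat \<lceil>real n * x\<rceil>" "\<lceil>real n * x\<rceil> > 0" by (simp_all add: cell_def)
  then have "cell n x = i \<longleftrightarrow> \<lceil>real n * x\<rceil> = int i" by auto
  also have "\<dots> \<longleftrightarrow> real i - 1 < real n * x \<and> real n * x \<le> real i" by (auto simp: ceiling_eq_iff)
  also have "\<dots> \<longleftrightarrow> x \<in> {(real i - 1) / real n <.. real i / real n}"
    using n by (auto simp: field_simps)
  finally show ?thesis .
qed

lemma cell_measurable [measurable]: "cell n \<in> unit_lborel \<rightarrow>\<^sub>M count_space UNIV"
  unfolding cell_def by (intro measurable_restrict_space1) measurable

definition cell_set :: "nat \<Rightarrow> nat \<Rightarrow> real set" where
  "cell_set n i = {x \<in> {0..1}. cell n x = i}"

lemma cell_set_measurable [measurable]: "cell_set n i \<in> sets unit_lborel"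
proof -
  have "cell_set n i = cell n -` {i} \<inter> space unit_lborel" by (auto simp: cell_set_def)
  then show ?thesis using measurable_sets[OF cell_measurable, of "{i}" n] by simp
qed

lemma AE_unit_pos: "AE x in unit_lborel. x \<in> {0<..1}"
proof -
  have "AE x in unit_lborel. x \<noteq> 0"
    by (subst AE_restrict_space_iff) (auto intro: eventually_mono[OF AE_lborel_singleton[of 0]])
  then show ?thesis using AE_space by eventually_elim auto
qed

lemma measure_cell_set:
  assumes "i \<in> {1..n}"
  shows "measure unit_lborel (cell_set n i) = 1 / real n"
proof -
  have n: "real n > 0" using assms by auto
  let ?C = "{(real i - 1) / real n <.. real i / real n}"
  have "0 \<le> (real i - 1) / real n" "real i / real n \<le> 1" using assms n by simp_all
  then have sub: "?C \<subseteq> {0..1}" by (auto intro: order.trans less_imp_le)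
  have C: "?C \<in> sets unit_lborel" using sub by (auto simp: sets_restrict_space_iff)
  have "measure unit_lborel (cell_set n i) = measure unit_lborel ?C"
  proof (rule unit.finite_measure_eq_AE)
    show "AE x in unit_lborel. x \<in> cell_set n i \<longleftrightarrow> x \<in> ?C"
      using AE_unit_pos by eventually_elim (use cell_eq_iff[OF assms] in \<open>auto simp: cell_set_def\<close>)
  qed (use C in auto)
  also have "\<dots> = measure lborel ?C"
    using sub by (subst measure_restrict_space) auto
  also have "\<dots> = 1 / real n" using n by (simp add: divide_right_mono diff_divide_distrib)
  finally show ?thesis .
qed

lemma sum_cell_indicator:
  fixes c :: "nat \<Rightarrow> real"
  assumes "n > 0" "x \<in> {0..1}"
  shows "(\<Sum>i=1..n. c i * indicator (cell_set n i) x) = c (cell n x)"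
proof -
  have "(\<Sum>i=1..n. c i * indicator (cell_set n i) x) = (\<Sum>i\<in>{1..n}. if i = cell n x then c i else 0)"
    using assms by (intro sum.cong) (auto simp: cell_set_def indicator_def)
  then show ?thesis using cell_range[OF assms(1), of x] by simp
qed

lemma step_measurable:
  fixes w :: "nat \<Rightarrow> nat \<Rightarrow> real"
  shows "(\<lambda>z. w (cell n (fst z)) (cell n (snd z))) \<in> borel_measurable unit_sq"
proof -
  have "(\<lambda>z. (cell n (fst z), cell n (snd z))) \<in> unit_sq \<rightarrow>\<^sub>M count_space UNIV \<Otimes>\<^sub>M count_space UNIV"
    by measurable
  moreover have "case_prod w \<in> borel_measurable (count_space UNIV \<Otimes>\<^sub>M count_space UNIV)"
    by (simp add: pair_measure_countable)
  ultimately show ?thesis using measurable_compose by fastforce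
qed

lemma integral_sq_product:
  fixes f g :: "real \<Rightarrow> real"
  assumes "integrable unit_lborel f" "integrable unit_lborel g"
  shows "(LINT z|unit_sq. f (fst z) * g (snd z)) = integral\<^sup>L unit_lborel f * integral\<^sup>L unit_lborel g"
  and "integrable unit_sq (\<lambda>z. f (fst z) * g (snd z))"
proof -
  show int: "integrable unit_sq (\<lambda>z. f (fst z) * g (snd z))"
  proof (rule sq.Fubini_integrable)
    show "AE x in unit_lborel. integrable unit_lborel (\<lambda>y. f (fst (x, y)) * g (snd (x, y)))"
      using assms by simp
    show "integrable unit_lborel (\<lambda>x. LINT y|unit_lborel. norm (f (fst (x, y)) * g (snd (x, y))))"
      using assms by (simp add: abs_mult)
    show "(\<lambda>z. f (fst z) * g (snd z)) \<in> borel_measurable unit_sq"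
      using assms[THEN borel_measurable_integrable] by measurable
  qed
  show "(LINT z|unit_sq. f (fst z) * g (snd z)) = integral\<^sup>L unit_lborel f * integral\<^sup>L unit_lborel g"
    using sq.integral_fst'[OF int] by simp
qed

lemma integral_step_weighted:
  fixes f g :: "real \<Rightarrow> real" and w :: "nat \<Rightarrow> nat \<Rightarrow> real"
  assumes n: "n > 0" and f: "f \<in> borel_measurable unit_lborel" "\<And>x. 0 \<le> f x \<and> f x \<le> 1"
    and g: "g \<in> borel_measurable unit_lborel" "\<And>x. 0 \<le> g x \<and> g x \<le> 1"
  shows "(LINT z|unit_sq. f (fst z) * g (snd z) * w (cell n (fst z)) (cell n (snd z))) =
    (\<Sum>i=1..n. \<Sum>j=1..n. (LINT x|unit_lborel. f x * indicator (cell_set n i) x) *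
       (LINT y|unit_lborel. g y * indicator (cell_set n j) y) * w i j)"
proof -
  let ?f = "\<lambda>i x. f x * indicator (cell_set n i) x" and ?g = "\<lambda>j x. g x * indicator (cell_set n j) x"
  have int: "integrable unit_lborel (?f i)" "integrable unit_lborel (?g i)" for i
    using f g by (auto intro!: unit.integrable_const_bound[of _ 1] simp: abs_mult indicator_def)
  have "(LINT z|unit_sq. f (fst z) * g (snd z) * w (cell n (fst z)) (cell n (snd z))) =
    (LINT z|unit_sq. (\<Sum>i=1..n. \<Sum>j=1..n. ?f i (fst z) * ?g j (snd z) * w i j))"
  proof (intro Bochner_Integration.integral_cong refl)
    fix z assume "z \<in> space unit_sq"
    then have z: "fst z \<in> {0..1}" "snd z \<in> {0..1}" by (auto simp: space_unit_sq)
    have "(\<Sum>i=1..n. \<Sum>j=1..n. ?f i (fst z) * ?g j (snd z) * w i j) =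
      (\<Sum>i=1..n. (f (fst z) * g (snd z) * (\<Sum>j=1..n. w i j * indicator (cell_set n j) (snd z))) * indicator (cell_set n i) (fst z))"
      unfolding sum_distrib_left sum_distrib_right by (intro sum.cong refl) (simp only: mult_ac)
    also have "\<dots> = f (fst z) * g (snd z) * w (cell n (fst z)) (cell n (snd z))"
      unfolding sum_cell_indicator[OF n z(1)] sum_cell_indicator[OF n z(2)] ..
    finally show "f (fst z) * g (snd z) * w (cell n (fst z)) (cell n (snd z)) =
      (\<Sum>i=1..n. \<Sum>j=1..n. ?f i (fst z) * ?g j (snd z) * w i j)" by simp
  qed
  also have "\<dots> = (\<Sum>i=1..n. \<Sum>j=1..n. (LINT z|unit_sq. ?f i (fst z) * ?g j (snd z) * w i j))"
    by (subst Bochner_Integration.integral_sum; (intro sum.cong refl Bochner_Integration.integral_sum)?)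
       (intro Bochner_Integration.integrable_sum integrable_mult_left integral_sq_product(2) int)+
  finally show ?thesis using integral_sq_product(1)[OF int(1) int(2)] by simp
qed

lemma integral_cell_bounds:
  assumes i: "i \<in> {1..n}" and f: "f \<in> borel_measurable unit_lborel" "\<And>x. 0 \<le> f x \<and> f x \<le> (1::real)"
  shows "0 \<le> real n * (LINT x|unit_lborel. f x * indicator (cell_set n i) x)"
    "real n * (LINT x|unit_lborel. f x * indicator (cell_set n i) x) \<le> 1"
proof -
  show "0 \<le> real n * (LINT x|unit_lborel. f x * indicator (cell_set n i) x)"
    using f by (intro mult_nonneg_nonneg integral_nonneg_AE) auto
  have "(LINT x|unit_lborel. f x * indicator (cell_set n i) x) \<le> (LINT x|unit_lborel. indicator (cell_set n i) x)"
    using f by (intro integral_mono unit.integrable_const_bound[of _ 1]) (auto simp: abs_mult indicator_def)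
  also have "\<dots> = 1 / real n"
    using measure_cell_set[OF i] by (simp add: cell_set_def Int_absorb2 subset_eq)
  finally show "real n * (LINT x|unit_lborel. f x * indicator (cell_set n i) x) \<le> 1"
    using i by (simp add: field_simps)
qed

lemma integral_step:
  assumes "n > 0"
  shows "(LINT z|unit_sq. w (cell n (fst z)) (cell n (snd z))) = (\<Sum>i=1..n. \<Sum>j=1..n. w i j) / (real n)\<^sup>2"
proof -
  have "(LINT x|unit_lborel. 1 * indicator (cell_set n i) x) = 1 / real n" if "i \<in> {1..n}" for i
    using measure_cell_set[OF that] by (simp add: cell_set_def Int_absorb2 subset_eq)
  note cell = this
  have "(\<Sum>i=1..n. \<Sum>j=1..n. (LINT x|unit_lborel. 1 * indicator (cell_set n i) x) *
       (LINT y|unit_lborel. 1 * indicator (cell_set n j) y) * w i j) = (\<Sum>i=1..n. \<Sum>j=1..n. w i j / (real n)\<^sup>2)"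
    by (intro sum.cong refl) (simp only: cell, simp add: power2_eq_square)
  moreover have "(LINT z|unit_sq. w (cell n (fst z)) (cell n (snd z))) =
    (LINT z|unit_sq. 1 * 1 * w (cell n (fst z)) (cell n (snd z)))" by simp
  moreover have "(LINT z|unit_sq. 1 * 1 * w (cell n (fst z)) (cell n (snd z))) =
    (\<Sum>i=1..n. \<Sum>j=1..n. (LINT x|unit_lborel. 1 * indicator (cell_set n i) x) *
       (LINT y|unit_lborel. 1 * indicator (cell_set n j) y) * w i j)"
    by (rule integral_step_weighted[OF assms]) auto
  ultimately show ?thesis by (simp only: sum_divide_distrib)
qed

text \<open>Weights enter the integral of a step function only through their averages on the cells,
  and these averages are weights on the indices.\<close>

lemma cut_norm_le_step:
  assumes n: "n > 0" and M: "cut_le {1..n} M c"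
  shows "cut_norm_le (\<lambda>z. M (cell n (fst z)) (cell n (snd z))) (c / (real n)\<^sup>2)"
  unfolding cut_norm_le_def
proof (intro ballI impI)
  fix f g :: "real \<Rightarrow> real"
  assume f: "f \<in> borel_measurable unit_lborel" "\<forall>x. 0 \<le> f x \<and> f x \<le> 1"
    and g: "g \<in> borel_measurable unit_lborel" "\<forall>x. 0 \<le> g x \<and> g x \<le> 1"
  define F where "F i = real n * (LINT x|unit_lborel. f x * indicator (cell_set n i) x)" for i
  define G where "G i = real n * (LINT x|unit_lborel. g x * indicator (cell_set n i) x)" for i
  have "\<bar>\<Sum>i=1..n. \<Sum>j=1..n. F i * G j * M i j\<bar> \<le> c"
    using f g by (intro cut_le_weighted[OF _ M]) (auto simp: F_def G_def intro!: integral_cell_bounds)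
  moreover have "(\<Sum>i=1..n. \<Sum>j=1..n. F i * G j * M i j) =
    (real n)\<^sup>2 * (LINT z|unit_sq. f (fst z) * g (snd z) * M (cell n (fst z)) (cell n (snd z)))"
    using f g by (subst integral_step_weighted[OF n])
      (auto simp: F_def G_def sum_distrib_left power2_eq_square mult_ac)
  ultimately show "\<bar>LINT z|unit_sq. f (fst z) * g (snd z) * M (cell n (fst z)) (cell n (snd z))\<bar> \<le> c / (real n)\<^sup>2"
    using n by (simp add: abs_mult field_simps)
qed

section \<open>Graphs as step functions\<close>

definition adj :: "graph \<Rightarrow> nat \<Rightarrow> nat \<Rightarrow> real" where
  "adj H u v = of_bool ({u, v} \<in> edges H)"

lemma adj_sym: "adj H u v = adj H v u"
  by (simp add: adj_def insert_commute)

text \<open>\<open>\<sigma>\<close> lists the vertices along the unit interval. The order is left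
  open because densities do not depend on it and the compactness proof has to choose it.\<close>

definition graph_step :: "graph \<Rightarrow> (nat \<Rightarrow> nat) \<Rightarrow> real \<Rightarrow> real \<Rightarrow> real" where
  "graph_step H \<sigma> x y = adj H (\<sigma> (cell (card (verts H)) x)) (\<sigma> (cell (card (verts H)) y))"

lemma graph_step_measurable: "(\<lambda>z. graph_step H \<sigma> (fst z) (snd z)) \<in> borel_measurable unit_sq"
  unfolding graph_step_def by (rule step_measurable)

lemma graph_step_01: "0 \<le> graph_step H \<sigma> x y \<and> graph_step H \<sigma> x y \<le> 1"
  by (simp add: graph_step_def adj_def)

lemma graph_step_sym: "graph_step H \<sigma> x y = graph_step H \<sigma> y x"
  by (simp add: graph_step_def adj_sym)

lemma prod_edge_pairs_adj:
  assumes F: "simple_graph F"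
  shows "(\<Prod>(i, j)\<in>edge_pairs F. adj H (\<phi> i) (\<phi> j)) = of_bool (\<forall>e\<in>edges F. \<phi> ` e \<in> edges H)"
proof -
  have "(\<forall>e\<in>edges F. \<phi> ` e \<in> edges H) \<longleftrightarrow> (\<forall>(i, j)\<in>edge_pairs F. {\<phi> i, \<phi> j} \<in> edges H)"
  proof safe
    fix i j assume "\<forall>e\<in>edges F. \<phi> ` e \<in> edges H" "(i, j) \<in> edge_pairs F"
    then have "\<phi> ` {i, j} \<in> edges H" unfolding edge_pairs_def by blast
    then show "{\<phi> i, \<phi> j} \<in> edges H" by simp
  next
    fix e assume *: "\<forall>(i, j)\<in>edge_pairs F. {\<phi> i, \<phi> j} \<in> edges H" and e: "e \<in> edges F"
    then have "card e = 2" using F by (auto simp: simple_graph_def all_pairs_def)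
    then obtain a b where ab: "e = {a, b}" "a \<noteq> b" by (auto simp: card_2_iff)
    then have "(min a b, max a b) \<in> edge_pairs F"
      using e by (auto simp: edge_pairs_def min_def max_def insert_commute)
    with * have "{\<phi> (min a b), \<phi> (max a b)} \<in> edges H" by blast
    then show "\<phi> ` e \<in> edges H" using ab by (auto simp: min_def max_def insert_commute split: if_splits)
  qed
  moreover have "(\<Prod>p\<in>A. of_bool (P p) :: real) = of_bool (\<forall>p\<in>A. P p)" if "finite A" for A :: "(nat \<times> nat) set" and P
    using that by (induction A rule: finite_induct) auto
  ultimately show ?thesis
    using finite_edge_pairs[OF F] by (simp add: adj_def case_prod_unfold)
qed

text \<open>The cube splits into boxes of equal measure, one for each map from the nodes of F to the
  cells. The integrand is 1 on a box if the map is a homomorphism and 0 otherwise.\<close>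

lemma t_fun_graph_step:
  assumes F: "simple_graph F" and n: "card (verts H) > 0" and \<sigma>: "bij_betw \<sigma> {1..card (verts H)} (verts H)"
  shows "t_fun F (graph_step H \<sigma>) = t_graph F H"
proof -
  let ?n = "card (verts H)" and ?V = "verts F"
  let ?M = "\<Pi>\<^sub>M _\<in>?V. unit_lborel"
  interpret V: product_prob_space "\<lambda>_. unit_lborel" ?V ..
  have V: "finite ?V" using F by (simp add: simple_graph_def)
  define P where "P \<phi> \<longleftrightarrow> (\<forall>e\<in>edges F. \<phi> ` e \<in> edges H)" for \<phi>
  define \<Phi> where "\<Phi> = ?V \<rightarrow>\<^sub>E {1..?n}"
  have fin: "finite \<Phi>" unfolding \<Phi>_def using V by (intro finite_PiE) auto
  define box where "box \<phi> = Pi\<^sub>E ?V (\<lambda>v. cell_set ?n (\<phi> v))" for \<phi>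
  have box: "box \<phi> \<in> sets ?M" for \<phi> unfolding box_def using V by (intro sets_PiM_I_finite) auto
  have m_box: "measure ?M (box \<phi>) = (1 / real ?n) ^ card ?V" if "\<phi> \<in> \<Phi>" for \<phi>
  proof -
    have "emeasure ?M (box \<phi>) = (\<Prod>v\<in>?V. emeasure unit_lborel (cell_set ?n (\<phi> v)))"
      unfolding box_def using V by (intro cube.emeasure_PiM) auto
    also have "\<dots> = (\<Prod>v\<in>?V. ennreal (1 / real ?n))"
      using that by (intro prod.cong refl) (auto simp: unit.emeasure_eq_measure measure_cell_set \<Phi>_def PiE_def Pi_def)
    also have "\<dots> = ennreal ((1 / real ?n) ^ card ?V)" by (simp add: ennreal_power)
    finally show ?thesis by (simp add: measure_def)
  qed
  have edge_in: "i \<in> e \<Longrightarrow> e \<in> edges F \<Longrightarrow> i \<in> ?V" for i e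
    using F by (auto simp: simple_graph_def all_pairs_def)
  have "t_fun F (graph_step H \<sigma>) = (LINT x|?M. (\<Prod>(i, j)\<in>edge_pairs F. graph_step H \<sigma> (x i) (x j)))"
    by (rule t_fun_borel_cong[OF F graph_step_measurable]) auto
  also have "\<dots> = (LINT x|?M. (\<Sum>\<phi>\<in>\<Phi>. of_bool (P (\<lambda>v. \<sigma> (\<phi> v))) * indicator (box \<phi>) x))"
  proof (intro Bochner_Integration.integral_cong refl)
    fix x assume x: "x \<in> space ?M"
    define \<psi> where "\<psi> = (\<lambda>v\<in>?V. cell ?n (x v))"
    have \<psi>: "\<psi> \<in> \<Phi>" using cell_range[OF n] by (auto simp: \<psi>_def \<Phi>_def)
    have "x \<in> box \<phi> \<longleftrightarrow> \<phi> = \<psi>" if "\<phi> \<in> \<Phi>" for \<phi>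
      using that x by (auto simp: box_def \<psi>_def \<Phi>_def cell_set_def space_PiM PiE_iff extensional_def fun_eq_iff)
    then have "(\<Sum>\<phi>\<in>\<Phi>. of_bool (P (\<lambda>v. \<sigma> (\<phi> v))) * indicator (box \<phi>) x) =
      (\<Sum>\<phi>\<in>\<Phi>. if \<phi> = \<psi> then of_bool (P (\<lambda>v. \<sigma> (\<phi> v))) else (0::real))"
      by (intro sum.cong) (auto simp: indicator_def)
    also have "\<dots> = of_bool (P (\<lambda>v. \<sigma> (\<psi> v)))" using \<psi> fin by simp
    also have "P (\<lambda>v. \<sigma> (\<psi> v)) \<longleftrightarrow> P (\<lambda>v. \<sigma> (cell ?n (x v)))"
      unfolding P_def
    proof (intro ball_cong refl)
      fix e assume "e \<in> edges F"
      then have "(\<lambda>v. \<sigma> (\<psi> v)) ` e = (\<lambda>v. \<sigma> (cell ?n (x v))) ` e"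
        using edge_in by (intro image_cong) (auto simp: \<psi>_def)
      then show "(\<lambda>v. \<sigma> (\<psi> v)) ` e \<in> edges H \<longleftrightarrow> (\<lambda>v. \<sigma> (cell ?n (x v))) ` e \<in> edges H" by simp
    qed
    finally show "(\<Prod>(i, j)\<in>edge_pairs F. graph_step H \<sigma> (x i) (x j)) =
      (\<Sum>\<phi>\<in>\<Phi>. of_bool (P (\<lambda>v. \<sigma> (\<phi> v))) * indicator (box \<phi>) x)"
      using prod_edge_pairs_adj[OF F, of H "\<lambda>v. \<sigma> (cell ?n (x v))"] by (simp add: graph_step_def P_def)
  qed
  also have "\<dots> = (\<Sum>\<phi>\<in>\<Phi>. of_bool (P (\<lambda>v. \<sigma> (\<phi> v))) * measure ?M (box \<phi>))"
  proof -
    have "integrable ?M (indicator (box \<phi>) :: _ \<Rightarrow> real)" for \<phi>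
      by (rule V.P.integrable_const_bound[of _ 1]) (use box in \<open>auto simp: indicator_def\<close>)
    then show ?thesis
      using sets.sets_into_space[OF box]
      by (subst Bochner_Integration.integral_sum) (simp_all add: Int_absorb2 del: sum_mult_of_bool_eq)
  qed
  also have "\<dots> = (\<Sum>\<phi>\<in>\<Phi>. of_bool (P (\<lambda>v. \<sigma> (\<phi> v)))) / real ?n ^ card ?V"
    by (simp add: m_box sum_divide_distrib power_divide)
  also have "(\<Sum>\<phi>\<in>\<Phi>. of_bool (P (\<lambda>v. \<sigma> (\<phi> v))) :: real) = real (card {\<phi> \<in> \<Phi>. P (\<lambda>v. \<sigma> (\<phi> v))})"
    using fin by (simp add: Int_def)
  \<comment> \<open>Composition with \<open>\<sigma>\<close> turns maps to indices into maps to
    vertices; the restrictions keep the maps extensional, as \<open>\<rightarrow>\<^sub>E\<close>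
    demands.\<close>
  also have "card {\<phi> \<in> \<Phi>. P (\<lambda>v. \<sigma> (\<phi> v))} = card {\<phi> \<in> ?V \<rightarrow>\<^sub>E verts H. P \<phi>}"
  proof (rule bij_betw_same_card, rule bij_betw_byWitness[where f = "\<lambda>\<phi>. \<lambda>v\<in>?V. \<sigma> (\<phi> v)" and f' = "\<lambda>\<phi>. \<lambda>v\<in>?V. inv_into {1..?n} \<sigma> (\<phi> v)"])
    have P_cong: "P \<phi> \<longleftrightarrow> P \<psi>" if "\<And>v. v \<in> ?V \<Longrightarrow> \<phi> v = \<psi> v" for \<phi> \<psi>
    proof -
      have "\<phi> ` e = \<psi> ` e" if "e \<in> edges F" for e
        using edge_in that \<open>\<And>v. v \<in> ?V \<Longrightarrow> \<phi> v = \<psi> v\<close> by (intro image_cong) auto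
      then show ?thesis by (simp add: P_def)
    qed
    have inv: "inv_into {1..?n} \<sigma> (\<sigma> i) = i" if "i \<in> {1..?n}" for i
      using \<sigma> that by (meson bij_betw_inv_into_left)
    have inv': "\<sigma> (inv_into {1..?n} \<sigma> u) = u" "inv_into {1..?n} \<sigma> u \<in> {1..?n}" if "u \<in> verts H" for u
      using \<sigma> that by (meson bij_betw_inv_into_right, metis bij_betw_imp_surj_on inv_into_into)
    have \<sigma>V: "\<sigma> i \<in> verts H" if "i \<in> {1..?n}" for i using \<sigma> that by (meson bij_betwE)
    show "\<forall>\<phi>\<in>{\<phi> \<in> \<Phi>. P (\<lambda>v. \<sigma> (\<phi> v))}. (\<lambda>v\<in>?V. inv_into {1..?n} \<sigma> ((\<lambda>v\<in>?V. \<sigma> (\<phi> v)) v)) = \<phi>"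
      by (auto simp: \<Phi>_def PiE_iff extensional_def fun_eq_iff inv simp del: One_nat_def)
    show "\<forall>\<phi>\<in>{\<phi> \<in> ?V \<rightarrow>\<^sub>E verts H. P \<phi>}. (\<lambda>v\<in>?V. \<sigma> ((\<lambda>v\<in>?V. inv_into {1..?n} \<sigma> (\<phi> v)) v)) = \<phi>"
    proof (intro ballI ext)
      fix \<phi> v assume \<phi>: "\<phi> \<in> {\<phi> \<in> ?V \<rightarrow>\<^sub>E verts H. P \<phi>}"
      show "(\<lambda>v\<in>?V. \<sigma> ((\<lambda>v\<in>?V. inv_into {1..?n} \<sigma> (\<phi> v)) v)) v = \<phi> v"
      proof (cases "v \<in> ?V")
        case True
        then have "\<phi> v \<in> verts H" using \<phi> by (auto simp: PiE_iff)
        from inv'(1)[OF this] True show ?thesis by (simp del: One_nat_def)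
      next
        case False
        then show ?thesis using \<phi> by (auto simp: PiE_iff extensional_def)
      qed
    qed
    show "(\<lambda>\<phi>. \<lambda>v\<in>?V. \<sigma> (\<phi> v)) ` {\<phi> \<in> \<Phi>. P (\<lambda>v. \<sigma> (\<phi> v))} \<subseteq> {\<phi> \<in> ?V \<rightarrow>\<^sub>E verts H. P \<phi>}"
    proof safe
      fix \<phi> v assume "\<phi> \<in> \<Phi>" "v \<in> ?V"
      then have "\<phi> v \<in> {1..?n}" by (auto simp: \<Phi>_def)
      from \<sigma>V[OF this] \<open>v \<in> ?V\<close> show "(\<lambda>v\<in>?V. \<sigma> (\<phi> v)) v \<in> verts H" by simp
    next
      fix \<phi> assume "P (\<lambda>v. \<sigma> (\<phi> v))"
      also have "P (\<lambda>v. \<sigma> (\<phi> v)) \<longleftrightarrow> P (\<lambda>v\<in>?V. \<sigma> (\<phi> v))" by (rule P_cong) simp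
      finally show "P (\<lambda>v\<in>?V. \<sigma> (\<phi> v))" .
    qed auto
    show "(\<lambda>\<phi>. \<lambda>v\<in>?V. inv_into {1..?n} \<sigma> (\<phi> v)) ` {\<phi> \<in> ?V \<rightarrow>\<^sub>E verts H. P \<phi>} \<subseteq> {\<phi> \<in> \<Phi>. P (\<lambda>v. \<sigma> (\<phi> v))}"
    proof safe
      fix \<phi> assume \<phi>: "\<phi> \<in> ?V \<rightarrow>\<^sub>E verts H"
      then have \<phi>v: "\<phi> v \<in> verts H" if "v \<in> ?V" for v using that by auto
      show "(\<lambda>v\<in>?V. inv_into {1..?n} \<sigma> (\<phi> v)) \<in> \<Phi>"
        unfolding \<Phi>_def using inv'(2)[OF \<phi>v] by (intro restrict_PiE_iff[THEN iffD2]) blast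
      assume "P \<phi>"
      also have "P \<phi> \<longleftrightarrow> P (\<lambda>v. \<sigma> ((\<lambda>v\<in>?V. inv_into {1..?n} \<sigma> (\<phi> v)) v))"
        by (rule P_cong) (use inv'(1)[OF \<phi>v] in \<open>simp del: One_nat_def\<close>)
      finally show "P (\<lambda>v. \<sigma> ((\<lambda>v\<in>?V. inv_into {1..?n} \<sigma> (\<phi> v)) v))" .
    qed
  qed
  finally show ?thesis
    using V by (simp add: t_graph_def P_def card_PiE)
qed

section \<open>Compactness\<close>

lemma cut_le_reindex:
  assumes \<sigma>: "bij_betw \<sigma> I V" and c: "cut_le V M c"
  shows "cut_le I (\<lambda>i j. M (\<sigma> i) (\<sigma> j)) c"
  unfolding cut_le_def
proof (intro allI impI)
  fix S T assume ST: "S \<subseteq> I" "T \<subseteq> I"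
  have inj: "inj_on \<sigma> S" "inj_on \<sigma> T" using \<sigma> ST by (meson bij_betw_imp_inj_on inj_on_subset)+
  have "(\<Sum>i\<in>S. \<Sum>j\<in>T. M (\<sigma> i) (\<sigma> j)) = (\<Sum>u\<in>\<sigma> ` S. \<Sum>v\<in>\<sigma> ` T. M u v)"
    using inj by (simp add: sum.reindex)
  moreover have "\<sigma> ` S \<subseteq> V" "\<sigma> ` T \<subseteq> V" using \<sigma> ST by (auto simp: bij_betw_def)
  ultimately show "\<bar>\<Sum>i\<in>S. \<Sum>j\<in>T. M (\<sigma> i) (\<sigma> j)\<bar> \<le> c" using c by (simp add: cut_le_def)
qed

lemma integrable_cut:
  fixes f g :: "real \<Rightarrow> real"
  assumes "D \<in> borel_measurable unit_sq" "\<And>z. \<bar>D z\<bar> \<le> B" "f \<in> borel_measurable unit_lborel" "g \<in> borel_measurable unit_lborel"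
    "\<And>x. 0 \<le> f x \<and> f x \<le> 1" "\<And>x. 0 \<le> g x \<and> g x \<le> 1"
  shows "integrable unit_sq (\<lambda>z. f (fst z) * g (snd z) * D z)"
proof (rule integrable_sq[of _ B])
  show "(\<lambda>z. f (fst z) * g (snd z) * D z) \<in> borel_measurable unit_sq"
    using assms by measurable
  fix z
  have "0 \<le> f (fst z) * g (snd z)" "f (fst z) * g (snd z) \<le> 1"
    using assms(5)[of "fst z"] assms(6)[of "snd z"] by (auto intro: mult_le_one)
  then show "\<bar>f (fst z) * g (snd z) * D z\<bar> \<le> B"
    using abs_mult_le_left[of "D z" B "f (fst z) * g (snd z)"] assms(2)[of z] by (simp add: mult.commute)
qed

lemma cut_norm_le_add:
  assumes "cut_norm_le D c" "cut_norm_le D' c'" "D \<in> borel_measurable unit_sq" "D' \<in> borel_measurable unit_sq"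
    "\<And>z. \<bar>D z\<bar> \<le> B" "\<And>z. \<bar>D' z\<bar> \<le> B'"
  shows "cut_norm_le (\<lambda>z. D z + D' z) (c + c')"
  unfolding cut_norm_le_def
proof (intro ballI impI)
  fix f g :: "real \<Rightarrow> real"
  assume fg: "f \<in> borel_measurable unit_lborel" "g \<in> borel_measurable unit_lborel"
    "\<forall>x. 0 \<le> f x \<and> f x \<le> 1" "\<forall>x. 0 \<le> g x \<and> g x \<le> 1"
  have i: "integrable unit_sq (\<lambda>z. f (fst z) * g (snd z) * D z)" "integrable unit_sq (\<lambda>z. f (fst z) * g (snd z) * D' z)"
    using fg(3,4) by (intro integrable_cut[OF assms(3,5) fg(1,2)] integrable_cut[OF assms(4,6) fg(1,2)]; simp)+
  have "(LINT z|unit_sq. f (fst z) * g (snd z) * (D z + D' z)) =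
    (LINT z|unit_sq. f (fst z) * g (snd z) * D z) + (LINT z|unit_sq. f (fst z) * g (snd z) * D' z)"
    using i by (simp add: distrib_left)
  also have "\<bar>\<dots>\<bar> \<le> \<bar>LINT z|unit_sq. f (fst z) * g (snd z) * D z\<bar> + \<bar>LINT z|unit_sq. f (fst z) * g (snd z) * D' z\<bar>"
    by (rule abs_triangle_ineq)
  also have "\<dots> \<le> c + c'"
    using cut_norm_leD[OF assms(1), of f g] cut_norm_leD[OF assms(2), of f g] fg by (intro add_mono) auto
  finally show "\<bar>LINT z|unit_sq. f (fst z) * g (snd z) * (D z + D' z)\<bar> \<le> c + c'" .
qed

lemma cut_norm_le_uminus: "cut_norm_le D c \<Longrightarrow> cut_norm_le (\<lambda>z. - D z) c"
  by (simp add: cut_norm_le_def)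

lemma cut_norm_le_L1:
  assumes D: "D \<in> borel_measurable unit_sq" "\<And>z. \<bar>D z\<bar> \<le> B"
  shows "cut_norm_le D (LINT z|unit_sq. \<bar>D z\<bar>)"
  unfolding cut_norm_le_def
proof (intro ballI impI)
  fix f g :: "real \<Rightarrow> real"
  assume fg: "f \<in> borel_measurable unit_lborel" "g \<in> borel_measurable unit_lborel"
    "\<forall>x. 0 \<le> f x \<and> f x \<le> 1" "\<forall>x. 0 \<le> g x \<and> g x \<le> 1"
  have i: "integrable unit_sq (\<lambda>z. f (fst z) * g (snd z) * D z)"
    using fg(3,4) by (intro integrable_cut[OF D fg(1,2)]; simp)
  have "\<bar>LINT z|unit_sq. f (fst z) * g (snd z) * D z\<bar> \<le> (LINT z|unit_sq. \<bar>f (fst z) * g (snd z) * D z\<bar>)"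
    using integral_norm_bound[of unit_sq "\<lambda>z. f (fst z) * g (snd z) * D z"] by simp
  also have "\<dots> \<le> (LINT z|unit_sq. \<bar>D z\<bar>)"
  proof (intro integral_mono integrable_abs i integrable_sq[OF D])
    fix z
    have "0 \<le> f (fst z) * g (snd z)" "f (fst z) * g (snd z) \<le> 1"
      using fg(3,4) by (auto intro: mult_le_one)
    then show "\<bar>f (fst z) * g (snd z) * D z\<bar> \<le> \<bar>D z\<bar>"
      using abs_mult_le_left[of "D z" "\<bar>D z\<bar>" "f (fst z) * g (snd z)"] by (simp add: mult.commute)
  qed
  finally show "\<bar>LINT z|unit_sq. f (fst z) * g (snd z) * D z\<bar> \<le> (LINT z|unit_sq. \<bar>D z\<bar>)" .
qed

lemma cut_norm_le_mono: "cut_norm_le D c \<Longrightarrow> c \<le> c' \<Longrightarrow> cut_norm_le D c'"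
  unfolding cut_norm_le_def by (meson order_trans)

text \<open>Membership in the first \<open>l\<close> sets written in binary, with the earliest set
  as leading digit. Sorting by codes of a high level therefore sorts the codes of all lower levels
  too, and the last digit gives back membership in the last set.\<close>

primrec code :: "(nat \<Rightarrow> 'a set) \<Rightarrow> nat \<Rightarrow> 'a \<Rightarrow> nat" where
  "code Q 0 v = 0"
| "code Q (Suc l) v = 2 * code Q l v + of_bool (v \<in> Q l)"

lemma code_less: "code Q l v < 2 ^ l"
  by (induction l) (auto simp: of_bool_def)

text \<open>Lowering the level deletes trailing binary digits, which preserves the order.\<close>

lemma code_mono_level:
  assumes "code Q L u \<le> code Q L v" "l \<le> L"
  shows "code Q l u \<le> code Q l v"
  using assms(2,1)
proof (induction L rule: dec_induct)
  case (step m)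
  then show ?case by (auto simp: of_bool_def split: if_splits)
qed

lemma sorted_enumeration:
  fixes f :: "nat \<Rightarrow> nat"
  assumes "finite V"
  obtains \<sigma> where "bij_betw \<sigma> {1..card V} V" "\<And>i j. 1 \<le> i \<Longrightarrow> i \<le> j \<Longrightarrow> j \<le> card V \<Longrightarrow> f (\<sigma> i) \<le> f (\<sigma> j)"
proof -
  define xs where "xs = sort_key f (sorted_list_of_set V)"
  have xs: "distinct xs" "set xs = V" "length xs = card V" "sorted (map f xs)"
    using assms by (auto simp: xs_def)
  have "bij_betw ((!) xs \<circ> (\<lambda>i. i - 1)) {1..card V} V"
  proof (rule bij_betw_trans)
    show "bij_betw (\<lambda>i. i - 1) {1..card V} {..<card V}"
      by (rule bij_betw_byWitness[where f' = Suc]) auto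
    show "bij_betw ((!) xs) {..<card V} V" using xs by (intro bij_betw_nth) auto
  qed
  moreover have "f (((!) xs \<circ> (\<lambda>i. i - 1)) i) \<le> f (((!) xs \<circ> (\<lambda>i. i - 1)) j)"
    if "1 \<le> i" "i \<le> j" "j \<le> card V" for i j
    using sorted_nth_mono[OF xs(4), of "i - 1" "j - 1"] that xs(3) by simp
  ultimately show ?thesis using that by blast
qed

lemma cell_mono: "x \<le> y \<Longrightarrow> cell n x \<le> cell n y"
  unfolding cell_def by (intro nat_mono max.mono min.mono order.refl ceiling_mono mult_left_mono) auto

text \<open>The cell of -y depends on y only through the floor of n y, which is constant just to the
  right of any point.\<close>

lemma cell_right_continuous_reflect:
  fixes g :: "nat \<Rightarrow> real"
  shows "continuous (at_right x) (\<lambda>y. g (cell n (- y)))"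
proof (cases "n = 0")
  case True
  then show ?thesis by (simp add: cell_def)
next
  case False
  then have n: "real n > 0" by simp
  define b where "b = (of_int \<lfloor>real n * x\<rfloor> + 1) / real n"
  have "x < b" using n by (simp add: b_def field_simps) linarith
  then have "eventually (\<lambda>y. y \<in> {x<..<b}) (at_right x)"
    by (rule eventually_at_right_real)
  then have "eventually (\<lambda>y. g (cell n (- y)) = g (cell n (- x))) (at_right x)"
  proof eventually_elim
    case (elim y)
    have "real n * x \<le> real n * y" "real n * y < of_int \<lfloor>real n * x\<rfloor> + 1"
      using elim n by (auto simp: b_def field_simps)
    then have "\<lfloor>real n * y\<rfloor> = \<lfloor>real n * x\<rfloor>" by linarith
    then show ?case by (simp add: cell_def ceiling_minus)
  qed
  then show ?thesis
    unfolding continuous_within by (rule tendsto_eventually)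
qed

text \<open>Helly's theorem wants right continuity, whereas cells are closed on the right, hence the reflection.\<close>

lemma Helly_monotone_cells:
  fixes g :: "nat \<Rightarrow> nat \<Rightarrow> nat"
  assumes mono: "\<And>k i j. 1 \<le> i \<Longrightarrow> i \<le> j \<Longrightarrow> j \<le> n k \<Longrightarrow> g k i \<le> g k j"
    and pos: "\<And>k. 0 < n k" and bd: "\<And>k i. g k i \<le> B"
  obtains s N where "strict_mono (s :: nat \<Rightarrow> nat)" "countable N"
    "\<And>x. x \<notin> N \<Longrightarrow> convergent (\<lambda>k. real (g (s k) (cell (n (s k)) x)))"
proof -
  \<comment> \<open>The outer minus sign makes the reflected function increasing again.\<close>
  let ?f = "\<lambda>k y. - real (g k (cell (n k) (- y)))"
  have "mono (?f k)" for k
    using cell_range[OF pos, of k] by (intro monoI) (auto intro!: mono cell_mono)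
  moreover have "\<bar>?f k y\<bar> \<le> real B" for k y using bd by simp
  moreover have "continuous (at_right x) (?f k)" for x k
    by (intro continuous_minus cell_right_continuous_reflect)
  ultimately obtain s F where s: "strict_mono s" and F: "mono F"
    and lim: "\<And>x. continuous (at x) F \<Longrightarrow> (\<lambda>k. ?f (s k) x) \<longlonglongrightarrow> F x"
    using Helly_selection[of ?f "real B"] by blast
  define N where "N = uminus ` {x. \<not> isCont F x}"
  have "countable N" unfolding N_def using mono_ctble_discont[OF F] by (intro countable_image) simp
  moreover have "convergent (\<lambda>k. real (g (s k) (cell (n (s k)) x)))" if "x \<notin> N" for x
  proof -
    have "isCont F (- x)" using that by (force simp: N_def)
    from tendsto_minus[OF lim[OF this]] show ?thesis by (auto simp: convergent_def)
  qed
  ultimately show ?thesis using that s by blast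
qed

lemma convergent_nat_eventually_const:
  fixes a :: "nat \<Rightarrow> nat"
  assumes "convergent (\<lambda>k. real (a k))"
  obtains c where "eventually (\<lambda>k. a k = c) sequentially"
proof -
  have "Cauchy (\<lambda>k. real (a k))" using assms by (simp add: convergent_Cauchy)
  then obtain K where K: "\<And>m n. m \<ge> K \<Longrightarrow> n \<ge> K \<Longrightarrow> dist (real (a m)) (real (a n)) < 1"
    unfolding Cauchy_def by (meson zero_less_one)
  have "a k = a K" if "k \<ge> K" for k
  proof -
    have "\<bar>real (a k) - real (a K)\<bar> < 1" using K[OF that order.refl] by (simp add: dist_real_def)
    then show ?thesis by linarith
  qed
  then have "eventually (\<lambda>k. a k = a K) sequentially" unfolding eventually_sequentially by blast
  then show ?thesis by (rule that)
qed

lemma AE_unit_countable: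
  assumes "countable N" shows "AE x in unit_lborel. x \<notin> N"
proof -
  have "AE x in lborel. x \<notin> N"
    by (rule AE_not_in) (rule countable_imp_null_set_lborel[OF assms])
  then show ?thesis by (subst AE_restrict_space_iff) (auto elim: eventually_mono)
qed

lemma AE_sq_fst:
  assumes "AE x in unit_lborel. P x" shows "AE z in unit_sq. P (fst z)"
proof -
  from assms obtain N where N: "N \<in> null_sets unit_lborel" "{x \<in> space unit_lborel. \<not> P x} \<subseteq> N"
    by (auto simp: eventually_ae_filter)
  have "N \<times> space unit_lborel \<in> null_sets unit_sq"
    using N(1) by (intro unit.times_in_null_sets1 sets.top)
  then show ?thesis
    by (rule AE_I') (use N(2) in \<open>auto simp: space_pair_measure\<close>)
qed

lemma AE_sq_snd:
  assumes "AE x in unit_lborel. P x" shows "AE z in unit_sq. P (snd z)"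
  using AE_unit_sq_swap[OF AE_sq_fst[OF assms]] by (simp add: prod.swap_def)

text \<open>The decompositions for all precisions \<open>m\<close> are packed into one sequence of
  sets and one of coefficients, so that a single order of the vertices can serve all of them. At
  precision \<open>m\<close>, entry 2i is the i-th row set and entry 2i + 1 the i-th column
  set.\<close>

lemma graph_cut_decomposition:
  assumes "finite V"
  shows "\<exists>(Q :: nat \<Rightarrow> nat set) (d :: nat \<Rightarrow> real). (\<forall>l. \<bar>d l\<bar> \<le> 1) \<and>
    (\<forall>m. cut_le V (\<lambda>u v. adj H u v - (\<Sum>i<(Suc m)\<^sup>2. d (prod_encode (m, i)) *
        of_bool (u \<in> Q (prod_encode (m, 2 * i))) * of_bool (v \<in> Q (prod_encode (m, Suc (2 * i))))))
      ((real (card V))\<^sup>2 / real (Suc m)))"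
proof -
  have "\<forall>m. \<exists>p. (\<forall>i. \<bar>fst p i\<bar> \<le> 1) \<and>
    cut_le V (\<lambda>u v. adj H u v - (\<Sum>i<(Suc m)\<^sup>2. fst p i * of_bool (u \<in> fst (snd p) i) * of_bool (v \<in> snd (snd p) i)))
      ((real (card V))\<^sup>2 / real (Suc m))"
  proof
    fix m
    have "\<bar>adj H u v\<bar> \<le> 1" for u v by (simp add: adj_def)
    from cut_decomposition[where V = V and R = "adj H" and m = m, OF assms this] obtain d S T where
      "(\<forall>i. \<bar>d i\<bar> \<le> 1) \<and> cut_le V (\<lambda>u v. adj H u v - (\<Sum>i<(Suc m)\<^sup>2. d i * of_bool (u \<in> S i) * of_bool (v \<in> T i)))
        ((real (card V))\<^sup>2 / real (Suc m))" by (elim exE)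
    then show "\<exists>p. (\<forall>i. \<bar>fst p i\<bar> \<le> 1) \<and>
      cut_le V (\<lambda>u v. adj H u v - (\<Sum>i<(Suc m)\<^sup>2. fst p i * of_bool (u \<in> fst (snd p) i) * of_bool (v \<in> snd (snd p) i)))
        ((real (card V))\<^sup>2 / real (Suc m))"
      by (intro exI[of _ "(d, S, T)"]) simp
  qed
  from choice[OF this] obtain p where p: "\<And>m i. \<bar>fst (p m) i\<bar> \<le> 1"
    "\<And>m. cut_le V (\<lambda>u v. adj H u v - (\<Sum>i<(Suc m)\<^sup>2. fst (p m) i * of_bool (u \<in> fst (snd (p m)) i) * of_bool (v \<in> snd (snd (p m)) i)))
      ((real (card V))\<^sup>2 / real (Suc m))" by (elim exE) blast
  define Q where "Q l = (case prod_decode l of (m, j) \<Rightarrow>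
    if even j then fst (snd (p m)) (j div 2) else snd (snd (p m)) (j div 2))" for l
  define d where "d l = (case prod_decode l of (m, i) \<Rightarrow> fst (p m) i)" for l
  have "\<bar>d l\<bar> \<le> 1" for l using p(1) by (simp add: d_def case_prod_unfold)
  moreover have "cut_le V (\<lambda>u v. adj H u v - (\<Sum>i<(Suc m)\<^sup>2. d (prod_encode (m, i)) *
        of_bool (u \<in> Q (prod_encode (m, 2 * i))) * of_bool (v \<in> Q (prod_encode (m, Suc (2 * i))))))
      ((real (card V))\<^sup>2 / real (Suc m))" for m
    using p(2)[of m] by (simp add: Q_def d_def)
  ultimately show ?thesis by blast
qed

text \<open>Listing the vertices by the membership code of the first sets of their cut decompositions turns
  the decompositions into step functions with boundedly many steps, which converge along a
  subsequence by Helly's theorem.\<close>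

theorem graph_compactness:
  fixes H :: "nat \<Rightarrow> graph"
  assumes simple: "\<And>k. simple_graph (H k)" and pos: "\<And>k. 0 < card (verts (H k))"
  obtains r \<sigma> U where "strict_mono (r :: nat \<Rightarrow> nat)"
    "\<And>k. bij_betw (\<sigma> k) {1..card (verts (H k))} (verts (H k))"
    "(\<lambda>z. U (fst z) (snd z)) \<in> borel_measurable unit_sq"
    "\<And>x y. 0 \<le> U x y \<and> U x y \<le> 1" "\<And>x y. U x y = U y x"
    "\<And>F. simple_graph F \<Longrightarrow> (\<lambda>k. t_graph F (H (r k))) \<longlonglongrightarrow> t_fun F U"
    "\<And>A. A \<in> sets unit_sq \<Longrightarrow>
      (\<lambda>k. LINT z|unit_sq. indicator A z * graph_step (H (r k)) (\<sigma> (r k)) (fst z) (snd z)) \<longlonglongrightarrow>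
      (LINT z|unit_sq. indicator A z * U (fst z) (snd z))"
proof -
  define n where "n k = card (verts (H k))" for k
  have n: "n k > 0" for k using pos by (simp add: n_def)
  have fin: "finite (verts (H k))" for k using simple[of k] by (simp add: simple_graph_def)
  define dec where "dec k Q d \<longleftrightarrow> (\<forall>l. \<bar>d l\<bar> \<le> 1) \<and>
    (\<forall>m. cut_le (verts (H k)) (\<lambda>u v. adj (H k) u v - (\<Sum>i<(Suc m)\<^sup>2. d (prod_encode (m, i)) *
        of_bool (u \<in> Q (prod_encode (m, 2 * i))) * of_bool (v \<in> Q (prod_encode (m, Suc (2 * i))))))
      ((real (n k))\<^sup>2 / real (Suc m)))" for k and Q :: "nat \<Rightarrow> nat set" and d :: "nat \<Rightarrow> real"
  have "\<forall>k. \<exists>Q d. dec k Q d"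
    unfolding dec_def n_def using graph_cut_decomposition[OF fin] by blast
  from choice[OF this] obtain Q where "\<forall>k. \<exists>d. dec k (Q k) d" by (elim exE)
  from choice[OF this] obtain d where dec: "\<And>k. dec k (Q k) (d k)" by (elim exE) blast
  have d1: "\<bar>d k l\<bar> \<le> 1" for k l using dec[of k] by (simp add: dec_def)
  \<comment> \<open>Graph k is sorted by its first k sets, so every fixed set takes part from some k
    on.\<close>
  have "\<forall>k. \<exists>\<sigma>. bij_betw \<sigma> {1..n k} (verts (H k)) \<and>
    (\<forall>i j. 1 \<le> i \<longrightarrow> i \<le> j \<longrightarrow> j \<le> n k \<longrightarrow> code (Q k) k (\<sigma> i) \<le> code (Q k) k (\<sigma> j))"
  proof
    fix k
    obtain \<sigma> where \<sigma>: "bij_betw \<sigma> {1..card (verts (H k))} (verts (H k))"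
      "\<And>i j. 1 \<le> i \<Longrightarrow> i \<le> j \<Longrightarrow> j \<le> card (verts (H k)) \<Longrightarrow> code (Q k) k (\<sigma> i) \<le> code (Q k) k (\<sigma> j)"
      using sorted_enumeration[OF fin[of k], of "code (Q k) k"] by blast
    then show "\<exists>\<sigma>. bij_betw \<sigma> {1..n k} (verts (H k)) \<and>
      (\<forall>i j. 1 \<le> i \<longrightarrow> i \<le> j \<longrightarrow> j \<le> n k \<longrightarrow> code (Q k) k (\<sigma> i) \<le> code (Q k) k (\<sigma> j))"
      unfolding n_def by blast
  qed
  from choice[OF this] obtain \<sigma> where \<sigma>: "\<And>k. bij_betw (\<sigma> k) {1..n k} (verts (H k))"
    and sorted: "\<And>k i j. 1 \<le> i \<Longrightarrow> i \<le> j \<Longrightarrow> j \<le> n k \<Longrightarrow> code (Q k) k (\<sigma> k i) \<le> code (Q k) k (\<sigma> k j)"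
    by (elim exE) blast
  \<comment> \<open>Membership in one set is not monotone along the order, but the code is, as
    Helly's theorem needs. The value 0 keeps monotonicity at levels l > k, which the order does not
    control.\<close>
  define X where "X k l i = (if l \<le> k then code (Q k) l (\<sigma> k i) else 0)" for k l i
  have X_mono: "X k l i \<le> X k l j" if "1 \<le> i" "i \<le> j" "j \<le> n k" for k l i j
    using code_mono_level[OF sorted[OF that], of l] by (simp add: X_def)
  have X_bound: "X k l i \<le> 2 ^ l" for k l i
    using code_less[of "Q k" l "\<sigma> k i"] by (simp add: X_def)
  define P where "P l s \<longleftrightarrow>
    (\<exists>N. countable N \<and> (\<forall>x. x \<notin> N \<longrightarrow> convergent (\<lambda>k. real (X (s k) l (cell (n (s k)) x))))) \<and>
    convergent (\<lambda>k. d (s k) l)" for l and s :: "nat \<Rightarrow> nat"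
  have P_subseq: "P l (s \<circ> s')" if "strict_mono s'" "P l s" for l s s'
  proof -
    from that(2) obtain N where N: "countable N"
      "\<And>x. x \<notin> N \<Longrightarrow> convergent (\<lambda>k. real (X (s k) l (cell (n (s k)) x)))" and dc: "convergent (\<lambda>k. d (s k) l)"
      unfolding P_def by blast
    have "convergent (\<lambda>k. real (X ((s \<circ> s') k) l (cell (n ((s \<circ> s') k)) x)))" if "x \<notin> N" for x
      using convergent_subseq_convergent[OF N(2)[OF that] \<open>strict_mono s'\<close>] by (simp add: o_def)
    moreover have "convergent (\<lambda>k. d ((s \<circ> s') k) l)"
      using convergent_subseq_convergent[OF dc \<open>strict_mono s'\<close>] by (simp add: o_def)
    ultimately show ?thesis unfolding P_def using N(1) by blast
  qed
  interpret subseqs P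
  proof
    fix l and s :: "nat \<Rightarrow> nat" assume "strict_mono s"
    have "X (s k) l i \<le> X (s k) l j" if "1 \<le> i" "i \<le> j" "j \<le> n (s k)" for k i j
      using that by (rule X_mono)
    from Helly_monotone_cells[of "\<lambda>k. n (s k)" "\<lambda>k. X (s k) l", OF this n X_bound]
    obtain s1 N where s1: "strict_mono s1" "countable N"
      "\<And>x. x \<notin> N \<Longrightarrow> convergent (\<lambda>k. real (X (s (s1 k)) l (cell (n (s (s1 k))) x)))" by blast
    have "bounded (range (\<lambda>k. d (s (s1 k)) l))"
      using d1 by (intro boundedI[of _ 1]) auto
    then obtain x s2 where s2: "strict_mono s2" "((\<lambda>k. d (s (s1 k)) l) \<circ> s2) \<longlonglongrightarrow> x"
      using bounded_imp_convergent_subsequence by blast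
    have "convergent (\<lambda>k. real (X ((s \<circ> (s1 \<circ> s2)) k) l (cell (n ((s \<circ> (s1 \<circ> s2)) k)) x)))" if "x \<notin> N" for x
      using convergent_subseq_convergent[OF s1(3)[OF that] s2(1)] by (simp add: o_def)
    moreover have "convergent (\<lambda>k. d ((s \<circ> (s1 \<circ> s2)) k) l)"
      using s2(2) by (auto simp: convergent_def o_def)
    moreover have "strict_mono (s1 \<circ> s2)" using s1(1) s2(1) by (rule strict_mono_o)
    ultimately show "\<exists>r'. strict_mono r' \<and> P l (s \<circ> r')"
      unfolding P_def using s1(2) by blast
  qed
  define r where "r = diagseq"
  have r: "strict_mono r" unfolding r_def by (rule subseq_diagseq)
  \<comment> \<open>The first l + 1 terms of the diagonal sequence may precede the thinning out for
    l.\<close>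
  have P_r: "P l (r \<circ> (+) (Suc l))" for l
    unfolding r_def by (rule diagseq_holds[OF P_subseq])
  have d_conv: "convergent (\<lambda>k. d (r k) l)" for l
  proof -
    have "convergent (\<lambda>k. d (r (k + Suc l)) l)"
      using P_r[of l] by (simp add: P_def o_def add.commute)
    then show ?thesis by (rule convergent_ignore_initial_segment[THEN iffD1])
  qed
  have X_conv: "AE x in unit_lborel. convergent (\<lambda>k. real (X (r k) l (cell (n (r k)) x)))" for l
  proof -
    from P_r[of l] obtain N where N: "countable N"
      "\<And>x. x \<notin> N \<Longrightarrow> convergent (\<lambda>k. real (X (r (k + Suc l)) l (cell (n (r (k + Suc l))) x)))"
      unfolding P_def by (auto simp: o_def add.commute)
    have "convergent (\<lambda>k. real (X (r k) l (cell (n (r k)) x)))" if "x \<notin> N" for x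
      using N(2)[OF that] by (rule convergent_ignore_initial_segment[THEN iffD1])
    then show ?thesis using AE_unit_countable[OF N(1)] by (auto elim: eventually_mono)
  qed
  define q where "q k l i = (of_bool (\<sigma> k i \<in> Q k l) :: real)" for k l i
  \<comment> \<open>A convergent sequence of natural numbers is eventually constant, and the parity
    of the limit code at level l + 1 is membership in set l.\<close>
  have q_conv: "AE x in unit_lborel. \<forall>l. convergent (\<lambda>k. q (r k) l (cell (n (r k)) x))"
  proof (subst AE_all_countable, rule allI)
    fix l
    show "AE x in unit_lborel. convergent (\<lambda>k. q (r k) l (cell (n (r k)) x))"
      using X_conv[of "Suc l"]
    proof eventually_elim
      case (elim x)
      from elim obtain c where c: "eventually (\<lambda>k. X (r k) (Suc l) (cell (n (r k)) x) = c) sequentially"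
        by (rule convergent_nat_eventually_const)
      have "eventually (\<lambda>k. Suc l \<le> r k) sequentially"
        using filterlim_subseq[OF r] by (simp add: filterlim_at_top)
      with c have "eventually (\<lambda>k. q (r k) l (cell (n (r k)) x) = of_bool (odd c)) sequentially"
        by eventually_elim (auto simp: q_def X_def)
      then have "(\<lambda>k. q (r k) l (cell (n (r k)) x)) \<longlonglongrightarrow> of_bool (odd c)"
        by (rule tendsto_eventually)
      then show ?case by (rule convergentI)
    qed
  qed
  define w where "w m k i j = (\<Sum>a<(Suc m)\<^sup>2. d k (prod_encode (m, a)) * q k (prod_encode (m, 2 * a)) i *
    q k (prod_encode (m, Suc (2 * a))) j)" for m k i j
  define A where "A m k z = w m k (cell (n k) (fst z)) (cell (n k) (snd z))" for m k and z :: "real \<times> real"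
  have A_meas[measurable]: "A m k \<in> borel_measurable unit_sq" for m k
    unfolding A_def by (rule step_measurable)
  define C where "C m = real ((Suc m)\<^sup>2)" for m
  have A_bound: "\<bar>A m k z\<bar> \<le> C m" for m k z
  proof -
    have "\<bar>A m k z\<bar> \<le> (\<Sum>a<(Suc m)\<^sup>2. \<bar>d k (prod_encode (m, a)) * q k (prod_encode (m, 2 * a)) (cell (n k) (fst z)) *
      q k (prod_encode (m, Suc (2 * a))) (cell (n k) (snd z))\<bar>)"
      unfolding A_def w_def by (rule sum_abs)
    also have "\<dots> \<le> (\<Sum>a<(Suc m)\<^sup>2. 1)"
      by (intro sum_mono abs_mult_le_left d1) (auto simp: q_def)
    finally show ?thesis by (simp add: C_def)
  qed
  have A_conv: "AE z in unit_sq. convergent (\<lambda>k. A m (r k) z)" for m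
    using AE_sq_fst[OF q_conv] AE_sq_snd[OF q_conv]
    unfolding A_def w_def by eventually_elim (intro convergent_sum convergent_mult d_conv; simp)
  \<comment> \<open>The limit exists only almost everywhere; clamping makes \<open>B\<close> bounded
    at every point.\<close>
  define B where "B m z = max (- C m) (min (C m) (lim (\<lambda>k. A m (r k) z)))" for m z
  have C_pos: "0 \<le> C m" for m by (simp add: C_def)
  have B_meas[measurable]: "B m \<in> borel_measurable unit_sq" for m
    unfolding B_def by (intro borel_measurable_max borel_measurable_min borel_measurable_lim_metric) measurable
  have B_bound: "\<bar>B m z\<bar> \<le> C m" for m z using C_pos[of m] by (auto simp: B_def)
  have A_B: "AE z in unit_sq. (\<lambda>k. A m (r k) z) \<longlonglongrightarrow> B m z" for m
    using A_conv[of m]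
  proof eventually_elim
    case (elim z)
    then have l: "(\<lambda>k. A m (r k) z) \<longlonglongrightarrow> lim (\<lambda>k. A m (r k) z)" by (simp add: convergent_LIMSEQ_iff)
    have "\<bar>lim (\<lambda>k. A m (r k) z)\<bar> \<le> C m"
      by (rule LIMSEQ_le_const2[OF tendsto_rabs[OF l]]) (auto simp: A_bound)
    then have "B m z = lim (\<lambda>k. A m (r k) z)" by (auto simp: B_def)
    with l show ?case by simp
  qed
  have AB_L1: "(\<lambda>k. LINT z|unit_sq. \<bar>A m (r k) z - B m z\<bar>) \<longlonglongrightarrow> 0" for m
  proof -
    have "(\<lambda>k. LINT z|unit_sq. \<bar>A m (r k) z - B m z\<bar>) \<longlonglongrightarrow> (LINT z|unit_sq. 0 :: real)"
    proof (rule integral_dominated_convergence[where w = "\<lambda>_. 2 * C m"])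
      show "AE z in unit_sq. (\<lambda>k. \<bar>A m (r k) z - B m z\<bar>) \<longlonglongrightarrow> 0"
        using A_B[of m] by eventually_elim (simp add: LIM_zero tendsto_rabs_zero)
      have "\<bar>A m k z - B m z\<bar> \<le> 2 * C m" for k z
        using A_bound[of m k z] B_bound[of m z] by linarith
      then show "AE z in unit_sq. norm \<bar>A m (r k) z - B m z\<bar> \<le> 2 * C m" for k by simp
    qed simp_all
    then show ?thesis by simp
  qed
  define W where "W k z = graph_step (H k) (\<sigma> k) (fst z) (snd z)" for k and z :: "real \<times> real"
  have W_meas[measurable]: "W k \<in> borel_measurable unit_sq" for k
    unfolding W_def by (rule graph_step_measurable)
  have W01: "0 \<le> W k z \<and> W k z \<le> 1" for k z unfolding W_def by (rule graph_step_01)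
  have W_bound: "\<bar>W k z\<bar> \<le> 1" for k z using W01[of k z] by simp
  have WA: "cut_norm_le (\<lambda>z. W k z - A m k z) (1 / real (Suc m))" for k m
  proof -
    have "cut_le {1..n k} (\<lambda>i j. adj (H k) (\<sigma> k i) (\<sigma> k j) - w m k i j) ((real (n k))\<^sup>2 / real (Suc m))"
      using cut_le_reindex[OF \<sigma>[of k]] dec[of k] unfolding dec_def w_def q_def by blast
    from cut_norm_le_step[OF n this] show ?thesis
      using n[of k] by (simp add: W_def A_def graph_step_def n_def[symmetric])
  qed
  have Cau: "\<exists>K. \<forall>k\<ge>K. \<forall>l\<ge>K. cut_norm_le (\<lambda>z. W (r k) z - W (r l) z) e" if "e > 0" for e
  proof -
    \<comment> \<open>The comparison of two graphs goes through W - A and A - B at index k and again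
      at index l. Each of these four differences gets e/4.\<close>
    obtain m where m: "1 / real (Suc m) < e / 4"
      using reals_Archimedean[of "e / 4"] \<open>e > 0\<close> by (auto simp: inverse_eq_divide)
    obtain K where K: "\<And>k. k \<ge> K \<Longrightarrow> \<bar>LINT z|unit_sq. \<bar>A m (r k) z - B m z\<bar>\<bar> < e / 4"
      using LIMSEQ_D[OF AB_L1[of m], of "e / 4"] \<open>e > 0\<close> by auto
    have "cut_norm_le (\<lambda>z. W (r k) z - W (r l) z) e" if "k \<ge> K" "l \<ge> K" for k l
    proof -
      have AB_b: "\<bar>A m k z - B m z\<bar> \<le> 2 * C m" "\<bar>B m z - A m k z\<bar> \<le> 2 * C m" for k z
        using A_bound[of m k z] B_bound[of m z] by linarith+
      have WA_b: "\<bar>W k z - A m k z\<bar> \<le> 1 + C m" "\<bar>- (W k z - A m k z)\<bar> \<le> 1 + C m" for k z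
        using A_bound[of m k z] W_bound[of k z] by linarith+
      have "cut_norm_le (\<lambda>z. A m (r k) z - B m z) (e / 4)" if "k \<ge> K" for k
        using AB_b K[OF that] by (intro cut_norm_le_mono[OF cut_norm_le_L1[where B = "2 * C m"]]) auto
      note AB = this this[THEN cut_norm_le_uminus]
      have "cut_norm_le (\<lambda>z. W k z - A m k z) (e / 4)" for k
        using m by (intro cut_norm_le_mono[OF WA]) simp
      note WA' = this this[THEN cut_norm_le_uminus]
      have "cut_norm_le (\<lambda>z. (W (r k) z - A m (r k) z) + (A m (r k) z - B m z)) (e / 4 + e / 4)"
        using AB_b WA_b by (intro cut_norm_le_add[where B = "1 + C m" and B' = "2 * C m"] WA' AB \<open>k \<ge> K\<close>) auto
      moreover have "cut_norm_le (\<lambda>z. - (W (r l) z - A m (r l) z) + - (A m (r l) z - B m z)) (e / 4 + e / 4)"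
        using AB_b WA_b by (intro cut_norm_le_add[where B = "1 + C m" and B' = "2 * C m"] WA' AB \<open>l \<ge> K\<close>) auto
      ultimately have "cut_norm_le (\<lambda>z. ((W (r k) z - A m (r k) z) + (A m (r k) z - B m z)) +
        (- (W (r l) z - A m (r l) z) + - (A m (r l) z - B m z))) ((e / 4 + e / 4) + (e / 4 + e / 4))"
      proof (rule cut_norm_le_add[where B = "1 + C m" and B' = "1 + C m"])
        show "\<bar>(W (r k) z - A m (r k) z) + (A m (r k) z - B m z)\<bar> \<le> 1 + C m" for z
          using W_bound[of "r k" z] B_bound[of m z] by linarith
        show "\<bar>- (W (r l) z - A m (r l) z) + - (A m (r l) z - B m z)\<bar> \<le> 1 + C m" for z
          using W_bound[of "r l" z] B_bound[of m z] by linarith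
      qed measurable
      then show ?thesis by (simp add: algebra_simps)
    qed
    then show ?thesis by blast
  qed
  obtain U where U: "(\<lambda>z. U (fst z) (snd z)) \<in> borel_measurable unit_sq"
    "\<And>x y. 0 \<le> U x y \<and> U x y \<le> 1" "\<And>x y. U x y = U y x"
    and U_sets: "\<And>A. A \<in> sets unit_sq \<Longrightarrow>
      (\<lambda>k. LINT z|unit_sq. indicator A z * W (r k) z) \<longlonglongrightarrow> (LINT z|unit_sq. indicator A z * U (fst z) (snd z))"
    and U_cut: "\<And>e. e > 0 \<Longrightarrow> \<exists>K. \<forall>k\<ge>K. cut_norm_le (\<lambda>z. W (r k) z - U (fst z) (snd z)) e"
  proof -
    have sym: "W (r k) (x, y) = W (r k) (y, x)" for k x y by (simp add: W_def graph_step_sym)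
    show thesis
      by (rule cut_limit_exists[of "\<lambda>k. W (r k)", OF W_meas W01 sym Cau]) (assumption, rule that)
  qed
  have "(\<lambda>k. t_graph F (H (r k))) \<longlonglongrightarrow> t_fun F U" if F: "simple_graph F" for F
  proof (rule LIMSEQ_I)
    fix e :: real assume "e > 0"
    \<comment> \<open>The summand 1 covers graphs without edges.\<close>
    define c where "c = e / (real (card (edge_pairs F)) + 1)"
    have "c > 0" using \<open>e > 0\<close> by (simp add: c_def add_nonneg_pos)
    moreover have "(real (card (edge_pairs F)) + 1) * c = e" by (simp add: c_def add_nonneg_eq_0_iff)
    ultimately have c: "c > 0" "real (card (edge_pairs F)) * c < e" by (simp_all add: distrib_right)
    obtain K where K: "\<And>k. k \<ge> K \<Longrightarrow> cut_norm_le (\<lambda>z. W (r k) z - U (fst z) (snd z)) c"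
      using U_cut[OF c(1)] by blast
    have "norm (t_graph F (H (r k)) - t_fun F U) < e" if "k \<ge> K" for k
    proof -
      from K[OF that] have "cut_norm_le (\<lambda>z. graph_step (H (r k)) (\<sigma> (r k)) (fst z) (snd z) - U (fst z) (snd z)) c"
        by (simp add: W_def)
      from counting_lemma[OF F U(1,2) graph_step_measurable graph_step_01 this]
      have "\<bar>t_fun F (graph_step (H (r k)) (\<sigma> (r k))) - t_fun F U\<bar> \<le> real (card (edge_pairs F)) * c" .
      moreover have "t_fun F (graph_step (H (r k)) (\<sigma> (r k))) = t_graph F (H (r k))"
        using \<sigma>[of "r k"] pos by (intro t_fun_graph_step F) (auto simp: n_def)
      ultimately show ?thesis using c by simp
    qed
    then show "\<exists>K. \<forall>k\<ge>K. norm (t_graph F (H (r k)) - t_fun F U) < e" by blast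
  qed
  then show ?thesis
    using that[OF r, of \<sigma> U] \<sigma> U U_sets by (simp add: W_def n_def)
qed

section \<open>Step approximation and averaging over permutations\<close>

lemma cell_dist:
  assumes "n > 0" "x \<in> {0..1}"
  shows "\<bar>x - real (cell n x) / real n\<bar> \<le> 1 / real n"
proof -
  have "0 \<le> real n * x" "real n * x \<le> real n" using assms by (auto simp: mult_left_le)
  then have "\<lceil>real n * x\<rceil> \<le> int n" "0 \<le> \<lceil>real n * x\<rceil>" by (auto simp: ceiling_le_iff)
  then have "real (cell n x) = max 1 (of_int \<lceil>real n * x\<rceil>)"
    using assms(1) by (simp add: cell_def max_def min_def)
  then have "\<bar>real n * x - real (cell n x)\<bar> \<le> 1"
    using \<open>0 \<le> real n * x\<close> by (auto simp: max_def) linarith+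
  moreover have "x - real (cell n x) / real n = (real n * x - real (cell n x)) / real n"
    using assms(1) by (simp add: field_simps)
  ultimately show ?thesis using assms(1) by (simp add: abs_divide divide_right_mono)
qed

text \<open>A measurable function is almost everywhere a limit of continuous ones, and these are
  uniformly continuous on the square. Every large n has to work because n will be the number of
  vertices of a given graph.\<close>

lemma step_approximation:
  fixes h :: "real \<times> real \<Rightarrow> real"
  assumes h: "h \<in> borel_measurable unit_sq" "\<And>z. z \<in> square \<Longrightarrow> 0 \<le> h z \<and> h z \<le> 1" and e: "e > 0"
  shows "\<exists>N. \<forall>n\<ge>N. \<exists>w. (\<forall>i j. 0 \<le> w i j \<and> w i j \<le> 1) \<and>
    (LINT z|unit_sq. \<bar>h z - w (cell n (fst z)) (cell n (snd z))\<bar>) < e"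
proof -
  have "h measurable_on square"
    using measurable_on_iff_borel_measurable[OF square_lebesgue, of h] borel_measurable_lebesgue_square[OF h(1)] by blast
  then obtain N g where N: "negligible N" and g: "\<And>n. continuous_on UNIV (g n)"
    and lim: "\<And>z. z \<notin> N \<Longrightarrow> (\<lambda>n. g n z) \<longlonglongrightarrow> (if z \<in> square then h z else 0)"
    unfolding measurable_on_def by blast
  have "AE z in lebesgue. z \<notin> N"
    using N by (intro AE_not_in) (simp add: negligible_iff_null_sets)
  then have "AE z in lborel. z \<notin> N" by (simp add: AE_completion_iff)
  then have ae: "AE z in unit_sq. z \<notin> N"
    unfolding unit_sq_eq by (subst AE_restrict_space_iff) (auto elim: eventually_mono)
  \<comment> \<open>Clamping supplies the bound for dominated convergence and keeps the step values
    in [0, 1].\<close>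
  define c where "c n z = max 0 (min 1 (g n z))" for n z
  have c: "continuous_on UNIV (c n)" for n
    unfolding c_def by (intro continuous_intros g)
  have c_meas[measurable]: "c n \<in> borel_measurable unit_sq" for n
    using c by (intro borel_measurable_unit_sq borel_measurable_continuous_onI)
  have c01: "0 \<le> c n z \<and> c n z \<le> 1" for n z by (simp add: c_def)
  have diff1: "\<bar>h z - c n z\<bar> \<le> 1" if "z \<in> square" for n z using h(2)[OF that] c01[of n z] by auto
  have "(\<lambda>n. LINT z|unit_sq. \<bar>h z - c n z\<bar>) \<longlonglongrightarrow> (LINT z|unit_sq. 0 :: real)"
  proof (rule integral_dominated_convergence[where w = "\<lambda>_. 1"])
    show "AE z in unit_sq. (\<lambda>n. \<bar>h z - c n z\<bar>) \<longlonglongrightarrow> 0"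
      using ae AE_space
    proof eventually_elim
      case (elim z)
      then have z: "z \<in> square" by (simp add: space_unit_sq)
      have "(\<lambda>n. c n z) \<longlonglongrightarrow> max 0 (min 1 (h z))"
        unfolding c_def using lim[OF elim(1)] z by (intro tendsto_max tendsto_min tendsto_const) simp
      then have "(\<lambda>n. c n z) \<longlonglongrightarrow> h z" using h(2)[OF z] by simp
      from tendsto_diff[OF tendsto_const[of "h z"] this] show ?case by (simp add: tendsto_rabs_zero)
    qed
    show "AE z in unit_sq. norm \<bar>h z - c n z\<bar> \<le> 1" for n
      using diff1 by (intro AE_I2) (simp add: space_unit_sq)
  qed (use h in simp_all)
  then have "(\<lambda>n. LINT z|unit_sq. \<bar>h z - c n z\<bar>) \<longlonglongrightarrow> 0" by simp
  from order_tendstoD(2)[OF this, of "e / 2"] e obtain k where k: "(LINT z|unit_sq. \<bar>h z - c k z\<bar>) < e / 2"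
    by (auto simp: eventually_sequentially)
  have "uniformly_continuous_on square (c k)"
    by (intro compact_uniformly_continuous compact_Times continuous_on_subset[OF c]) auto
  then obtain d where d: "d > 0" "\<And>z z'. z \<in> square \<Longrightarrow> z' \<in> square \<Longrightarrow> dist z' z < d \<Longrightarrow> dist (c k z') (c k z) < e / 2"
    using e unfolding uniformly_continuous_on_def by (meson half_gt_zero)
  \<comment> \<open>Each coordinate moves by at most 1/n when a point is replaced by the upper
    corner of its cell, and 2/n < d.\<close>
  define N where "N = nat \<lceil>2 / d\<rceil> + 1"
  have "\<exists>w. (\<forall>i j. 0 \<le> w i j \<and> w i j \<le> 1) \<and>
    (LINT z|unit_sq. \<bar>h z - w (cell n (fst z)) (cell n (snd z))\<bar>) < e" if "n \<ge> N" for n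
  proof -
    have n: "n > 0" using that by (simp add: N_def)
    have "2 / d < real N" using d(1) by (simp add: N_def) linarith
    then have "2 / d < real n" using that by simp
    then have nd: "2 / real n < d" using d(1) n by (simp add: field_simps)
    define w where "w i j = c k (real i / real n, real j / real n)" for i j
    have w01: "0 \<le> w i j \<and> w i j \<le> 1" for i j unfolding w_def by (rule c01)
    have w_meas[measurable]: "(\<lambda>z. w (cell n (fst z)) (cell n (snd z))) \<in> borel_measurable unit_sq"
      by (rule step_measurable)
    have close: "\<bar>c k z - w (cell n (fst z)) (cell n (snd z))\<bar> \<le> e / 2" if z: "z \<in> square" for z
    proof -
      let ?z' = "(real (cell n (fst z)) / real n, real (cell n (snd z)) / real n)"
      have "dist ?z' z = sqrt ((dist (fst ?z') (fst z))\<^sup>2 + (dist (snd ?z') (snd z))\<^sup>2)"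
        by (simp add: dist_prod_def)
      also have "\<dots> \<le> dist (fst ?z') (fst z) + dist (snd ?z') (snd z)"
        by (intro sqrt_sum_squares_le_sum) auto
      also have "\<dots> \<le> 1 / real n + 1 / real n"
        using cell_dist[OF n, of "fst z"] cell_dist[OF n, of "snd z"] z
        by (intro add_mono) (auto simp: dist_real_def abs_minus_commute)
      also have "\<dots> < d" using nd by simp
      finally have "dist ?z' z < d" .
      moreover have "?z' \<in> square"
        using cell_range[OF n, of "fst z"] cell_range[OF n, of "snd z"] n by auto
      ultimately have "dist (c k ?z') (c k z) < e / 2" using d(2) z by blast
      then show ?thesis by (simp add: w_def dist_real_def abs_minus_commute)
    qed
    have "(LINT z|unit_sq. \<bar>h z - w (cell n (fst z)) (cell n (snd z))\<bar>) \<le>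
      (LINT z|unit_sq. \<bar>h z - c k z\<bar> + e / 2)"
    proof (intro integral_mono)
      show "integrable unit_sq (\<lambda>z. \<bar>h z - w (cell n (fst z)) (cell n (snd z))\<bar>)"
      proof (rule integrable_sq[of _ 1])
        show "\<bar>\<bar>h z - w (cell n (fst z)) (cell n (snd z))\<bar>\<bar> \<le> 1" if "z \<in> square" for z
          using h(2)[OF that] w01[of "cell n (fst z)" "cell n (snd z)"] by auto
      qed (use h(1) in measurable)
      show "integrable unit_sq (\<lambda>z. \<bar>h z - c k z\<bar> + e / 2)"
        using diff1 h(1) e by (intro integrable_sq[of _ "1 + e / 2"]) auto
      fix z assume "z \<in> space unit_sq"
      then show "\<bar>h z - w (cell n (fst z)) (cell n (snd z))\<bar> \<le> \<bar>h z - c k z\<bar> + e / 2"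
        using close[of z] unfolding space_unit_sq by linarith
    qed
    also have "\<dots> = (LINT z|unit_sq. \<bar>h z - c k z\<bar>) + e / 2"
    proof -
      have "integrable unit_sq (\<lambda>z. \<bar>h z - c k z\<bar>)"
        using diff1 h(1) by (intro integrable_sq[of _ 1]) auto
      then show ?thesis by (simp add: sq.P.prob_space)
    qed
    also have "\<dots> < e" using k by simp
    finally show ?thesis using w01 by blast
  qed
  then show ?thesis by blast
qed

text \<open>The symmetrised weights are rounded at 1/2. This is wrong at a point only if
  \<open>w\<close> and its transpose together err there by at least 1, so an error below e/2 for
  \<open>w\<close> is enough.\<close>

lemma symmetric_pattern_approximation:
  assumes A: "A \<in> sets unit_sq" and sym: "\<And>x y. (x, y) \<in> A \<Longrightarrow> (y, x) \<in> A" and e: "e > 0"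
  shows "\<exists>N. \<forall>n\<ge>N. \<exists>a :: nat \<Rightarrow> nat \<Rightarrow> bool. (\<forall>i j. a i j = a j i) \<and>
    (LINT z|unit_sq. \<bar>indicator A z - of_bool (a (cell n (fst z)) (cell n (snd z)))\<bar> :: real) < e"
proof -
  have A_meas: "(indicator A :: _ \<Rightarrow> real) \<in> borel_measurable unit_sq" using A by simp
  obtain N where N: "\<And>n. n \<ge> N \<Longrightarrow> \<exists>w. (\<forall>i j. 0 \<le> w i j \<and> w i j \<le> 1) \<and>
    (LINT z|unit_sq. \<bar>indicator A z - w (cell n (fst z)) (cell n (snd z))\<bar>) < e / 2"
    using step_approximation[OF A_meas, of "e / 2"] e by auto
  have "\<exists>a :: nat \<Rightarrow> nat \<Rightarrow> bool. (\<forall>i j. a i j = a j i) \<and>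
    (LINT z|unit_sq. \<bar>indicator A z - of_bool (a (cell n (fst z)) (cell n (snd z)))\<bar> :: real) < e"
    if nN: "n \<ge> N" for n
  proof -
    obtain w where w01: "\<And>i j. 0 \<le> w i j \<and> w i j \<le> 1"
      and w: "(LINT z|unit_sq. \<bar>indicator A z - w (cell n (fst z)) (cell n (snd z))\<bar>) < e / 2"
      using N[OF nN] by blast
    define a where "a i j \<longleftrightarrow> w i j + w j i > 1" for i j
    let ?w = "\<lambda>z. w (cell n (fst z)) (cell n (snd z))" and ?w' = "\<lambda>z. w (cell n (snd z)) (cell n (fst z))"
    have [measurable]: "?w \<in> borel_measurable unit_sq" "?w' \<in> borel_measurable unit_sq"
      "(\<lambda>z. of_bool (a (cell n (fst z)) (cell n (snd z))) :: real) \<in> borel_measurable unit_sq"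
      by (rule step_measurable step_measurable[of "\<lambda>i j. w j i"] step_measurable[of "\<lambda>i j. of_bool (a i j)"])+
    note [measurable] = A
    have int: "integrable unit_sq (\<lambda>z. \<bar>indicator A z - ?w z\<bar>)" "integrable unit_sq (\<lambda>z. \<bar>indicator A z - ?w' z\<bar>)"
      "integrable unit_sq (\<lambda>z. \<bar>indicator A z - of_bool (a (cell n (fst z)) (cell n (snd z)))\<bar> :: real)"
    proof -
      have "\<bar>indicator A z - ?w z\<bar> \<le> 1" "\<bar>indicator A z - ?w' z\<bar> \<le> 1" for z
        using w01[of "cell n (fst z)" "cell n (snd z)"] w01[of "cell n (snd z)" "cell n (fst z)"]
        by (auto simp: indicator_def)
      then show "integrable unit_sq (\<lambda>z. \<bar>indicator A z - ?w z\<bar>)" "integrable unit_sq (\<lambda>z. \<bar>indicator A z - ?w' z\<bar>)"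
        by (auto intro!: integrable_sq[of _ 1])
      show "integrable unit_sq (\<lambda>z. \<bar>indicator A z - of_bool (a (cell n (fst z)) (cell n (snd z)))\<bar> :: real)"
        by (rule integrable_sq[of _ 1]) (auto simp: indicator_def)
    qed
    have ind: "indicator A (snd z, fst z) = (indicator A z :: real)" for z
      using sym[of "fst z" "snd z"] sym[of "snd z" "fst z"] by (auto simp: indicator_def)
    have swap: "(LINT z|unit_sq. \<bar>indicator A z - ?w' z\<bar>) = (LINT z|unit_sq. \<bar>indicator A z - ?w z\<bar>)"
      using integral_sq_swap[of "\<lambda>z. \<bar>indicator A z - ?w z\<bar>"] by (simp add: ind)
    have "(LINT z|unit_sq. \<bar>indicator A z - of_bool (a (cell n (fst z)) (cell n (snd z)))\<bar> :: real) \<le>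
      (LINT z|unit_sq. \<bar>indicator A z - ?w z\<bar> + \<bar>indicator A z - ?w' z\<bar>)"
    proof (intro integral_mono Bochner_Integration.integrable_add int)
      fix z
      show "\<bar>indicator A z - of_bool (a (cell n (fst z)) (cell n (snd z)))\<bar> \<le> \<bar>indicator A z - ?w z\<bar> + \<bar>indicator A z - ?w' z\<bar>"
        using w01[of "cell n (fst z)" "cell n (snd z)"] w01[of "cell n (snd z)" "cell n (fst z)"]
        by (auto simp: a_def indicator_def)
    qed
    also have "\<dots> < e" using int w swap by simp
    finally show ?thesis by (intro exI[of _ a]) (auto simp: a_def add.commute)
  qed
  then show ?thesis by blast
qed

section \<open>Averaging over permutations\<close>

lemma exists_permutes_two_points:
  assumes "i \<in> S" "j \<in> S" "i' \<in> S" "j' \<in> S" "i \<noteq> j" "i' \<noteq> j'"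
  shows "\<exists>t. t permutes S \<and> t i = i' \<and> t j = j'"
proof -
  define j'' where "j'' = Transposition.transpose i i' j"
  have "j'' \<in> S" "j'' \<noteq> i'" using assms by (auto simp: j''_def Transposition.transpose_def)
  then have "(Transposition.transpose j'' j' \<circ> Transposition.transpose i i') permutes S"
    using assms by (intro permutes_compose permutes_swap_id)
  moreover have "Transposition.transpose j'' j' (Transposition.transpose i i' i) = i'"
    using \<open>j'' \<noteq> i'\<close> assms by (simp add: transpose_apply_other)
  moreover have "Transposition.transpose j'' j' (Transposition.transpose i i' j) = j'"
    by (simp flip: j''_def)
  ultimately show ?thesis by (intro exI[of _ "Transposition.transpose j'' j' \<circ> Transposition.transpose i i'"]) simp
qed

text \<open>By double transitivity of the symmetric group, every off-diagonal position sees the same average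
  of the entries of \<open>a\<close> over all permutations.\<close>

lemma permuted_correlation_le:
  fixes a w :: "nat \<Rightarrow> nat \<Rightarrow> real"
  assumes n: "n > 0" and a: "\<And>i j. \<bar>a i j\<bar> \<le> 1" and w: "\<And>i j. \<bar>w i j\<bar> \<le> 1"
  shows "\<exists>p. p permutes {1..n} \<and>
    (\<Sum>i=1..n. \<Sum>j=1..n. a (p i) (p j) * w i j) \<le>
    (\<Sum>i=1..n. \<Sum>j=1..n. a i j) * (\<Sum>i=1..n. \<Sum>j=1..n. w i j) / (real n)\<^sup>2 + 4 * real n"
proof -
  define S where "S = {1..n}"
  define Od where "Od = {z \<in> S \<times> S. fst z \<noteq> snd z}"
  define Perms where "Perms = {p. p permutes S}"
  have fin: "finite S" "finite Od" "finite Perms" by (auto simp: S_def Od_def Perms_def finite_permutations)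
  have cS: "card S = n" by (simp add: S_def)
  have split: "(\<Sum>i=1..n. \<Sum>j=1..n. f i j) = (\<Sum>z\<in>Od. f (fst z) (snd z)) + (\<Sum>i=1..n. f i i)" for f :: "nat \<Rightarrow> nat \<Rightarrow> real"
  proof -
    have "(\<Sum>i=1..n. \<Sum>j=1..n. f i j) = (\<Sum>z\<in>S \<times> S. f (fst z) (snd z))"
      by (simp add: S_def sum.cartesian_product case_prod_unfold)
    also have "S \<times> S = Od \<union> (\<lambda>i. (i, i)) ` S" by (auto simp: Od_def)
    also have "(\<Sum>z\<in>Od \<union> (\<lambda>i. (i, i)) ` S. f (fst z) (snd z)) =
      (\<Sum>z\<in>Od. f (fst z) (snd z)) + (\<Sum>z\<in>(\<lambda>i. (i, i)) ` S. f (fst z) (snd z))"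
      using fin by (intro sum.union_disjoint) (auto simp: Od_def)
    also have "(\<Sum>z\<in>(\<lambda>i. (i, i)) ` S. f (fst z) (snd z)) = (\<Sum>i=1..n. f i i)"
      by (subst sum.reindex) (auto simp: S_def inj_on_def)
    finally show ?thesis .
  qed
  have cO: "real (card Od) = real n * (real n - 1)"
    using split[of "\<lambda>_ _. 1"] by (simp add: algebra_simps)
  define a' where "a' = (\<Sum>z\<in>Od. a (fst z) (snd z))"
  define w' where "w' = (\<Sum>z\<in>Od. w (fst z) (snd z))"
  define da where "da = (\<Sum>i=1..n. a i i)"
  define dw where "dw = (\<Sum>i=1..n. w i i)"
  have diag: "\<bar>\<Sum>i=1..n. f i\<bar> \<le> real n" if "\<And>i. \<bar>f i\<bar> \<le> 1" for f :: "nat \<Rightarrow> real"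
    using sum_norm_bound[of "{1..n}" f 1] that by simp
  have off: "\<bar>\<Sum>z\<in>Od. f z\<bar> \<le> real n * (real n - 1)" if "\<And>z. \<bar>f z\<bar> \<le> 1" for f :: "nat \<times> nat \<Rightarrow> real"
    using sum_norm_bound[of Od f 1] that by (simp flip: cO)
  have Perms_ne: "card Perms > 0" using card_permutations[OF cS fin(1)] by (simp add: Perms_def)
  \<comment> \<open>The least value over all p is at most the mean. Multiplying by the number of
    off-diagonal positions avoids a division by 0 at n = 1.\<close>
  have "\<exists>p\<in>Perms. (\<Sum>z\<in>Od. a (p (fst z)) (p (snd z)) * w (fst z) (snd z)) * real (card Od) \<le> a' * w'"
  proof (rule ccontr)
    assume "\<not> ?thesis"
    then have *: "\<And>p. p \<in> Perms \<Longrightarrow> a' * w' < (\<Sum>z\<in>Od. a (p (fst z)) (p (snd z)) * w (fst z) (snd z)) * real (card Od)"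
      by (auto simp: not_le)
    define T where "T z = (\<Sum>p\<in>Perms. a (p (fst z)) (p (snd z)))" for z
    have T_const: "T z = T z'" if z: "z \<in> Od" "z' \<in> Od" for z z'
    proof -
      obtain t where t: "t permutes S" "t (fst z) = fst z'" "t (snd z) = snd z'"
        using exists_permutes_two_points[of "fst z" S "snd z" "fst z'" "snd z'"] z by (auto simp: Od_def)
      have "T z' = (\<Sum>p\<in>Perms. a (p (t (fst z))) (p (t (snd z))))" by (simp add: T_def t)
      also have "\<dots> = T z"
        unfolding T_def Perms_def using sum_permutations_compose_right[OF t(1), of "\<lambda>p. a (p (fst z)) (p (snd z))"] by simp
      finally show ?thesis by simp
    qed
    have row: "(\<Sum>z\<in>Od. a (p (fst z)) (p (snd z))) = a'" if "p \<in> Perms" for p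
    proof -
      from that have p: "p permutes S" by (simp add: Perms_def)
      have "bij_betw (\<lambda>z. (p (fst z), p (snd z))) Od Od"
      proof (rule bij_betw_byWitness[where f' = "\<lambda>z. (inv p (fst z), inv p (snd z))"])
        show "(\<lambda>z. (p (fst z), p (snd z))) ` Od \<subseteq> Od"
          using permutes_in_image[OF p] permutes_inj[OF p] by (auto simp: Od_def dest: injD)
        show "(\<lambda>z. (inv p (fst z), inv p (snd z))) ` Od \<subseteq> Od"
          using permutes_in_image[OF permutes_inv[OF p]] permutes_inj[OF permutes_inv[OF p]] by (auto simp: Od_def dest: injD)
      qed (use permutes_inverses[OF p] in auto)
      from sum.reindex_bij_betw[OF this, of "\<lambda>z. a (fst z) (snd z)"] show ?thesis by (simp add: a'_def)
    qed
    have T_val: "real (card Od) * T z = real (card Perms) * a'" if "z \<in> Od" for z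
    proof -
      have "(\<Sum>z'\<in>Od. T z') = (\<Sum>z'\<in>Od. T z)"
        by (intro sum.cong refl T_const that)
      then have "real (card Od) * T z = (\<Sum>z'\<in>Od. T z')" by simp
      also have "\<dots> = (\<Sum>p\<in>Perms. \<Sum>z\<in>Od. a (p (fst z)) (p (snd z)))" unfolding T_def by (rule sum.swap)
      also have "\<dots> = real (card Perms) * a'" using row by simp
      finally show ?thesis .
    qed
    have "real (card Perms) * (a' * w') = (\<Sum>p\<in>Perms. a' * w')" by simp
    also have "\<dots> < (\<Sum>p\<in>Perms. (\<Sum>z\<in>Od. a (p (fst z)) (p (snd z)) * w (fst z) (snd z)) * real (card Od))"
      using * fin Perms_ne by (intro sum_strict_mono) (auto simp: card_gt_0_iff)
    also have "\<dots> = (\<Sum>z\<in>Od. \<Sum>p\<in>Perms. a (p (fst z)) (p (snd z)) * w (fst z) (snd z)) * real (card Od)"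
      by (subst sum_distrib_right[symmetric], subst sum.swap, rule refl)
    also have "\<dots> = (\<Sum>z\<in>Od. (real (card Od) * T z) * w (fst z) (snd z))"
      by (simp add: T_def sum_distrib_right sum_distrib_left mult_ac)
    also have "\<dots> = (\<Sum>z\<in>Od. (real (card Perms) * a') * w (fst z) (snd z))"
      by (intro sum.cong refl) (simp only: T_val)
    also have "\<dots> = real (card Perms) * (a' * w')"
      by (simp add: w'_def sum_distrib_left mult_ac)
    finally show False by simp
  qed
  then obtain p where p: "p permutes S"
    and pO: "(\<Sum>z\<in>Od. a (p (fst z)) (p (snd z)) * w (fst z) (snd z)) * real (card Od) \<le> a' * w'"
    by (auto simp: Perms_def)
  let ?s = "\<Sum>z\<in>Od. a (p (fst z)) (p (snd z)) * w (fst z) (snd z)"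
  have a'b: "\<bar>a'\<bar> \<le> real n * (real n - 1)" and w'b: "\<bar>w'\<bar> \<le> real n * (real n - 1)"
    unfolding a'_def w'_def by (rule off, rule a, rule off, rule w)
  have dab: "\<bar>da\<bar> \<le> real n" and dwb: "\<bar>dw\<bar> \<le> real n"
    unfolding da_def dw_def by (rule diag, rule a, rule diag, rule w)
  \<comment> \<open>The error 4n consists of n for replacing n(n-1) by n^2, of 2n for adding the
    diagonals to both sums, and of n for the diagonal of the permuted sum.\<close>
  have s1: "?s \<le> a' * w' / (real n)\<^sup>2 + real n"
  proof (cases "n = 1")
    case True
    then have "Od = {}" by (auto simp: Od_def S_def)
    then show ?thesis by (simp add: a'_def)
  next
    case False
    then have n1: "real n - 1 > 0" using n by simp
    have "?s * (real n * (real n - 1)) \<le> a' * w'" using pO by (simp add: cO)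
    then have "?s \<le> a' * w' / (real n * (real n - 1))"
      using n n1 by (subst pos_le_divide_eq) auto
    also have "\<dots> = a' * w' / (real n)\<^sup>2 + a' * w' / ((real n)\<^sup>2 * (real n - 1))"
    proof -
      have "x / (m * (m - 1)) = x / m\<^sup>2 + x / (m\<^sup>2 * (m - 1))" if "m > 1" for x m :: real
        using that by (simp add: power2_eq_square divide_simps) (simp add: algebra_simps)
      from this[of "real n"] show ?thesis using n1 by simp
    qed
    also have "a' * w' / ((real n)\<^sup>2 * (real n - 1)) \<le> real n - 1"
    proof (subst pos_divide_le_eq)
      have "a' * w' \<le> \<bar>a'\<bar> * \<bar>w'\<bar>" by (simp flip: abs_mult)
      also have "\<dots> \<le> (real n * (real n - 1)) * (real n * (real n - 1))"
        using a'b w'b n1 by (intro mult_mono) auto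
      finally show "a' * w' \<le> (real n - 1) * ((real n)\<^sup>2 * (real n - 1))"
        by (simp add: power2_eq_square mult_ac)
    qed (use n n1 in auto)
    finally show ?thesis by simp
  qed
  have s2: "a' * w' / (real n)\<^sup>2 \<le> (a' + da) * (w' + dw) / (real n)\<^sup>2 + 2 * real n"
  proof -
    have nn: "real n * (real n - 1) \<le> real n * real n" by (intro mult_left_mono) auto
    have "a' * w' - (a' + da) * (w' + dw) = - (a' * dw) - da * (w' + dw)" by (simp add: algebra_simps)
    also have "\<dots> \<le> \<bar>a'\<bar> * \<bar>dw\<bar> + \<bar>da\<bar> * \<bar>w' + dw\<bar>"
      using abs_ge_minus_self[of "a' * dw"] abs_ge_minus_self[of "da * (w' + dw)"] by (simp add: abs_mult)
    also have "\<bar>a'\<bar> * \<bar>dw\<bar> \<le> (real n * real n) * real n"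
      using a'b dwb nn by (intro mult_mono) auto
    also have "\<bar>da\<bar> * \<bar>w' + dw\<bar> \<le> real n * (real n * real n)"
    proof (intro mult_mono dab)
      have "\<bar>w' + dw\<bar> \<le> real n * (real n - 1) + real n" using w'b dwb by linarith
      then show "\<bar>w' + dw\<bar> \<le> real n * real n" by (simp add: algebra_simps)
    qed auto
    finally have "a' * w' \<le> (a' + da) * (w' + dw) + 2 * real n * (real n)\<^sup>2"
      by (simp add: power2_eq_square)
    then show ?thesis using n by (simp add: field_simps)
  qed
  have "\<bar>a (p i) (p i) * w i i\<bar> \<le> 1" for i by (rule abs_mult_le_left[OF a w])
  from diag[of "\<lambda>i. a (p i) (p i) * w i i", OF this] have s3: "(\<Sum>i=1..n. a (p i) (p i) * w i i) \<le> real n" by linarith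
  have "(\<Sum>i=1..n. \<Sum>j=1..n. a (p i) (p j) * w i j) = ?s + (\<Sum>i=1..n. a (p i) (p i) * w i i)"
    by (rule split)
  also have "\<dots> \<le> (a' + da) * (w' + dw) / (real n)\<^sup>2 + 4 * real n" using s1 s2 s3 by linarith
  finally show ?thesis
    using p unfolding S_def a'_def w'_def da_def dw_def split[symmetric] by blast
qed

section \<open>Flexible graphon properties\<close>

definition cell_perm :: "nat \<Rightarrow> (nat \<Rightarrow> nat) \<Rightarrow> real \<Rightarrow> real" where
  "cell_perm n p x = x + (real (p (cell n x)) - real (cell n x)) / real n"

text \<open>The point 0 is left out: it is sent to the left end of cell p 1, which belongs to the
  preceding cell if p 1 > 1.\<close>

lemma cell_perm_bounds:
  assumes n: "n > 0" and p: "p permutes {1..n}" and x: "x \<in> {0<..1}"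
  shows "cell_perm n p x \<in> {0<..1}" "cell n (cell_perm n p x) = p (cell n x)"
proof -
  let ?i = "cell n x"
  have i: "?i \<in> {1..n}" using n by (rule cell_range)
  then have pi: "p ?i \<in> {1..n}" using permutes_in_image[OF p] by blast
  have "x \<in> {(real ?i - 1) / real n <.. real ?i / real n}"
    using cell_eq_iff[OF i x] by simp
  then have *: "cell_perm n p x \<in> {(real (p ?i) - 1) / real n <.. real (p ?i) / real n}"
    by (auto simp: cell_perm_def diff_divide_distrib)
  have "0 \<le> (real (p ?i) - 1) / real n" "real (p ?i) / real n \<le> 1" using pi n by auto
  with * show r: "cell_perm n p x \<in> {0<..1}" by auto
  show "cell n (cell_perm n p x) = p ?i"
    using cell_eq_iff[OF pi r] * by simp
qed

lemma cell_perm_0: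
  assumes n: "n > 0" and p: "p permutes {1..n}"
  shows "cell_perm n p 0 \<in> {0..1}"
proof -
  have c: "cell n 0 = 1" using n by (simp add: cell_def)
  have "p 1 \<in> {1..n}" using permutes_in_image[OF p, of 1] n by simp
  then show ?thesis using n by (auto simp: cell_perm_def c field_simps)
qed

lemma cell_perm_measurable:
  assumes n: "n > 0" and p: "p permutes {1..n}"
  shows "cell_perm n p \<in> unit_lborel \<rightarrow>\<^sub>M unit_lborel"
proof (rule measurable_restrict_space2)
  show "cell_perm n p \<in> space unit_lborel \<rightarrow> {0..1}"
  proof
    fix x assume "x \<in> space unit_lborel"
    then show "cell_perm n p x \<in> {0..1}"
      using cell_perm_0[OF n p] cell_perm_bounds(1)[OF n p, of x] by (cases "x = 0") auto
  qed
  have "(\<lambda>x. real (p (cell n x)) - real (cell n x)) \<in> borel_measurable unit_lborel"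
    using measurable_compose[OF cell_measurable, of "\<lambda>i. real (p i) - real i" borel n] by simp
  moreover have "(\<lambda>x. x) \<in> borel_measurable unit_lborel" by (intro measurable_restrict_space1) simp
  ultimately have "cell_perm n p \<in> borel_measurable unit_lborel"
    unfolding cell_perm_def by measurable
  then show "cell_perm n p \<in> unit_lborel \<rightarrow>\<^sub>M lborel" by simp
qed

text \<open>Off the null set {0} the map is a translation on each cell, and it permutes the
  cells.\<close>

lemma distr_cell_perm:
  assumes n: "n > 0" and p: "p permutes {1..n}"
  shows "distr unit_lborel unit_lborel (cell_perm n p) = unit_lborel"
proof (rule measure_eqI)
  fix A assume "A \<in> sets (distr unit_lborel unit_lborel (cell_perm n p))"
  then have A: "A \<in> sets unit_lborel" by simp
  then have Ab: "A \<in> sets borel" "A \<subseteq> {0..1}" by (auto simp: sets_restrict_space_iff)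
  define C where "C i = {(real i - 1) / real n <.. real i / real n}" for i :: nat
  have C_sub: "C i \<subseteq> {0<..1}" if "i \<in> {1..n}" for i
  proof -
    have "0 \<le> (real i - 1) / real n" "real i / real n \<le> 1" using that n by auto
    then show ?thesis by (auto simp: C_def)
  qed
  have C_cell: "x \<in> C i \<longleftrightarrow> x \<in> {0<..1} \<and> cell n x = i" if "i \<in> {1..n}" for x i
    using cell_eq_iff[OF that, of x] C_sub[OF that] by (auto simp: C_def)
  have part: "emeasure unit_lborel B = (\<Sum>i=1..n. emeasure lborel (C i \<inter> B))"
    if B: "B \<in> sets unit_lborel" for B
  proof -
    have Bb: "B \<in> sets borel" "B \<subseteq> {0..1}" using B by (auto simp: sets_restrict_space_iff)
    have "emeasure unit_lborel B = emeasure lborel B"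
      using Bb by (subst emeasure_restrict_space) auto
    also have "\<dots> = emeasure lborel (\<Union>i\<in>{1..n}. C i \<inter> B)"
    proof (rule emeasure_eq_AE)
      have eq: "x \<in> B \<longleftrightarrow> x \<in> (\<Union>i\<in>{1..n}. C i \<inter> B)" if "x \<noteq> 0" for x
        using Bb(2) C_cell[of _ x] cell_range[OF n, of x] that by fastforce
      show "AE x in lborel. x \<in> B \<longleftrightarrow> x \<in> (\<Union>i\<in>{1..n}. C i \<inter> B)"
        using AE_lborel_singleton[of 0] by eventually_elim (rule eq)
    qed (use Bb in \<open>auto simp: C_def\<close>)
    also have "\<dots> = (\<Sum>i=1..n. emeasure lborel (C i \<inter> B))"
    proof (rule sum_emeasure[symmetric])
      show "disjoint_family_on (\<lambda>i. C i \<inter> B) {1..n}"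
        unfolding disjoint_family_on_def by (auto simp: C_cell)
    qed (use Bb in \<open>auto simp: C_def\<close>)
    finally show ?thesis .
  qed
  let ?A = "cell_perm n p -` A \<inter> space unit_lborel"
  have "emeasure (distr unit_lborel unit_lborel (cell_perm n p)) A = emeasure unit_lborel ?A"
    using A cell_perm_measurable[OF n p] by (rule emeasure_distr[rotated])
  also have "\<dots> = (\<Sum>i=1..n. emeasure lborel (C i \<inter> ?A))"
    by (rule part) (rule measurable_sets[OF cell_perm_measurable[OF n p] A])
  also have "\<dots> = (\<Sum>i=1..n. emeasure lborel (C (p i) \<inter> A))"
  proof (intro sum.cong refl)
    fix i assume i: "i \<in> {1..n}"
    define c where "c = (real (p i) - real i) / real n"
    have "C i \<inter> ?A = (\<lambda>x. c + x) -` (C (p i) \<inter> A)"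
    proof -
      have "x \<in> ?A \<longleftrightarrow> c + x \<in> A" if "x \<in> C i" for x
        using that C_cell[OF i, of x] by (auto simp: cell_perm_def c_def add.commute)
      moreover have "x \<in> C i \<longleftrightarrow> c + x \<in> C (p i)" for x
        by (auto simp: C_def c_def diff_divide_distrib)
      ultimately have "x \<in> C i \<inter> ?A \<longleftrightarrow> c + x \<in> C (p i) \<inter> A" for x by blast
      then show ?thesis by (intro set_eqI) (simp only: vimage_eq)
    qed
    also have "emeasure lborel \<dots> = emeasure (distr lborel borel ((+) c)) (C (p i) \<inter> A)"
      using Ab by (subst emeasure_distr) (auto simp: C_def)
    finally show "emeasure lborel (C i \<inter> ?A) = emeasure lborel (C (p i) \<inter> A)"
      by (simp add: lborel_distr_plus)
  qed
  also have "\<dots> = (\<Sum>i=1..n. emeasure lborel (C i \<inter> A))"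
    by (rule sum.reindex_bij_betw[OF permutes_imp_bij[OF p], of "\<lambda>i. emeasure lborel (C i \<inter> A)"])
  also have "\<dots> = emeasure unit_lborel A" by (rule part[OF A, symmetric])
  finally show "emeasure (distr unit_lborel unit_lborel (cell_perm n p)) A = emeasure unit_lborel A" .
qed simp

lemma distr_sq_cell_perm:
  assumes n: "n > 0" and p: "p permutes {1..n}"
  shows "distr unit_sq unit_sq (\<lambda>z. (cell_perm n p (fst z), cell_perm n p (snd z))) = unit_sq"
  using pair_measure_distr[OF cell_perm_measurable[OF n p] cell_perm_measurable[OF n p]]
  by (simp add: distr_cell_perm[OF n p] unit.sigma_finite_measure_axioms case_prod_unfold)

lemma sq_cell_perm_measurable:
  assumes n: "n > 0" and p: "p permutes {1..n}"
  shows "(\<lambda>z. (cell_perm n p (fst z), cell_perm n p (snd z))) \<in> unit_sq \<rightarrow>\<^sub>M unit_sq"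
  using cell_perm_measurable[OF n p] by measurable

lemma integral_sq_cell_perm:
  fixes f :: "real \<times> real \<Rightarrow> real"
  assumes "n > 0" "p permutes {1..n}" "f \<in> borel_measurable unit_sq"
  shows "(LINT z|unit_sq. f (cell_perm n p (fst z), cell_perm n p (snd z))) = integral\<^sup>L unit_sq f"
  using integral_distr[OF sq_cell_perm_measurable[OF assms(1,2)] assms(3)]
  by (simp add: distr_sq_cell_perm[OF assms(1,2)])

text \<open>Applied in each coordinate, the map preserves the measure of the cube. Hence rearranging
  a function does not lead out of a graphon property.\<close>

lemma t_fun_cell_perm:
  assumes n: "n > 0" and p: "p permutes {1..n}" and F: "simple_graph F"
    and U: "(\<lambda>z. U (fst z) (snd z)) \<in> borel_measurable unit_sq"
  shows "t_fun F (\<lambda>x y. U (cell_perm n p x) (cell_perm n p y)) = t_fun F U"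
proof -
  let ?\<phi> = "cell_perm n p" and ?M = "\<Pi>\<^sub>M _\<in>verts F. unit_lborel"
  have V: "finite (verts F)" using F by (simp add: simple_graph_def)
  have "distr ?M ?M (compose (verts F) ?\<phi>) = (\<Pi>\<^sub>M _\<in>verts F. distr unit_lborel unit_lborel ?\<phi>)"
    using cell_perm_measurable[OF n p] V
    by (intro distr_PiM_finite_prob_space' unit.prob_space_axioms) auto
  then have dM: "distr ?M ?M (compose (verts F) ?\<phi>) = ?M"
    by (simp add: distr_cell_perm[OF n p])
  let ?f = "\<lambda>x. \<Prod>(i, j)\<in>edge_pairs F. U (x i) (x j)"
  have f: "?f \<in> borel_measurable ?M"
  proof (intro borel_measurable_prod, clarify)
    fix i j assume "(i, j) \<in> edge_pairs F"
    from edge_pairs_sub(1,2)[OF F this] show "(\<lambda>x. U (x i) (x j)) \<in> borel_measurable ?M"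
      by (rule measurable_cube_pair[OF _ _ U])
  qed
  have cm: "compose (verts F) ?\<phi> \<in> ?M \<rightarrow>\<^sub>M ?M"
    unfolding compose_def using cell_perm_measurable[OF n p]
    by (intro measurable_restrict measurable_compose[OF measurable_component_singleton]) auto
  have Um: "(\<lambda>z. U (?\<phi> (fst z)) (?\<phi> (snd z))) \<in> borel_measurable unit_sq"
    using measurable_compose[OF sq_cell_perm_measurable[OF n p] U] by simp
  have "t_fun F (\<lambda>x y. U (?\<phi> x) (?\<phi> y)) = (LINT x|?M. ?f (compose (verts F) ?\<phi> x))"
    unfolding t_fun_borel_cong[OF F Um AE_I2[OF refl]]
    by (intro Bochner_Integration.integral_cong prod.cong refl)
       (auto simp: compose_def dest: edge_pairs_sub[OF F])
  also have "\<dots> = (LINT x|?M. ?f x)"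
    using integral_distr[OF cm f] by (simp add: dM)
  also have "\<dots> = t_fun F U"
    by (rule t_fun_borel_cong[OF F U AE_I2[OF refl], symmetric])
  finally show ?thesis .
qed

section \<open>The cost of flexing\<close>

definition flex_cost :: "(real \<Rightarrow> real \<Rightarrow> real) \<Rightarrow> (real \<Rightarrow> real \<Rightarrow> real) \<Rightarrow> real" where
  "flex_cost U W = (LINT z|unit_sq. indicator {z. U (fst z) (snd z) = 0} z * W (fst z) (snd z) +
     indicator {z. U (fst z) (snd z) = 1} z * (1 - W (fst z) (snd z)))"

lemma W0_bounds: "W \<in> W0 \<Longrightarrow> z \<in> square \<Longrightarrow> 0 \<le> W (fst z) (snd z) \<and> W (fst z) (snd z) \<le> 1"
  by (auto simp: W0_def)

lemma W0_I:
  assumes "(\<lambda>z. W (fst z) (snd z)) \<in> borel_measurable unit_sq"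
    "\<And>x y. x \<in> {0..1} \<Longrightarrow> y \<in> {0..1} \<Longrightarrow> W x y = W y x \<and> 0 \<le> W x y \<and> W x y \<le> 1"
  shows "W \<in> W0"
  using borel_measurable_lebesgue_square[OF assms(1)] assms(2) by (simp add: W0_def case_prod_unfold)

lemma level_indicator_measurable:
  fixes U :: "real \<Rightarrow> real \<Rightarrow> real"
  assumes "(\<lambda>z. U (fst z) (snd z)) \<in> borel_measurable unit_sq"
  shows "(indicator {z. U (fst z) (snd z) = c} :: _ \<Rightarrow> real) \<in> borel_measurable unit_sq"
proof -
  have "{z \<in> space unit_sq. U (fst z) (snd z) = c} \<in> sets unit_sq"
    using assms by measurable
  then have "(indicator {z \<in> space unit_sq. U (fst z) (snd z) = c} :: _ \<Rightarrow> real) \<in> borel_measurable unit_sq"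
    by simp
  then show ?thesis by (rule measurable_cong[THEN iffD1, rotated]) (auto simp: indicator_def)
qed

lemma d1_fun_le_flex_cost:
  assumes R: "graphon_property R" "flexible_fun_property R" and UR: "U \<in> R"
    and U: "(\<lambda>z. U (fst z) (snd z)) \<in> borel_measurable unit_sq"
    and W: "W \<in> W0" "(\<lambda>z. W (fst z) (snd z)) \<in> borel_measurable unit_sq"
  shows "d1_fun_set W R \<le> ennreal (flex_cost U W)"
proof -
  have U0: "U \<in> W0" using R(1) UR by (auto simp: graphon_property_def)
  define V where "V x y = (if U x y = 0 then 0 else if U x y = 1 then 1 else W x y)" for x y
  have V_eq: "V x y = indicator {z. U (fst z) (snd z) = 1} (x, y) +
    (1 - indicator {z. U (fst z) (snd z) = 0} (x, y) - indicator {z. U (fst z) (snd z) = 1} (x, y)) * W x y" for x y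
    by (auto simp: V_def indicator_def)
  have Vm: "(\<lambda>z. V (fst z) (snd z)) \<in> borel_measurable unit_sq"
    unfolding V_eq using level_indicator_measurable[OF U] W(2) by simp
  have "V \<in> W0"
    using U0 W(1) by (intro W0_I[OF Vm]) (auto simp: V_def W0_def)
  then have "flexing V U" using U0 by (auto simp: flexing_def V_def)
  then have VR: "V \<in> R" using R(2) UR by (auto simp: flexible_fun_property_def)
  have "d1_fun W V = (LINT z|unit_sq. \<bar>W (fst z) (snd z) - V (fst z) (snd z)\<bar>)"
    unfolding d1_fun_def case_prod_unfold using W(2) Vm by (intro integral_lebesgue_square) simp
  also have "\<dots> = flex_cost U W"
    unfolding flex_cost_def
  proof (intro Bochner_Integration.integral_cong refl)
    fix z assume "z \<in> space unit_sq"
    then have "0 \<le> W (fst z) (snd z) \<and> W (fst z) (snd z) \<le> 1" using W0_bounds[OF W(1)] by (simp add: space_unit_sq)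
    then show "\<bar>W (fst z) (snd z) - V (fst z) (snd z)\<bar> =
      indicator {z. U (fst z) (snd z) = 0} z * W (fst z) (snd z) +
      indicator {z. U (fst z) (snd z) = 1} z * (1 - W (fst z) (snd z))"
      by (auto simp: V_def indicator_def)
  qed
  finally show ?thesis
    unfolding d1_fun_set_def using VR by (metis INF_lower)
qed

lemma W0_measurable: "W \<in> W0 \<Longrightarrow> (\<lambda>z. W (fst z) (snd z)) \<in> borel_measurable (lebesgue_on square)"
  by (auto simp: W0_def case_prod_unfold)

lemma d1_fun_cong_AE:
  assumes "W \<in> W0" "W' \<in> W0" "U \<in> W0" "U' \<in> W0"
    "AE z in unit_sq. W (fst z) (snd z) = W' (fst z) (snd z)"
    "AE z in unit_sq. U (fst z) (snd z) = U' (fst z) (snd z)"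
  shows "d1_fun W U = d1_fun W' U'"
  unfolding d1_fun_def case_prod_unfold
proof (rule integral_cong_AE)
  note [measurable] = assms(1-4)[THEN W0_measurable]
  show "(\<lambda>z. \<bar>W (fst z) (snd z) - U (fst z) (snd z)\<bar>) \<in> borel_measurable (lebesgue_on square)"
    "(\<lambda>z. \<bar>W' (fst z) (snd z) - U' (fst z) (snd z)\<bar>) \<in> borel_measurable (lebesgue_on square)"
    by measurable
  have "AE z in lebesgue_on square. W (fst z) (snd z) = W' (fst z) (snd z)"
    "AE z in lebesgue_on square. U (fst z) (snd z) = U' (fst z) (snd z)"
    using assms(5,6) by (simp_all only: AE_lebesgue_square)
  then show "AE z in lebesgue_on square. \<bar>W (fst z) (snd z) - U (fst z) (snd z)\<bar> = \<bar>W' (fst z) (snd z) - U' (fst z) (snd z)\<bar>"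
    by eventually_elim simp
qed

text \<open>A Borel version has the same densities, so it is isomorphic to \<open>U\<close>.\<close>

lemma graphon_property_borel_version:
  assumes R: "graphon_property R" and UR: "U \<in> R"
  obtains U' where "U' \<in> R" "(\<lambda>z. U' (fst z) (snd z)) \<in> borel_measurable unit_sq"
    "AE z in unit_sq. U' (fst z) (snd z) = U (fst z) (snd z)"
proof -
  have U0: "U \<in> W0" using R UR by (auto simp: graphon_property_def)
  obtain U' where U': "U' \<in> W0" "(\<lambda>z. U' (fst z) (snd z)) \<in> borel_measurable unit_sq"
    "AE z in unit_sq. U' (fst z) (snd z) = U (fst z) (snd z)"
    by (rule W0_borel_version[OF U0])
  have "t_fun F U' = t_fun F U" if "simple_graph F" for F
    using t_fun_borel_cong[OF that U'(2,3)] t_fun_borel_cong[OF that U'(2) AE_I2[OF refl]] by simp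
  then have "isomorphic_fun U' U" by (simp add: isomorphic_fun_def)
  then have "U' \<in> R" using R UR U'(1) by (auto simp: graphon_property_def)
  then show ?thesis using that U' by blast
qed

lemma flex_cost_const:
  assumes U: "(\<lambda>z. U (fst z) (snd z)) \<in> borel_measurable unit_sq"
  shows "flex_cost U (\<lambda>_ _. p) = p * (LINT z|unit_sq. indicator {z. U (fst z) (snd z) = 0} z) +
    (1 - p) * (LINT z|unit_sq. indicator {z. U (fst z) (snd z) = 1} z)"
proof -
  have int: "integrable unit_sq (indicator {z. U (fst z) (snd z) = c} :: _ \<Rightarrow> real)" for c
    by (rule integrable_sq[of _ 1]) (use level_indicator_measurable[OF U] in \<open>auto simp: indicator_def\<close>)
  show ?thesis unfolding flex_cost_def
    using int[of 0] int[of 1] by simp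
qed

text \<open>The integrands agree where \<open>U\<close> is 0 or 1, and the left one vanishes
  elsewhere. This is the converse to \<open>d1_fun_le_flex_cost\<close> that lets the cost replace
  the distance of constants from R.\<close>

lemma flex_cost_const_le_d1:
  assumes U: "U \<in> W0" "(\<lambda>z. U (fst z) (snd z)) \<in> borel_measurable unit_sq" and p: "0 \<le> p" "p \<le> 1"
  shows "flex_cost U (\<lambda>_ _. p) \<le> d1_fun (\<lambda>_ _. p) U"
proof -
  note [measurable] = U(2) level_indicator_measurable[OF U(2)]
  have d: "d1_fun (\<lambda>_ _. p) U = (LINT z|unit_sq. \<bar>p - U (fst z) (snd z)\<bar>)"
    unfolding d1_fun_def case_prod_unfold by (intro integral_lebesgue_square) simp
  show ?thesis
    unfolding d flex_cost_def
  proof (intro integral_mono)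
    show "integrable unit_sq (\<lambda>z. indicator {z. U (fst z) (snd z) = 0} z * p + indicator {z. U (fst z) (snd z) = 1} z * (1 - p))"
      using p by (intro integrable_sq[of _ 1]) (auto simp: indicator_def)
    show "integrable unit_sq (\<lambda>z. \<bar>p - U (fst z) (snd z)\<bar>)"
    proof (rule integrable_sq[of _ 1])
      show "\<bar>\<bar>p - U (fst z) (snd z)\<bar>\<bar> \<le> 1" if "z \<in> square" for z
        using W0_bounds[OF U(1) that] p by linarith
    qed measurable
  qed (use p in \<open>auto simp: indicator_def\<close>)
qed

text \<open>The cost is the correlation of S = Z - E with W, plus the integral of E, which
  rearranging \<open>U\<close> does not change. For step functions some permutation brings the
  correlation down to the product of the means, up to a small error.\<close>

lemma flex_cost_cell_perm_le:
  assumes U: "U \<in> W0" "(\<lambda>z. U (fst z) (snd z)) \<in> borel_measurable unit_sq"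
    and W: "W \<in> W0" "(\<lambda>z. W (fst z) (snd z)) \<in> borel_measurable unit_sq" and e: "e > 0"
  shows "\<exists>n p. n > 0 \<and> p permutes {1..n} \<and>
    flex_cost (\<lambda>x y. U (cell_perm n p x) (cell_perm n p y)) W \<le>
    flex_cost U (\<lambda>_ _. LINT z|unit_sq. W (fst z) (snd z)) + e"
proof -
  define q where "q = (LINT z|unit_sq. W (fst z) (snd z))"
  define Z :: "real \<times> real \<Rightarrow> real" where "Z = indicator {z. U (fst z) (snd z) = 0}"
  define E :: "real \<times> real \<Rightarrow> real" where "E = indicator {z. U (fst z) (snd z) = 1}"
  define S where "S z = Z z - E z" for z
  have meas[measurable]: "Z \<in> borel_measurable unit_sq" "E \<in> borel_measurable unit_sq"
    "(\<lambda>z. W (fst z) (snd z)) \<in> borel_measurable unit_sq"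
    using level_indicator_measurable[OF U(2), of 0] level_indicator_measurable[OF U(2), of 1] W(2)
    unfolding Z_def E_def by blast+
  have S_meas[measurable]: "S \<in> borel_measurable unit_sq" unfolding S_def by measurable
  have S1: "\<bar>S z\<bar> \<le> 1" for z by (simp add: S_def Z_def E_def indicator_def)
  have W01: "0 \<le> W (fst z) (snd z) \<and> W (fst z) (snd z) \<le> 1" if "z \<in> square" for z
    using W0_bounds[OF W(1) that] .
  have W1: "\<bar>W (fst z) (snd z)\<bar> \<le> 1" if "z \<in> square" for z using W01[OF that] by simp
  have q: "\<bar>q\<bar> \<le> 1" unfolding q_def by (rule integral_sq_bound[OF W(2) W1])
  have iE: "integrable unit_sq E" by (rule integrable_sq[of _ 1, OF meas(2)]) (simp add: E_def indicator_def)
  have iS: "integrable unit_sq S" by (rule integrable_sq[of _ 1]) (auto simp: S1)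
  have iW: "integrable unit_sq (\<lambda>z. W (fst z) (snd z))" by (rule integrable_sq[of _ 1]) (auto intro: W1)
  \<comment> \<open>\<open>step_approximation\<close> takes values in [0, 1], hence the scaling.
    Undoing it doubles the error, so S gets e/16 and W gets e/8.\<close>
  have Sh: "0 \<le> (S z + 1) / 2 \<and> (S z + 1) / 2 \<le> 1" if "z \<in> square" for z
    using S1[of z] by (simp add: abs_le_iff)
  have Sm: "(\<lambda>z. (S z + 1) / 2) \<in> borel_measurable unit_sq" by measurable
  have e16: "e / 16 > 0" "e / 8 > 0" using e by simp_all
  obtain N1 where N1: "\<And>n. n \<ge> N1 \<Longrightarrow> \<exists>w. (\<forall>i j. 0 \<le> w i j \<and> w i j \<le> 1) \<and>
    (LINT z|unit_sq. \<bar>(S z + 1) / 2 - w (cell n (fst z)) (cell n (snd z))\<bar>) < e / 16"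
    using step_approximation[OF Sm Sh e16(1)] by blast
  obtain N2 where N2: "\<And>n. n \<ge> N2 \<Longrightarrow> \<exists>w. (\<forall>i j. 0 \<le> w i j \<and> w i j \<le> 1) \<and>
    (LINT z|unit_sq. \<bar>W (fst z) (snd z) - w (cell n (fst z)) (cell n (snd z))\<bar>) < e / 8"
    using step_approximation[OF W(2) W01 e16(2)] by blast
  \<comment> \<open>The bound 8/e makes the averaging error 4/n at most e/2. The two approximations
    cost e/4 in the correlation and e/4 in the product of the means.\<close>
  define n where "n = max (max N1 N2) (nat \<lceil>8 / e\<rceil> + 1)"
  have n: "n > 0" "n \<ge> N1" "n \<ge> N2" by (auto simp: n_def)
  have "8 / e \<le> real (nat \<lceil>8 / e\<rceil> + 1)" using e by linarith
  also have "\<dots> \<le> real n" unfolding n_def by (intro of_nat_mono) simp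
  finally have ne: "4 / real n \<le> e / 2" using e n by (simp add: field_simps)
  let ?c = "\<lambda>w z. w (cell n (fst z)) (cell n (snd z)) :: real"
  obtain a0 where a0: "\<And>i j. 0 \<le> a0 i j \<and> a0 i j \<le> 1" and a0_S: "(LINT z|unit_sq. \<bar>(S z + 1) / 2 - ?c a0 z\<bar>) < e / 16"
    using N1[OF n(2)] by blast
  obtain w where w01: "\<And>i j. 0 \<le> w i j \<and> w i j \<le> 1" and w_W: "(LINT z|unit_sq. \<bar>W (fst z) (snd z) - ?c w z\<bar>) < e / 8"
    using N2[OF n(3)] by blast
  define a where "a i j = 2 * a0 i j - 1" for i j
  have a1: "\<bar>a i j\<bar> \<le> 1" for i j using a0[of i j] by (auto simp: a_def)
  have w1: "\<bar>w i j\<bar> \<le> 1" for i j using w01[of i j] by auto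
  note [measurable] = step_measurable[of a n] step_measurable[of w n] step_measurable[of a0 n]
  have "(LINT z|unit_sq. \<bar>S z - ?c a z\<bar>) = (LINT z|unit_sq. 2 * \<bar>(S z + 1) / 2 - ?c a0 z\<bar>)"
  proof -
    have "s - (2 * x - 1) = 2 * ((s + 1) / 2 - x)" for s x :: real by (simp add: field_simps)
    note * = this
    show ?thesis unfolding a_def * abs_mult by simp
  qed
  with a0_S have a_S: "(LINT z|unit_sq. \<bar>S z - ?c a z\<bar>) < e / 8" by simp
  obtain p where p: "p permutes {1..n}" and
    corr: "(\<Sum>i=1..n. \<Sum>j=1..n. a (p i) (p j) * w i j) \<le>
      (\<Sum>i=1..n. \<Sum>j=1..n. a i j) * (\<Sum>i=1..n. \<Sum>j=1..n. w i j) / (real n)\<^sup>2 + 4 * real n"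
    using permuted_correlation_le[where a = a and w = w, OF n(1) a1 w1] by blast
  let ?\<Phi> = "\<lambda>z. (cell_perm n p (fst z), cell_perm n p (snd z))"
  let ?ap = "\<lambda>i j. a (p i) (p j)"
  note [measurable] = step_measurable[of ?ap n] step_measurable[of "\<lambda>i j. ?ap i j * w i j" n]
  have S\<Phi>[measurable]: "(\<lambda>z. S (?\<Phi> z)) \<in> borel_measurable unit_sq" "(\<lambda>z. E (?\<Phi> z)) \<in> borel_measurable unit_sq"
    using measurable_compose[OF sq_cell_perm_measurable[OF n(1) p] S_meas]
      measurable_compose[OF sq_cell_perm_measurable[OF n(1) p] meas(2)] by simp_all
  \<comment> \<open>Off the axes, permuting the cells of a step function permutes the indices of its
    matrix. What remains is invariance of the measure.\<close>
  have aint: "(LINT z|unit_sq. \<bar>S (?\<Phi> z) - ?c ?ap z\<bar>) = (LINT z|unit_sq. \<bar>S z - ?c a z\<bar>)"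
  proof -
    have "(LINT z|unit_sq. \<bar>S (?\<Phi> z) - ?c ?ap z\<bar>) = (LINT z|unit_sq. \<bar>S (?\<Phi> z) - ?c a (?\<Phi> z)\<bar>)"
    proof (rule integral_cong_AE)
      show "AE z in unit_sq. \<bar>S (?\<Phi> z) - ?c ?ap z\<bar> = \<bar>S (?\<Phi> z) - ?c a (?\<Phi> z)\<bar>"
        using AE_sq_fst[OF AE_unit_pos] AE_sq_snd[OF AE_unit_pos]
        by eventually_elim (simp add: cell_perm_bounds(2)[OF n(1) p])
      show "(\<lambda>z. \<bar>S (?\<Phi> z) - ?c a (?\<Phi> z)\<bar>) \<in> borel_measurable unit_sq"
        using measurable_compose[OF sq_cell_perm_measurable[OF n(1) p] step_measurable[of a n]] by simp
    qed measurable
    also have "\<dots> = (LINT z|unit_sq. \<bar>S z - ?c a z\<bar>)"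
      by (rule integral_sq_cell_perm[OF n(1) p, of "\<lambda>z. \<bar>S z - ?c a z\<bar>"]) measurable
    finally show ?thesis .
  qed
  have i1: "integrable unit_sq (\<lambda>z. \<bar>S (?\<Phi> z) - ?c ?ap z\<bar>)" "integrable unit_sq (\<lambda>z. \<bar>W (fst z) (snd z) - ?c w z\<bar>)"
    "integrable unit_sq (\<lambda>z. ?c (\<lambda>i j. ?ap i j * w i j) z)" "integrable unit_sq (\<lambda>z. S (?\<Phi> z) * W (fst z) (snd z))"
    "integrable unit_sq (\<lambda>z. \<bar>S z - ?c a z\<bar>)" "integrable unit_sq (?c a)" "integrable unit_sq (?c w)"
  proof -
    show "integrable unit_sq (\<lambda>z. \<bar>S (?\<Phi> z) - ?c ?ap z\<bar>)"
    proof (rule integrable_sq[of _ 2])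
      show "\<bar>\<bar>S (?\<Phi> z) - ?c ?ap z\<bar>\<bar> \<le> 2" for z
        using S1[of "?\<Phi> z"] a1[of "p (cell n (fst z))" "p (cell n (snd z))"] by linarith
    qed measurable
    show "integrable unit_sq (\<lambda>z. \<bar>W (fst z) (snd z) - ?c w z\<bar>)"
    proof (rule integrable_sq[of _ 2])
      show "\<bar>\<bar>W (fst z) (snd z) - ?c w z\<bar>\<bar> \<le> 2" if "z \<in> square" for z
        using W1[OF that] w1[of "cell n (fst z)" "cell n (snd z)"] by linarith
    qed measurable
    show "integrable unit_sq (\<lambda>z. \<bar>S z - ?c a z\<bar>)"
    proof (rule integrable_sq[of _ 2])
      show "\<bar>\<bar>S z - ?c a z\<bar>\<bar> \<le> 2" for z
        using S1[of z] a1[of "cell n (fst z)" "cell n (snd z)"] by linarith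
    qed measurable
    show "integrable unit_sq (\<lambda>z. ?c (\<lambda>i j. ?ap i j * w i j) z)"
      by (intro integrable_sq[of _ 1] abs_mult_le_left a1 w1) measurable
    show "integrable unit_sq (\<lambda>z. S (?\<Phi> z) * W (fst z) (snd z))"
      by (intro integrable_sq[of _ 1] abs_mult_le_left S1 W1) measurable
    show "integrable unit_sq (?c a)" by (intro integrable_sq[of _ 1] a1) measurable
    show "integrable unit_sq (?c w)" by (intro integrable_sq[of _ 1] w1) measurable
  qed
  have "(LINT z|unit_sq. S (?\<Phi> z) * W (fst z) (snd z)) \<le>
    (LINT z|unit_sq. ?c (\<lambda>i j. ?ap i j * w i j) z + (\<bar>S (?\<Phi> z) - ?c ?ap z\<bar> + \<bar>W (fst z) (snd z) - ?c w z\<bar>))"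
  proof (intro integral_mono Bochner_Integration.integrable_add i1)
    fix z assume "z \<in> space unit_sq"
    then have z: "z \<in> square" by (simp add: space_unit_sq)
    have "S (?\<Phi> z) * W (fst z) (snd z) - ?c (\<lambda>i j. ?ap i j * w i j) z =
      (S (?\<Phi> z) - ?c ?ap z) * W (fst z) (snd z) + (W (fst z) (snd z) - ?c w z) * ?c ?ap z"
      by (simp add: algebra_simps)
    also have "\<dots> \<le> \<bar>S (?\<Phi> z) - ?c ?ap z\<bar> + \<bar>W (fst z) (snd z) - ?c w z\<bar>"
      using abs_mult_le_left[OF order.refl W1[OF z], of "S (?\<Phi> z) - ?c ?ap z"]
        abs_mult_le_left[OF order.refl a1[of "p (cell n (fst z))" "p (cell n (snd z))"], of "W (fst z) (snd z) - ?c w z"]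
      by linarith
    finally show "S (?\<Phi> z) * W (fst z) (snd z) \<le>
      ?c (\<lambda>i j. ?ap i j * w i j) z + (\<bar>S (?\<Phi> z) - ?c ?ap z\<bar> + \<bar>W (fst z) (snd z) - ?c w z\<bar>)" by linarith
  qed
  also have "\<dots> = (LINT z|unit_sq. ?c (\<lambda>i j. ?ap i j * w i j) z) +
    ((LINT z|unit_sq. \<bar>S (?\<Phi> z) - ?c ?ap z\<bar>) + (LINT z|unit_sq. \<bar>W (fst z) (snd z) - ?c w z\<bar>))"
    using i1 by simp
  also have "(LINT z|unit_sq. ?c (\<lambda>i j. ?ap i j * w i j) z) = (\<Sum>i=1..n. \<Sum>j=1..n. ?ap i j * w i j) / (real n)\<^sup>2"
    by (rule integral_step[OF n(1)])
  finally have b1: "(LINT z|unit_sq. S (?\<Phi> z) * W (fst z) (snd z)) \<le>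
    (\<Sum>i=1..n. \<Sum>j=1..n. ?ap i j * w i j) / (real n)\<^sup>2 + e / 4"
    using w_W a_S aint by linarith
  let ?Ia = "LINT z|unit_sq. ?c a z" and ?Iw = "LINT z|unit_sq. ?c w z"
  have "(\<Sum>i=1..n. \<Sum>j=1..n. ?ap i j * w i j) / (real n)\<^sup>2 \<le>
    ((\<Sum>i=1..n. \<Sum>j=1..n. a i j) * (\<Sum>i=1..n. \<Sum>j=1..n. w i j) / (real n)\<^sup>2 + 4 * real n) / (real n)\<^sup>2"
    by (intro divide_right_mono corr) simp
  also have "\<dots> = ?Ia * ?Iw + 4 / real n"
    using n by (simp add: integral_step[OF n(1)] add_divide_distrib power2_eq_square)
  finally have b2: "(\<Sum>i=1..n. \<Sum>j=1..n. ?ap i j * w i j) / (real n)\<^sup>2 \<le> ?Ia * ?Iw + 4 / real n" .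
  have Sa: "\<bar>?Ia - integral\<^sup>L unit_sq S\<bar> \<le> e / 8"
  proof -
    have "\<bar>integral\<^sup>L unit_sq S - ?Ia\<bar> = \<bar>LINT z|unit_sq. S z - ?c a z\<bar>" using iS i1 by simp
    also have "\<dots> \<le> (LINT z|unit_sq. \<bar>S z - ?c a z\<bar>)"
      using integral_norm_bound[of unit_sq "\<lambda>z. S z - ?c a z"] by simp
    finally show ?thesis using a_S by (simp add: abs_minus_commute)
  qed
  have qw: "\<bar>?Iw - q\<bar> \<le> e / 8"
  proof -
    have "\<bar>q - ?Iw\<bar> = \<bar>LINT z|unit_sq. W (fst z) (snd z) - ?c w z\<bar>" unfolding q_def using iW i1 by simp
    also have "\<dots> \<le> (LINT z|unit_sq. \<bar>W (fst z) (snd z) - ?c w z\<bar>)"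
      using integral_norm_bound[of unit_sq "\<lambda>z. W (fst z) (snd z) - ?c w z"] by simp
    finally show ?thesis using w_W by (simp add: abs_minus_commute)
  qed
  have Ia1: "\<bar>?Ia\<bar> \<le> 1" by (rule integral_sq_bound) (auto simp: a1)
  have "?Ia * ?Iw - q * integral\<^sup>L unit_sq S = (?Iw - q) * ?Ia + (?Ia - integral\<^sup>L unit_sq S) * q"
    by (simp add: algebra_simps)
  also have "\<dots> \<le> e / 8 + e / 8"
    using abs_mult_le_left[OF qw Ia1] abs_mult_le_left[OF Sa q] by linarith
  finally have b3: "(LINT z|unit_sq. S (?\<Phi> z) * W (fst z) (snd z)) \<le> q * integral\<^sup>L unit_sq S + e"
    using b1 b2 ne by linarith
  have "flex_cost (\<lambda>x y. U (cell_perm n p x) (cell_perm n p y)) W =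
    (LINT z|unit_sq. S (?\<Phi> z) * W (fst z) (snd z) + E (?\<Phi> z))"
    unfolding flex_cost_def
    by (intro Bochner_Integration.integral_cong refl) (auto simp: S_def Z_def E_def indicator_def)
  also have "\<dots> = (LINT z|unit_sq. S (?\<Phi> z) * W (fst z) (snd z)) + (LINT z|unit_sq. E (?\<Phi> z))"
    using i1(4) by (intro Bochner_Integration.integral_add integrable_sq[of "\<lambda>z. E (?\<Phi> z)" 1] S\<Phi>) (auto simp: E_def indicator_def)
  also have "(LINT z|unit_sq. E (?\<Phi> z)) = integral\<^sup>L unit_sq E"
    by (rule integral_sq_cell_perm[OF n(1) p meas(2)])
  also have "flex_cost U (\<lambda>_ _. q) = (LINT z|unit_sq. S z * q + E z)"
    unfolding flex_cost_def
    by (intro Bochner_Integration.integral_cong refl) (auto simp: S_def Z_def E_def indicator_def)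
  then have "flex_cost U (\<lambda>_ _. q) = q * integral\<^sup>L unit_sq S + integral\<^sup>L unit_sq E"
    using iS iE by (simp add: mult.commute)
  ultimately show ?thesis using b3 n(1) p unfolding q_def by (intro exI[of _ n] exI[of _ p]) simp
qed

text \<open>The member \<open>U\<close> of R is rearranged while \<open>W\<close> stays fixed. The
  rearranged function is isomorphic to \<open>U\<close>, so it is in R again, and its cost against
  \<open>W\<close> is nearly at most that of \<open>U\<close> against the mean of
  \<open>W\<close>.\<close>

lemma d1_fun_set_le_const:
  assumes R: "graphon_property R" "flexible_fun_property R" and W: "W \<in> W0"
  shows "\<exists>q. 0 \<le> q \<and> q \<le> 1 \<and> d1_fun_set W R \<le> d1_fun_set (\<lambda>_ _. q) R"
proof -
  obtain W' where W': "W' \<in> W0" "(\<lambda>z. W' (fst z) (snd z)) \<in> borel_measurable unit_sq"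
    "AE z in unit_sq. W' (fst z) (snd z) = W (fst z) (snd z)"
    by (rule W0_borel_version[OF W])
  define q where "q = (LINT z|unit_sq. W' (fst z) (snd z))"
  have q: "0 \<le> q" "q \<le> 1"
  proof -
    show "0 \<le> q" unfolding q_def
      using W0_bounds[OF W'(1)] by (intro integral_nonneg_AE AE_I2) (simp add: space_unit_sq)
    have "\<bar>q\<bar> \<le> 1" unfolding q_def
      using W0_bounds[OF W'(1)] by (intro integral_sq_bound W'(2)) fastforce
    then show "q \<le> 1" by simp
  qed
  have q0: "(\<lambda>_ _. q) \<in> W0" using q by (intro W0_I) auto
  have "d1_fun_set W R = d1_fun_set W' R"
    unfolding d1_fun_set_def
  proof (intro INF_cong refl arg_cong[where f = ennreal])
    fix U assume "U \<in> R"
    then have "U \<in> W0" using R(1) by (auto simp: graphon_property_def)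
    have "d1_fun W' U = d1_fun W U"
      by (rule d1_fun_cong_AE[OF W'(1) W \<open>U \<in> W0\<close> \<open>U \<in> W0\<close> W'(3) AE_I2[OF refl]])
    then show "d1_fun W U = d1_fun W' U" by simp
  qed
  also have "d1_fun_set W' R \<le> d1_fun_set (\<lambda>_ _. q) R"
    unfolding d1_fun_set_def[of "\<lambda>_ _. q"]
  proof (rule INF_greatest)
    fix U assume U: "U \<in> R"
    then have U0: "U \<in> W0" using R(1) by (auto simp: graphon_property_def)
    obtain U' where U': "U' \<in> R" "(\<lambda>z. U' (fst z) (snd z)) \<in> borel_measurable unit_sq"
      "AE z in unit_sq. U' (fst z) (snd z) = U (fst z) (snd z)"
      by (rule graphon_property_borel_version[OF R(1) U])
    have U'0: "U' \<in> W0" using R(1) U'(1) by (auto simp: graphon_property_def)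
    have "d1_fun_set W' R \<le> ennreal (flex_cost U' (\<lambda>_ _. q)) + ennreal e" if e: "e > 0" for e
    proof -
      obtain n p where n: "n > 0" "p permutes {1..n}" and
        le: "flex_cost (\<lambda>x y. U' (cell_perm n p x) (cell_perm n p y)) W' \<le> flex_cost U' (\<lambda>_ _. q) + e"
        using flex_cost_cell_perm_le[OF U'0 U'(2) W'(1,2) e] unfolding q_def by blast
      define V where "V = (\<lambda>x y. U' (cell_perm n p x) (cell_perm n p y))"
      have Vm: "(\<lambda>z. V (fst z) (snd z)) \<in> borel_measurable unit_sq"
        using measurable_compose[OF sq_cell_perm_measurable[OF n] U'(2)] by (simp add: V_def)
      have "cell_perm n p x \<in> {0..1}" if "x \<in> {0..1}" for x
        using measurable_space[OF cell_perm_measurable[OF n], of x] that by simp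
      then have V0: "V \<in> W0" using U'0 by (intro W0_I[OF Vm]) (simp add: V_def W0_def)
      have "isomorphic_fun V U'"
        using t_fun_cell_perm[OF n _ U'(2)] by (simp add: isomorphic_fun_def V_def)
      then have VR: "V \<in> R" using R(1) U'(1) V0 by (auto simp: graphon_property_def)
      have "d1_fun_set W' R \<le> ennreal (flex_cost V W')"
        by (rule d1_fun_le_flex_cost[OF R VR Vm W'(1,2)])
      also have "\<dots> \<le> ennreal (flex_cost U' (\<lambda>_ _. q) + e)"
        using le by (intro ennreal_leI) (simp add: V_def)
      also have "\<dots> \<le> ennreal (flex_cost U' (\<lambda>_ _. q)) + ennreal e"
      proof -
        have "0 \<le> flex_cost U' (\<lambda>_ _. q)" unfolding flex_cost_def
          using q by (intro integral_nonneg_AE AE_I2) (auto simp: indicator_def)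
        then show ?thesis using e by (simp add: ennreal_plus)
      qed
      finally show ?thesis .
    qed
    then have "d1_fun_set W' R \<le> ennreal (flex_cost U' (\<lambda>_ _. q))"
      by (rule ennreal_le_epsilon)
    also have "\<dots> \<le> ennreal (d1_fun (\<lambda>_ _. q) U')"
      by (intro ennreal_leI flex_cost_const_le_d1 U'0 U'(2) q)
    also have "d1_fun (\<lambda>_ _. q) U' = d1_fun (\<lambda>_ _. q) U"
      by (rule d1_fun_cong_AE[OF q0 q0 U'0 U0 AE_I2[OF refl] U'(3)])
    finally show "d1_fun_set W' R \<le> ennreal (d1_fun (\<lambda>_ _. q) U)" .
  qed
  finally show ?thesis using q by blast
qed

section \<open>Distances of constant functions\<close>

lemma d1_fun_const_lipschitz:
  assumes U: "U \<in> W0" and q: "0 \<le> q" "q \<le> 1" and q': "0 \<le> q'" "q' \<le> 1"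
  shows "d1_fun (\<lambda>_ _. q) U \<le> d1_fun (\<lambda>_ _. q') U + \<bar>q - q'\<bar>"
proof -
  obtain U' where U': "U' \<in> W0" "(\<lambda>z. U' (fst z) (snd z)) \<in> borel_measurable unit_sq"
    "AE z in unit_sq. U' (fst z) (snd z) = U (fst z) (snd z)"
    by (rule W0_borel_version[OF U])
  have d: "d1_fun (\<lambda>_ _. q) U = (LINT z|unit_sq. \<bar>q - U' (fst z) (snd z)\<bar>)" if "0 \<le> q" "q \<le> 1" for q
  proof -
    have q0: "(\<lambda>_ _. q) \<in> W0" using that by (intro W0_I) auto
    have "d1_fun (\<lambda>_ _. q) U' = d1_fun (\<lambda>_ _. q) U"
      by (rule d1_fun_cong_AE[OF q0 q0 U'(1) U AE_I2[OF refl] U'(3)])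
    then have "d1_fun (\<lambda>_ _. q) U = d1_fun (\<lambda>_ _. q) U'" by simp
    then show ?thesis
      unfolding d1_fun_def case_prod_unfold using U'(2) by (simp add: integral_lebesgue_square)
  qed
  have int: "integrable unit_sq (\<lambda>z. \<bar>q - U' (fst z) (snd z)\<bar>)" if "0 \<le> q" "q \<le> 1" for q
  proof (rule integrable_sq[of _ 1])
    show "\<bar>\<bar>q - U' (fst z) (snd z)\<bar>\<bar> \<le> 1" if "z \<in> square" for z
      using W0_bounds[OF U'(1) that] \<open>0 \<le> q\<close> \<open>q \<le> 1\<close> by linarith
  qed (use U'(2) in measurable)
  have "(LINT z|unit_sq. \<bar>q - U' (fst z) (snd z)\<bar>) \<le> (LINT z|unit_sq. \<bar>q' - U' (fst z) (snd z)\<bar> + \<bar>q - q'\<bar>)"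
    using int[OF q] int[OF q'] by (intro integral_mono Bochner_Integration.integrable_add) auto
  also have "\<dots> = (LINT z|unit_sq. \<bar>q' - U' (fst z) (snd z)\<bar>) + \<bar>q - q'\<bar>"
    using int[OF q'] by (simp add: sq.P.prob_space)
  finally show ?thesis by (simp add: d[OF q] d[OF q'])
qed

lemma d1_fun_set_finite:
  assumes "R \<noteq> {}" shows "d1_fun_set W R < top"
proof -
  obtain U where "U \<in> R" using assms by blast
  then have "d1_fun_set W R \<le> ennreal (d1_fun W U)" unfolding d1_fun_set_def by (rule INF_lower)
  then show ?thesis by (simp add: order_le_less_trans)
qed

lemma d1_fun_set_const_lipschitz:
  assumes R: "R \<subseteq> W0" "R \<noteq> {}" and q: "0 \<le> q" "q \<le> 1" and q': "0 \<le> q'" "q' \<le> 1"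
  shows "enn2real (d1_fun_set (\<lambda>_ _. q) R) \<le> enn2real (d1_fun_set (\<lambda>_ _. q') R) + \<bar>q - q'\<bar>"
proof (rule field_le_epsilon)
  fix e :: real assume e: "e > 0"
  let ?D = "\<lambda>q. d1_fun_set (\<lambda>_ _. q) R"
  have fin: "ennreal (enn2real (?D q)) = ?D q" for q using d1_fun_set_finite[OF R(2)] by simp
  have "ennreal (enn2real (?D q')) < ennreal (enn2real (?D q') + e)"
    using e by (intro ennreal_lessI) (simp_all add: add_nonneg_pos)
  then have "?D q' < ennreal (enn2real (?D q') + e)" by (simp only: fin)
  then obtain U where U: "U \<in> R" "ennreal (d1_fun (\<lambda>_ _. q') U) < ennreal (enn2real (?D q') + e)"
    unfolding d1_fun_set_def by (auto simp: INF_less_iff)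
  have "?D q \<le> ennreal (d1_fun (\<lambda>_ _. q) U)" unfolding d1_fun_set_def using U(1) by (rule INF_lower)
  then have "enn2real (?D q) \<le> d1_fun (\<lambda>_ _. q) U"
    by (intro enn2real_leI) (auto simp: d1_fun_def intro!: integral_nonneg_AE)
  also have "\<dots> \<le> d1_fun (\<lambda>_ _. q') U + \<bar>q - q'\<bar>"
    using R(1) U(1) by (intro d1_fun_const_lipschitz q q') auto
  also have "d1_fun (\<lambda>_ _. q') U \<le> enn2real (?D q') + e"
  proof (rule ccontr)
    assume "\<not> ?thesis"
    then have "ennreal (enn2real (?D q') + e) \<le> ennreal (d1_fun (\<lambda>_ _. q') U)" by (intro ennreal_leI) simp
    then show False using U(2) by simp
  qed
  finally show "enn2real (?D q) \<le> enn2real (?D q') + \<bar>q - q'\<bar> + e" by simp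
qed

lemma furthest_constant_exists:
  assumes R: "R \<subseteq> W0"
  shows "\<exists>p::real. 0 \<le> p \<and> p \<le> 1 \<and>
    (\<forall>q. 0 \<le> q \<longrightarrow> q \<le> 1 \<longrightarrow> d1_fun_set (\<lambda>_ _. q) R \<le> d1_fun_set (\<lambda>_ _. p) R)"
proof (cases "R = {}")
  case True
  \<comment> \<open>All distances from the empty set are infinite, so any constant will do.\<close>
  then show ?thesis by (intro exI[of _ 0]) (simp add: d1_fun_set_def)
next
  case False
  let ?g = "\<lambda>q. enn2real (d1_fun_set (\<lambda>_ _. q) R)"
  have "continuous_on {0..1} ?g"
  proof (rule continuous_onI)
    fix x e :: real assume "x \<in> {0..1}" "e > 0"
    have "dist (?g y) (?g x) \<le> e" if "y \<in> {0..1}" "dist y x < e" for y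
    proof -
      have "?g y \<le> ?g x + \<bar>y - x\<bar>" "?g x \<le> ?g y + \<bar>x - y\<bar>"
        using that(1) \<open>x \<in> {0..1}\<close> by (intro d1_fun_set_const_lipschitz[OF R False]; simp)+
      then show ?thesis using that(2) unfolding dist_real_def by linarith
    qed
    then show "\<exists>d>0. \<forall>y\<in>{0..1}. dist y x < d \<longrightarrow> dist (?g y) (?g x) \<le> e"
      using \<open>e > 0\<close> by blast
  qed
  from continuous_attains_sup[OF compact_Icc _ this] obtain p where p: "p \<in> {0..1}"
    "\<forall>q\<in>{0..1}. ?g q \<le> ?g p" by auto
  have "d1_fun_set (\<lambda>_ _. q) R \<le> d1_fun_set (\<lambda>_ _. p) R" if "0 \<le> q" "q \<le> 1" for q
  proof -
    have "ennreal (?g q) \<le> ennreal (?g p)" using p(2) that by (intro ennreal_leI) simp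
    then show ?thesis using d1_fun_set_finite[OF False] by simp
  qed
  then show ?thesis using p(1) by (intro exI[of _ p]) simp
qed

section \<open>Quasirandomness of random graphs\<close>

lemma finite_all_pairs: "finite V \<Longrightarrow> finite (all_pairs V)"
  unfolding all_pairs_def by (rule finite_subset[of _ "Pow V"]) auto

lemma card_all_pairs_le: "card (all_pairs {1..n}) \<le> n\<^sup>2"
proof -
  have "all_pairs {1..n} \<subseteq> (\<lambda>(i, j). {i, j}) ` ({1..n} \<times> {1..n})"
    by (auto simp: all_pairs_def card_2_iff)
  then have "card (all_pairs {1..n}) \<le> card ((\<lambda>(i, j). {i, j}) ` ({1..n} \<times> {1..n}))"
    by (intro card_mono) auto
  also have "\<dots> \<le> card ({1..n} \<times> {1..n})" by (rule card_image_le) simp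
  finally show ?thesis by (simp add: power2_eq_square)
qed

text \<open>Hoeffding's inequality for independent edges. Weights up to 2 are allowed because a cut
  sum over overlapping sets S and T can meet an unordered pair in both orders.\<close>

lemma pair_concentration:
  assumes n: "n \<ge> 2" and p: "0 \<le> p" "p \<le> 1" and c: "\<And>e. 0 \<le> c e \<and> c e \<le> 2" and \<epsilon>: "\<epsilon> \<ge> 0"
  shows "measure_pmf.prob (Pi_pmf (all_pairs {1..n}) False (\<lambda>_. bernoulli_pmf p))
    {f. \<bar>\<Sum>e\<in>all_pairs {1..n}. c e * (of_bool (f e) - p)\<bar> \<ge> \<epsilon>} \<le> 2 * exp (- (\<epsilon>\<^sup>2) / (2 * (real n)\<^sup>2))"
proof -
  let ?A = "all_pairs {1..n}"
  let ?P = "Pi_pmf ?A False (\<lambda>_. bernoulli_pmf p)"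
  have fin: "finite ?A" by (rule finite_all_pairs) simp
  have "{1, 2} \<in> ?A" using n by (auto simp: all_pairs_def)
  then have cA: "card ?A > 0" using fin by (auto simp: card_gt_0_iff)
  have ex: "measure_pmf.expectation ?P (\<lambda>f. c e * of_bool (f e)) = c e * p" if e: "e \<in> ?A" for e
  proof -
    have "measure_pmf.expectation ?P (\<lambda>f. of_bool (f e) :: real) =
      measure_pmf.expectation (map_pmf (\<lambda>f. f e) ?P) of_bool" by simp
    also have "map_pmf (\<lambda>f. f e) ?P = bernoulli_pmf p"
      using fin e by (simp add: Pi_pmf_component)
    also have "measure_pmf.expectation (bernoulli_pmf p) of_bool = p" using p by simp
    finally show ?thesis by simp
  qed
  interpret Hoeffding_ineq "measure_pmf ?P" ?A "\<lambda>e f. c e * of_bool (f e)" "\<lambda>_. 0" "\<lambda>_. 2"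
    "\<Sum>e\<in>?A. measure_pmf.expectation ?P (\<lambda>f. c e * of_bool (f e))"
  proof unfold_locales
    show "prob_space.indep_vars (measure_pmf ?P) (\<lambda>_. borel) (\<lambda>e f. c e * of_bool (f e)) ?A"
      by (rule prob_space.indep_vars_compose2[OF measure_pmf.prob_space_axioms indep_vars_Pi_pmf[OF fin], of "\<lambda>e b. c e * of_bool b"]) simp
    show "AE f in measure_pmf ?P. c e * of_bool (f e) \<in> {0..2}" for e
      using c[of e] by (auto simp: of_bool_def)
  qed (use fin in auto)
  have "(\<Sum>e\<in>?A. measure_pmf.expectation ?P (\<lambda>f. c e * of_bool (f e))) = (\<Sum>e\<in>?A. c e * p)"
    by (intro sum.cong refl ex)
  then have "{f. \<bar>\<Sum>e\<in>?A. c e * (of_bool (f e) - p)\<bar> \<ge> \<epsilon>} =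
    {f \<in> space (measure_pmf ?P). \<bar>(\<Sum>e\<in>?A. c e * of_bool (f e)) -
      (\<Sum>e\<in>?A. measure_pmf.expectation ?P (\<lambda>f. c e * of_bool (f e)))\<bar> \<ge> \<epsilon>}"
    by (simp add: right_diff_distrib sum_subtractf)
  also have "measure_pmf.prob ?P \<dots> \<le> 2 * exp (- 2 * \<epsilon>\<^sup>2 / (\<Sum>e\<in>?A. (2 - 0)\<^sup>2))"
    using cA by (intro Hoeffding_ineq_abs_ge \<epsilon>) simp
  \<comment> \<open>The exponent on the left is -2\<epsilon>^2 / (4|A|), and |A| \<le> n^2.\<close>
  also have "\<dots> \<le> 2 * exp (- (\<epsilon>\<^sup>2) / (2 * (real n)\<^sup>2))"
  proof -
    have "real (card ?A) \<le> (real n)\<^sup>2" using card_all_pairs_le[of n] by (metis of_nat_le_iff of_nat_power)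
    then have "\<epsilon>\<^sup>2 / (2 * (real n)\<^sup>2) \<le> \<epsilon>\<^sup>2 / (2 * real (card ?A))"
      using cA n by (intro divide_left_mono) auto
    then show ?thesis by simp
  qed
  finally show ?thesis .
qed

text \<open>There are 4^n pairs of vertex sets, and each violates its bound with probability at most
  2 exp(-\<eta>^2 n^2 / 8). The square of n in the exponent wins in the union bound.\<close>

lemma cut_le_random_graph:
  assumes p: "0 \<le> p" "p \<le> 1" and \<eta>: "\<eta> > 0"
  shows "(\<lambda>n. measure_pmf.prob (random_graph n p)
    {G. cut_le {1..n} (\<lambda>i j. adj G i j - p) (\<eta> * (real n)\<^sup>2)}) \<longlonglongrightarrow> 1"
proof -
  let ?P = "\<lambda>n. measure_pmf.prob (random_graph n p) {G. cut_le {1..n} (\<lambda>i j. adj G i j - p) (\<eta> * (real n)\<^sup>2)}"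
  have bound: "1 - ?P n \<le> 4 ^ n * (2 * exp (- ((\<eta> / 2 * (real n)\<^sup>2)\<^sup>2) / (2 * (real n)\<^sup>2)))"
    if n: "n \<ge> 2" "real n \<ge> 2 / \<eta>" for n
  proof -
    let ?A = "all_pairs {1..n}" and ?V = "{1..n}"
    let ?Q = "Pi_pmf ?A False (\<lambda>_. bernoulli_pmf p)"
    have fin: "finite ?A" by (rule finite_all_pairs) simp
    \<comment> \<open>The number of ordered pairs in S \<times> T that span e, that is, the weight
      of the random variable of e in the cut sum.\<close>
    define c where "c S T e = (\<Sum>i\<in>S. \<Sum>j\<in>T. of_bool (i \<noteq> j \<and> {i, j} = e) :: real)" for S T :: "nat set" and e
    have c2: "0 \<le> c S T e \<and> c S T e \<le> 2" if "S \<subseteq> ?V" "T \<subseteq> ?V" for S T e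
    proof -
      have finST: "finite S" "finite T" using that finite_subset by blast+
      have "c S T e = (\<Sum>z\<in>S \<times> T. of_bool (fst z \<noteq> snd z \<and> {fst z, snd z} = e))"
        unfolding c_def by (simp add: sum.cartesian_product case_prod_unfold)
      also have "\<dots> = real (card {z \<in> S \<times> T. fst z \<noteq> snd z \<and> {fst z, snd z} = e})"
        using finST by (simp add: Int_def)
      finally have ceq: "c S T e = real (card {z \<in> S \<times> T. fst z \<noteq> snd z \<and> {fst z, snd z} = e})" .
      have "card {z \<in> S \<times> T. fst z \<noteq> snd z \<and> {fst z, snd z} = e} \<le> 2"
      proof (cases "\<exists>a b. e = {a, b}")
        case True
        then obtain a b where e: "e = {a, b}" by blast
        have sub: "{z \<in> S \<times> T. fst z \<noteq> snd z \<and> {fst z, snd z} = e} \<subseteq> set [(a, b), (b, a)]"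
          by (auto simp: e doubleton_eq_iff)
        have "card {z \<in> S \<times> T. fst z \<noteq> snd z \<and> {fst z, snd z} = e} \<le> card (set [(a, b), (b, a)])"
          by (rule card_mono[OF finite_set sub])
        also have "\<dots> \<le> length [(a, b), (b, a)]" by (rule card_length)
        also have "\<dots> = 2" by simp
        finally show ?thesis .
      next
        case False
        then have empty: "{z \<in> S \<times> T. fst z \<noteq> snd z \<and> {fst z, snd z} = e} = {}" by blast
        show ?thesis unfolding empty by simp
      qed
      then show ?thesis unfolding ceq by simp
    qed
    have sum_c: "(\<Sum>e\<in>?A. c S T e * g e) = (\<Sum>i\<in>S. \<Sum>j\<in>T. of_bool (i \<noteq> j) * g {i, j})"
      if ST: "S \<subseteq> ?V" "T \<subseteq> ?V" for S T and g :: "nat set \<Rightarrow> real"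
    proof -
      have "(\<Sum>e\<in>?A. c S T e * g e) = (\<Sum>e\<in>?A. \<Sum>i\<in>S. \<Sum>j\<in>T. of_bool (i \<noteq> j \<and> {i, j} = e) * g e)"
        by (simp only: c_def sum_distrib_right)
      also have "\<dots> = (\<Sum>i\<in>S. \<Sum>e\<in>?A. \<Sum>j\<in>T. of_bool (i \<noteq> j \<and> {i, j} = e) * g e)"
        by (rule sum.swap)
      also have "\<dots> = (\<Sum>i\<in>S. \<Sum>j\<in>T. \<Sum>e\<in>?A. of_bool (i \<noteq> j \<and> {i, j} = e) * g e)"
        by (intro sum.cong refl sum.swap)
      also have "\<dots> = (\<Sum>i\<in>S. \<Sum>j\<in>T. of_bool (i \<noteq> j) * g {i, j})"
      proof (intro sum.cong refl)
        fix i j assume "i \<in> S" "j \<in> T"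
        show "(\<Sum>e\<in>?A. of_bool (i \<noteq> j \<and> {i, j} = e) * g e) = of_bool (i \<noteq> j) * g {i, j}"
        proof (cases "i = j")
          case False
          then have "{i, j} \<in> ?A" using ST \<open>i \<in> S\<close> \<open>j \<in> T\<close> by (auto simp: all_pairs_def)
          have "(\<Sum>e\<in>?A. of_bool (i \<noteq> j \<and> {i, j} = e) * g e) = (\<Sum>e\<in>?A. if e = {i, j} then g e else 0)"
            using False by (intro sum.cong) auto
          also have "\<dots> = g {i, j}" using fin \<open>{i, j} \<in> ?A\<close> by (simp add: sum.delta)
          finally show ?thesis using False by simp
        qed simp
      qed
      finally show ?thesis .
    qed
    define B where "B S T = {f. \<bar>\<Sum>e\<in>?A. c S T e * (of_bool (f e) - p)\<bar> \<ge> \<eta> / 2 * (real n)\<^sup>2}" for S T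
    \<comment> \<open>Half of the tolerance is reserved for the diagonal, whose entries -p
      contribute at most n in modulus; the other half is left for the random part.\<close>
    have \<eta>n: "real n \<le> \<eta> / 2 * (real n)\<^sup>2"
    proof -
      have "1 \<le> \<eta> / 2 * real n" using n \<eta> by (simp add: field_simps)
      then have "1 * real n \<le> \<eta> / 2 * real n * real n" by (rule mult_right_mono) simp
      then show ?thesis by (simp add: power2_eq_square mult.assoc)
    qed
    have good: "cut_le ?V (\<lambda>i j. adj (?V, {e \<in> ?A. f e}) i j - p) (\<eta> * (real n)\<^sup>2)"
      if f: "\<And>S T. S \<subseteq> ?V \<Longrightarrow> T \<subseteq> ?V \<Longrightarrow> f \<notin> B S T" for f
      unfolding cut_le_def
    proof (intro allI impI)
      fix S T assume ST: "S \<subseteq> ?V" "T \<subseteq> ?V"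
      have finST: "finite S" "finite T" using ST finite_subset by blast+
      have entry: "adj (?V, {e \<in> ?A. f e}) i j - p = of_bool (i \<noteq> j) * (of_bool (f {i, j}) - p) - of_bool (i = j) * p"
        if "i \<in> S" "j \<in> T" for i j
        using that ST by (auto simp: adj_def all_pairs_def)
      have "(\<Sum>i\<in>S. \<Sum>j\<in>T. adj (?V, {e \<in> ?A. f e}) i j - p) =
        (\<Sum>i\<in>S. \<Sum>j\<in>T. of_bool (i \<noteq> j) * (of_bool (f {i, j}) - p) - of_bool (i = j) * p)"
        by (intro sum.cong refl entry)
      also have "\<dots> = (\<Sum>e\<in>?A. c S T e * (of_bool (f e) - p)) - (\<Sum>i\<in>S. \<Sum>j\<in>T. of_bool (i = j) * p)"
        unfolding sum_c[OF ST] sum_subtractf ..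
      finally have eq: "(\<Sum>i\<in>S. \<Sum>j\<in>T. adj (?V, {e \<in> ?A. f e}) i j - p) =
        (\<Sum>e\<in>?A. c S T e * (of_bool (f e) - p)) - (\<Sum>i\<in>S. \<Sum>j\<in>T. of_bool (i = j) * p)" .
      have "0 \<le> (\<Sum>i\<in>S. \<Sum>j\<in>T. of_bool (i = j) * p)" using p by (intro sum_nonneg) auto
      moreover have "(\<Sum>i\<in>S. \<Sum>j\<in>T. of_bool (i = j) * p) \<le> (\<Sum>i\<in>S. 1)"
      proof (intro sum_mono)
        fix i assume "i \<in> S"
        have "(\<Sum>j\<in>T. of_bool (i = j) * p) = (\<Sum>j\<in>T. if j = i then p else 0)" by (intro sum.cong) auto
        also have "\<dots> \<le> 1" using finST p by (simp add: sum.delta)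
        finally show "(\<Sum>j\<in>T. of_bool (i = j) * p) \<le> 1" .
      qed
      moreover have "real (card S) \<le> real n" using card_mono[OF _ ST(1)] by simp
      moreover have "\<bar>\<Sum>e\<in>?A. c S T e * (of_bool (f e) - p)\<bar> < \<eta> / 2 * (real n)\<^sup>2"
        using f[OF ST] by (simp add: B_def)
      ultimately show "\<bar>\<Sum>i\<in>S. \<Sum>j\<in>T. adj (?V, {e \<in> ?A. f e}) i j - p\<bar> \<le> \<eta> * (real n)\<^sup>2"
        unfolding eq using \<eta>n by simp
    qed
    have "1 - ?P n = measure_pmf.prob (random_graph n p) (- {G. cut_le ?V (\<lambda>i j. adj G i j - p) (\<eta> * (real n)\<^sup>2)})"
      by (subst measure_pmf.prob_compl[symmetric]) (auto simp: Compl_eq_Diff_UNIV)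
    also have "\<dots> = measure_pmf.prob ?Q ((\<lambda>f. (?V, {e \<in> ?A. f e})) -` (- {G. cut_le ?V (\<lambda>i j. adj G i j - p) (\<eta> * (real n)\<^sup>2)}))"
      by (simp add: random_graph_def)
    also have "\<dots> \<le> measure_pmf.prob ?Q (\<Union>z\<in>Pow ?V \<times> Pow ?V. B (fst z) (snd z))"
    proof (rule measure_pmf.finite_measure_mono)
      show "(\<lambda>f. (?V, {e \<in> ?A. f e})) -` (- {G. cut_le ?V (\<lambda>i j. adj G i j - p) (\<eta> * (real n)\<^sup>2)})
        \<subseteq> (\<Union>z\<in>Pow ?V \<times> Pow ?V. B (fst z) (snd z))"
      proof
        fix f assume f: "f \<in> (\<lambda>f. (?V, {e \<in> ?A. f e})) -` (- {G. cut_le ?V (\<lambda>i j. adj G i j - p) (\<eta> * (real n)\<^sup>2)})"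
        show "f \<in> (\<Union>z\<in>Pow ?V \<times> Pow ?V. B (fst z) (snd z))"
        proof (rule ccontr)
          assume "f \<notin> (\<Union>z\<in>Pow ?V \<times> Pow ?V. B (fst z) (snd z))"
          then have "f \<notin> B S T" if "S \<subseteq> ?V" "T \<subseteq> ?V" for S T using that by force
          from good[OF this] f show False by simp
        qed
      qed
    qed simp
    also have "\<dots> \<le> (\<Sum>z\<in>Pow ?V \<times> Pow ?V. measure_pmf.prob ?Q (B (fst z) (snd z)))"
      by (intro measure_pmf.finite_measure_subadditive_finite) auto
    also have "\<dots> \<le> (\<Sum>z\<in>Pow ?V \<times> Pow ?V. 2 * exp (- ((\<eta> / 2 * (real n)\<^sup>2)\<^sup>2) / (2 * (real n)\<^sup>2)))"
    proof (intro sum_mono)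
      fix z assume "z \<in> Pow ?V \<times> Pow ?V"
      then have z: "fst z \<subseteq> ?V" "snd z \<subseteq> ?V" by auto
      have "0 \<le> \<eta> / 2 * (real n)\<^sup>2" using \<eta> by simp
      from pair_concentration[OF n(1) p c2[OF z] this]
      show "measure_pmf.prob ?Q (B (fst z) (snd z)) \<le> 2 * exp (- ((\<eta> / 2 * (real n)\<^sup>2)\<^sup>2) / (2 * (real n)\<^sup>2))"
        unfolding B_def .
    qed
    also have "\<dots> = 4 ^ n * (2 * exp (- ((\<eta> / 2 * (real n)\<^sup>2)\<^sup>2) / (2 * (real n)\<^sup>2)))"
    proof -
      have "(2::real) ^ n * 2 ^ n = 4 ^ n" by (simp flip: power_mult_distrib)
      then show ?thesis by (simp add: card_cartesian_product card_Pow)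
    qed
    finally show ?thesis .
  qed
  have lim: "(\<lambda>n. 1 - 4 ^ n * (2 * exp (- ((\<eta> / 2 * (real n)\<^sup>2)\<^sup>2) / (2 * (real n)\<^sup>2)))) \<longlonglongrightarrow> 1"
    using \<eta> by real_asymp
  show ?thesis
  proof (rule tendsto_sandwich[OF _ _ lim tendsto_const])
    show "eventually (\<lambda>n. 1 - 4 ^ n * (2 * exp (- ((\<eta> / 2 * (real n)\<^sup>2)\<^sup>2) / (2 * (real n)\<^sup>2))) \<le> ?P n) sequentially"
    proof (rule eventually_sequentiallyI[of "nat \<lceil>2 / \<eta>\<rceil> + 2"])
      fix n assume "nat \<lceil>2 / \<eta>\<rceil> + 2 \<le> n"
      then have "n \<ge> 2" "real n \<ge> 2 / \<eta>" by linarith+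
      from bound[OF this] show "1 - 4 ^ n * (2 * exp (- ((\<eta> / 2 * (real n)\<^sup>2)\<^sup>2) / (2 * (real n)\<^sup>2))) \<le> ?P n" by linarith
    qed
    show "eventually (\<lambda>n. ?P n \<le> 1) sequentially" by simp
  qed
qed

section \<open>Flexible and robust graph properties\<close>

definition relabel :: "(nat \<Rightarrow> nat) \<Rightarrow> graph \<Rightarrow> graph" where
  "relabel \<sigma> G = ({1..card (verts G)}, {e \<in> all_pairs {1..card (verts G)}. \<sigma> ` e \<in> edges G})"

lemma simple_relabel: "simple_graph (relabel \<sigma> G)"
  by (auto simp: relabel_def simple_graph_def)

lemma verts_relabel: "verts (relabel \<sigma> G) = {1..card (verts G)}"
  by (simp add: relabel_def)

lemma image_all_pairs:
  assumes "bij_betw \<sigma> V V'"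
  shows "(\<lambda>e. \<sigma> ` e) ` all_pairs V = all_pairs V'"
proof (intro equalityI subsetI)
  have inj: "inj_on \<sigma> V" and img: "\<sigma> ` V = V'" using assms by (auto simp: bij_betw_def)
  {
    fix e assume "e \<in> (\<lambda>e. \<sigma> ` e) ` all_pairs V"
    then obtain e' where e': "e = \<sigma> ` e'" "e' \<subseteq> V" "card e' = 2" by (auto simp: all_pairs_def)
    then show "e \<in> all_pairs V'"
      using img card_image[OF inj_on_subset[OF inj e'(2)]] by (auto simp: all_pairs_def)
  next
    fix e assume e: "e \<in> all_pairs V'"
    have sub: "inv_into V \<sigma> ` e \<subseteq> V" and eq: "\<sigma> ` (inv_into V \<sigma> ` e) = e"
      using e img by (auto simp: all_pairs_def image_inv_into_cancel intro: inv_into_into)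
    have "card (\<sigma> ` (inv_into V \<sigma> ` e)) = card (inv_into V \<sigma> ` e)"
      by (rule card_image[OF inj_on_subset[OF inj sub]])
    then have "inv_into V \<sigma> ` e \<in> all_pairs V" using sub e unfolding eq by (simp add: all_pairs_def)
    then show "e \<in> (\<lambda>e. \<sigma> ` e) ` all_pairs V" using eq by (metis image_eqI)
  }
qed

text \<open>Robustness speaks of graphs on {1..n}, so an arbitrary graph is pulled back to these
  nodes. A member of P near the pulled back graph is pushed forward again; its copy is in P and
  differs from \<open>G\<close> in as many edges.\<close>

lemma d1_graph_set_le_relabel:
  assumes P: "graph_property P" and G: "simple_graph G" and \<sigma>: "bij_betw \<sigma> {1..card (verts G)} (verts G)"
  shows "d1_graph_set G P \<le> d1_graph_set (relabel \<sigma> G) P"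
  unfolding d1_graph_set_def[of "relabel \<sigma> G"]
proof (rule INF_greatest)
  fix H assume "H \<in> {H \<in> P. verts H = verts (relabel \<sigma> G)}"
  then have HP: "H \<in> P" and Hv: "verts H = {1..card (verts G)}" by (auto simp: verts_relabel)
  have Hs: "simple_graph H" using P HP by (auto simp: graph_property_def)
  let ?I = "{1..card (verts G)}" and ?f = "\<lambda>e. \<sigma> ` e"
  define H' where "H' = (verts G, ?f ` edges H)"
  have inj: "inj_on ?f (all_pairs ?I)"
    using inj_on_image_Pow[OF bij_betw_imp_inj_on[OF \<sigma>]] by (rule inj_on_subset) (auto simp: all_pairs_def)
  have H'_sub: "?f ` edges H \<subseteq> all_pairs (verts G)"
    using Hs image_all_pairs[OF \<sigma>] by (auto simp: simple_graph_def Hv)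
  have "simple_graph H'" using G H'_sub by (simp add: simple_graph_def H'_def)
  moreover have "graph_iso H H'"
    unfolding graph_iso_def using \<sigma> by (intro exI[of _ \<sigma>]) (simp add: H'_def Hv)
  ultimately have H'P: "H' \<in> P" using P HP unfolding graph_property_def by blast
  have "edges G \<subseteq> ?f ` all_pairs ?I"
    unfolding image_all_pairs[OF \<sigma>] using G by (simp add: simple_graph_def)
  then have EG: "edges G = ?f ` edges (relabel \<sigma> G)"
    unfolding relabel_def snd_conv by blast
  have sub: "edges (relabel \<sigma> G) \<subseteq> all_pairs ?I" "edges H \<subseteq> all_pairs ?I"
    using Hs by (auto simp: relabel_def simple_graph_def Hv)
  have diff: "?f ` (A - B) = ?f ` A - ?f ` B" if "A \<subseteq> all_pairs ?I" "B \<subseteq> all_pairs ?I" for A B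
    using inj that by (intro inj_on_image_set_diff[OF inj]) auto
  have H'E: "edges H' = ?f ` edges H" by (simp add: H'_def)
  have "sym_diff (edges G) (edges H') = ?f ` sym_diff (edges (relabel \<sigma> G)) (edges H)"
    unfolding H'E image_Un diff[OF sub] diff[OF sub(2,1)] using EG by (rule arg_cong)
  moreover have "card (?f ` sym_diff (edges (relabel \<sigma> G)) (edges H)) = card (sym_diff (edges (relabel \<sigma> G)) (edges H))"
    using sub by (intro card_image inj_on_subset[OF inj]) auto
  ultimately have "d1_graph G H' = d1_graph (relabel \<sigma> G) H"
    by (simp add: d1_graph_def verts_relabel)
  moreover have "d1_graph_set G P \<le> ennreal (d1_graph G H')"
    unfolding d1_graph_set_def using H'P by (intro INF_lower) (simp add: H'_def)
  ultimately show "d1_graph_set G P \<le> ennreal (d1_graph (relabel \<sigma> G) H)" by simp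
qed

lemma sum_pairs_eq_card:
  assumes E: "E \<subseteq> all_pairs V" and V: "finite V"
  shows "(\<Sum>i\<in>V. \<Sum>j\<in>V. of_bool ({i, j} \<in> E) :: real) = 2 * real (card E)"
proof -
  have finE: "finite E" using E finite_all_pairs[OF V] finite_subset by blast
  have "(\<Sum>i\<in>V. \<Sum>j\<in>V. of_bool ({i, j} \<in> E) :: real) = (\<Sum>z\<in>V \<times> V. of_bool ({fst z, snd z} \<in> E))"
    by (simp add: sum.cartesian_product case_prod_unfold)
  also have "\<dots> = (\<Sum>z\<in>V \<times> V. \<Sum>e\<in>E. of_bool ({fst z, snd z} = e))"
    using finE by (intro sum.cong refl) (simp add: of_bool_def)
  also have "\<dots> = (\<Sum>e\<in>E. \<Sum>z\<in>V \<times> V. of_bool ({fst z, snd z} = e))"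
    by (rule sum.swap)
  also have "\<dots> = (\<Sum>e\<in>E. 2)"
  proof (intro sum.cong refl)
    fix e assume "e \<in> E"
    then have "e \<subseteq> V" "card e = 2" using E by (auto simp: all_pairs_def)
    then obtain a b where ab: "e = {a, b}" "a \<noteq> b" "a \<in> V" "b \<in> V" by (auto simp: card_2_iff)
    have "(\<Sum>z\<in>V \<times> V. of_bool ({fst z, snd z} = e) :: real) = (\<Sum>z\<in>{(a, b), (b, a)}. 1)"
      using V ab by (intro sum.mono_neutral_cong_right) (auto simp: doubleton_eq_iff)
    then show "(\<Sum>z\<in>V \<times> V. of_bool ({fst z, snd z} = e) :: real) = 2" using ab by simp
  qed
  finally show ?thesis by simp
qed

text \<open>Sums over ordered pairs meet each edge twice; this is where the halves in the bounds for
  graphs come from.\<close>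

lemma sum_adj_diff:
  assumes "simple_graph G" "simple_graph H" "verts G = V" "verts H = V"
  shows "(\<Sum>i\<in>V. \<Sum>j\<in>V. \<bar>adj G i j - adj H i j\<bar>) = 2 * real (card (sym_diff (edges G) (edges H)))"
proof -
  have "(\<Sum>i\<in>V. \<Sum>j\<in>V. \<bar>adj G i j - adj H i j\<bar>) =
    (\<Sum>i\<in>V. \<Sum>j\<in>V. of_bool ({i, j} \<in> sym_diff (edges G) (edges H)))"
    by (intro sum.cong refl) (auto simp: adj_def)
  also have "\<dots> = 2 * real (card (sym_diff (edges G) (edges H)))"
    using assms by (intro sum_pairs_eq_card) (auto simp: simple_graph_def)
  finally show ?thesis .
qed

lemma card_sym_diff_triangle:
  assumes "finite A" "finite B" "finite C"
  shows "card (sym_diff A C) \<le> card (sym_diff A B) + card (sym_diff B C)"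
proof -
  have "card (sym_diff A C) \<le> card (sym_diff A B \<union> sym_diff B C)"
    using assms by (intro card_mono) auto
  also have "\<dots> \<le> card (sym_diff A B) + card (sym_diff B C)" by (rule card_Un_le)
  finally show ?thesis .
qed

text \<open>Beyond \<open>W0\<close>, membership in the closure depends on a function only through
  its densities.\<close>

lemma graph_closure_graphon_property: "graphon_property (graph_closure P)"
  unfolding graphon_property_def graph_closure_def isomorphic_fun_def by auto

lemma graph_closure_sub: "graph_closure P \<subseteq> W0"
  by (auto simp: graph_closure_def)

section \<open>The function of a graph\<close>

lemma W_graph_step:
  assumes G: "simple_graph G" "verts G = {1..n}" and n: "n > 0" and xy: "x \<in> {0..1}" "y \<in> {0..1}"
  shows "W_graph G x y = of_bool (0 < x) * of_bool (0 < y) * adj G (cell n x) (cell n y)"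
proof -
  have W: "W_graph G x y = of_bool (\<exists>i j. {i, j} \<in> edges G \<and>
      x \<in> {(real i - 1) / real n <.. real i / real n} \<and> y \<in> {(real j - 1) / real n <.. real j / real n})"
    unfolding W_graph_def Let_def of_bool_def using G(2) by simp
  have range: "i \<in> {1..n} \<and> j \<in> {1..n}" if "{i, j} \<in> edges G" for i j
    using that G by (auto simp: simple_graph_def all_pairs_def)
  show ?thesis
  proof (cases "0 < x \<and> 0 < y")
    case True
    then have x: "x \<in> {0<..1}" and y: "y \<in> {0<..1}" using xy by auto
    have "(\<exists>i j. {i, j} \<in> edges G \<and>
      x \<in> {(real i - 1) / real n <.. real i / real n} \<and> y \<in> {(real j - 1) / real n <.. real j / real n}) \<longleftrightarrow>
      (\<exists>i j. {i, j} \<in> edges G \<and> cell n x = i \<and> cell n y = j)"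
      using cell_eq_iff[OF _ x] cell_eq_iff[OF _ y] range by blast
    then show ?thesis unfolding W using True by (simp add: adj_def)
  next
    case False
    \<comment> \<open>The half-open intervals of \<open>W_graph\<close> miss 0, whereas clamping
      counts 0 into the first cell.\<close>
    have pos: "0 < z" if "z \<in> {(real i - 1) / real n <.. real i / real n}" "i \<in> {1..n}" for z and i :: nat
    proof -
      have "0 \<le> (real i - 1) / real n" using that(2) by simp
      then show ?thesis using that(1) by simp
    qed
    have "\<not> (\<exists>i j. {i, j} \<in> edges G \<and>
      x \<in> {(real i - 1) / real n <.. real i / real n} \<and> y \<in> {(real j - 1) / real n <.. real j / real n})"
      using pos range False by blast
    then show ?thesis unfolding W using False by auto
  qed
qed

lemma W_graph_borel:
  assumes G: "simple_graph G" "verts G = {1..n}" and n: "n > 0"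
  shows "(\<lambda>z. W_graph G (fst z) (snd z)) \<in> borel_measurable unit_sq" "W_graph G \<in> W0"
proof -
  have [measurable]: "(\<lambda>z. adj G (cell n (fst z)) (cell n (snd z))) \<in> borel_measurable unit_sq"
    by (rule step_measurable)
  have f: "(\<lambda>z. fst z) \<in> borel_measurable unit_sq" and s: "(\<lambda>z. snd z) \<in> borel_measurable unit_sq"
    by (rule borel_measurable_unit_sq, simp add: borel_prod[symmetric])+
  note [measurable] = f s
  have "(\<lambda>z. of_bool (0 < fst z) * of_bool (0 < snd z) * adj G (cell n (fst z)) (cell n (snd z))) \<in> borel_measurable unit_sq"
    by measurable
  then show m: "(\<lambda>z. W_graph G (fst z) (snd z)) \<in> borel_measurable unit_sq"
    by (rule measurable_cong[THEN iffD1, rotated])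
       (auto simp: space_unit_sq W_graph_step[OF G n])
  show "W_graph G \<in> W0"
  proof (rule W0_I[OF m])
    fix x y :: real assume "x \<in> {0..1}" "y \<in> {0..1}"
    then show "W_graph G x y = W_graph G y x \<and> 0 \<le> W_graph G x y \<and> W_graph G x y \<le> 1"
      using adj_sym[of G "cell n x" "cell n y"] by (simp add: W_graph_step[OF G n] adj_def)
  qed
qed

section \<open>Upper bound: overwriting a graph by patterns\<close>

definition edge_density :: "graph \<Rightarrow> real" where
  "edge_density G = (\<Sum>u\<in>verts G. \<Sum>v\<in>verts G. adj G u v) / (real (card (verts G)))\<^sup>2"

lemma edge_density_bounds: "0 \<le> edge_density G" "edge_density G \<le> 1"
proof -
  show "0 \<le> edge_density G"
    unfolding edge_density_def by (intro divide_nonneg_nonneg sum_nonneg) (auto simp: adj_def)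
  have "(\<Sum>u\<in>verts G. \<Sum>v\<in>verts G. adj G u v) \<le> (\<Sum>u\<in>verts G. \<Sum>v\<in>verts G. 1)"
    by (intro sum_mono) (simp add: adj_def)
  then show "edge_density G \<le> 1"
    by (auto simp: edge_density_def divide_le_eq_1 power2_eq_square)
qed

text \<open>The graph obeys the patterns, with \<open>a1\<close> taking precedence over
  \<open>a0\<close>. So a point has a cost only if a pattern differs there from its level set of
  \<open>U\<close>, or if the point lies in a diagonal cell, where no edge is possible. The diagonal
  cells have total measure 1/n.\<close>

lemma flex_cost_pattern_le:
  assumes U: "(\<lambda>z. U (fst z) (snd z)) \<in> borel_measurable unit_sq"
    and G: "simple_graph G" "verts G = {1..n}" and n: "n > 0"
    and e0: "(LINT z|unit_sq. \<bar>indicator {z. U (fst z) (snd z) = 0} z - of_bool (a0 (cell n (fst z)) (cell n (snd z)))\<bar> :: real) \<le> \<eta>"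
    and e1: "(LINT z|unit_sq. \<bar>indicator {z. U (fst z) (snd z) = 1} z - of_bool (a1 (cell n (fst z)) (cell n (snd z)))\<bar> :: real) \<le> \<eta>"
    and edge: "\<And>i j. i \<in> {1..n} \<Longrightarrow> j \<in> {1..n} \<Longrightarrow> i \<noteq> j \<Longrightarrow> a1 i j \<Longrightarrow> {i, j} \<in> edges G"
    and non_edge: "\<And>i j. i \<in> {1..n} \<Longrightarrow> j \<in> {1..n} \<Longrightarrow> a0 i j \<Longrightarrow> {i, j} \<in> edges G \<Longrightarrow> a1 i j"
  shows "flex_cost U (W_graph G) \<le> 4 * \<eta> + 1 / real n"
proof -
  define Z :: "real \<times> real \<Rightarrow> real" where "Z = indicator {z. U (fst z) (snd z) = 0}"
  define E :: "real \<times> real \<Rightarrow> real" where "E = indicator {z. U (fst z) (snd z) = 1}"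
  define b0 where "b0 z = (of_bool (a0 (cell n (fst z)) (cell n (snd z))) :: real)" for z :: "real \<times> real"
  define b1 where "b1 z = (of_bool (a1 (cell n (fst z)) (cell n (snd z))) :: real)" for z :: "real \<times> real"
  define D where "D z = (of_bool (cell n (fst z) = cell n (snd z)) :: real)" for z :: "real \<times> real"
  have Zm: "Z \<in> borel_measurable unit_sq" and Em: "E \<in> borel_measurable unit_sq"
    unfolding Z_def E_def by (rule level_indicator_measurable[OF U])+
  have b0m: "b0 \<in> borel_measurable unit_sq" unfolding b0_def by (rule step_measurable[of "\<lambda>i j. of_bool (a0 i j)"])
  have b1m: "b1 \<in> borel_measurable unit_sq" unfolding b1_def by (rule step_measurable[of "\<lambda>i j. of_bool (a1 i j)"])
  have Dm: "D \<in> borel_measurable unit_sq" unfolding D_def by (rule step_measurable[of "\<lambda>i j. of_bool (i = j)"])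
  note [measurable] = Zm Em b0m b1m Dm W_graph_borel(1)[OF G n]
  have Z01: "Z z = 0 \<or> Z z = 1" and E01: "E z = 0 \<or> E z = 1" and ZE: "Z z * E z = 0" for z
    by (auto simp: Z_def E_def indicator_def)
  have b01: "b0 z = 0 \<or> b0 z = 1" "b1 z = 0 \<or> b1 z = 1" "D z = 0 \<or> D z = 1" for z
    by (auto simp: b0_def b1_def D_def)
  have i0: "integrable unit_sq (\<lambda>z. \<bar>Z z - b0 z\<bar>)"
  proof (rule integrable_sq[of _ 1])
    show "\<bar>\<bar>Z z - b0 z\<bar>\<bar> \<le> 1" for z using Z01[of z] b01[of z] by auto
  qed measurable
  have i1: "integrable unit_sq (\<lambda>z. \<bar>E z - b1 z\<bar>)"
  proof (rule integrable_sq[of _ 1])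
    show "\<bar>\<bar>E z - b1 z\<bar>\<bar> \<le> 1" for z using E01[of z] b01[of z] by auto
  qed measurable
  have iD: "integrable unit_sq D"
  proof (rule integrable_sq[of _ 1])
    show "\<bar>D z\<bar> \<le> 1" for z using b01[of z] by auto
  qed measurable
  have W01: "0 \<le> W_graph G (fst z) (snd z) \<and> W_graph G (fst z) (snd z) \<le> 1" if "z \<in> square" for z
    by (rule W0_bounds[OF W_graph_borel(2)[OF G n] that])
  have "flex_cost U (W_graph G) = (LINT z|unit_sq. Z z * W_graph G (fst z) (snd z) + E z * (1 - W_graph G (fst z) (snd z)))"
    unfolding flex_cost_def Z_def E_def ..
  also have "\<dots> \<le> (LINT z|unit_sq. 2 * \<bar>Z z - b0 z\<bar> + (2 * \<bar>E z - b1 z\<bar> + D z))"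
  proof (rule integral_mono_AE)
    show "integrable unit_sq (\<lambda>z. Z z * W_graph G (fst z) (snd z) + E z * (1 - W_graph G (fst z) (snd z)))"
    proof (rule integrable_sq[of _ 1])
      show "\<bar>Z z * W_graph G (fst z) (snd z) + E z * (1 - W_graph G (fst z) (snd z))\<bar> \<le> 1" if "z \<in> square" for z
        using W01[OF that] Z01[of z] E01[of z] ZE[of z] by auto
    qed measurable
    show "integrable unit_sq (\<lambda>z. 2 * \<bar>Z z - b0 z\<bar> + (2 * \<bar>E z - b1 z\<bar> + D z))"
      using i0 i1 iD by (intro Bochner_Integration.integrable_add integrable_mult_right)
    show "AE z in unit_sq. Z z * W_graph G (fst z) (snd z) + E z * (1 - W_graph G (fst z) (snd z))
      \<le> 2 * \<bar>Z z - b0 z\<bar> + (2 * \<bar>E z - b1 z\<bar> + D z)"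
      using AE_sq_fst[OF AE_unit_pos] AE_sq_snd[OF AE_unit_pos]
    proof eventually_elim
      case (elim z)
      let ?i = "cell n (fst z)" and ?j = "cell n (snd z)"
      define g where "g = adj G ?i ?j"
      have W: "W_graph G (fst z) (snd z) = g"
        using elim by (simp add: W_graph_step[OF G n] g_def)
      have ij: "?i \<in> {1..n}" "?j \<in> {1..n}" using cell_range[OF n] by auto
      have g01: "g = 0 \<or> g = 1" by (auto simp: g_def adj_def)
      have h1: "g = 1 \<or> b1 z = 0 \<or> D z = 1"
        using edge[OF ij] by (auto simp: g_def adj_def b1_def D_def)
      have h0: "b0 z = 0 \<or> g = 0 \<or> b1 z = 1"
        using non_edge[OF ij] by (auto simp: g_def adj_def b1_def b0_def)
      show ?case
        using Z01[of z] E01[of z] ZE[of z] b01[of z] g01 h0 h1 unfolding W by (elim disjE) simp_all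
    qed
  qed
  also have "\<dots> = 2 * (LINT z|unit_sq. \<bar>Z z - b0 z\<bar>) + (2 * (LINT z|unit_sq. \<bar>E z - b1 z\<bar>) + integral\<^sup>L unit_sq D)"
    using i0 i1 iD by simp
  also have "integral\<^sup>L unit_sq D = 1 / real n"
  proof -
    have "integral\<^sup>L unit_sq D = (\<Sum>i=1..n. \<Sum>j=1..n. of_bool (i = j)) / (real n)\<^sup>2"
      unfolding D_def by (rule integral_step[OF n])
    also have "(\<Sum>i=1..n. \<Sum>j=1..n. of_bool (i = j) :: real) = (\<Sum>i=1..n. 1)"
    proof (intro sum.cong refl)
      fix i assume "i \<in> {1..n}"
      have "(\<Sum>j=1..n. of_bool (i = j) :: real) = (\<Sum>j\<in>{1..n}. if j = i then 1 else 0)" by (intro sum.cong) auto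
      also have "\<dots> = 1" using \<open>i \<in> {1..n}\<close> by (simp add: sum.delta)
      finally show "(\<Sum>j=1..n. of_bool (i = j) :: real) = 1" .
    qed
    finally show ?thesis using n by (simp add: power2_eq_square)
  qed
  finally show ?thesis using e0 e1 unfolding Z_def E_def b0_def b1_def by linarith
qed

lemma flex_cost_const_density:
  assumes U: "(\<lambda>z. U (fst z) (snd z)) \<in> borel_measurable unit_sq"
  obtains x y where "0 \<le> x" "x \<le> 1" "0 \<le> y" "y \<le> 1"
    "x = (LINT z|unit_sq. indicator {z. U (fst z) (snd z) = 0} z)"
    "y = (LINT z|unit_sq. indicator {z. U (fst z) (snd z) = 1} z)"
    "\<And>p. flex_cost U (\<lambda>_ _. p) = p * x + (1 - p) * y"
proof -
  have b: "0 \<le> (LINT z|unit_sq. indicator {z. U (fst z) (snd z) = c} z :: real) \<and>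
    (LINT z|unit_sq. indicator {z. U (fst z) (snd z) = c} z :: real) \<le> 1" for c
  proof
    show "0 \<le> (LINT z|unit_sq. indicator {z. U (fst z) (snd z) = c} z :: real)"
      by (intro integral_nonneg_AE) auto
    have "\<bar>LINT z|unit_sq. indicator {z. U (fst z) (snd z) = c} z :: real\<bar> \<le> 1"
      by (rule integral_sq_bound[OF level_indicator_measurable[OF U]]) (simp add: indicator_def)
    then show "(LINT z|unit_sq. indicator {z. U (fst z) (snd z) = c} z :: real) \<le> 1" by linarith
  qed
  show ?thesis
    using b[of 0] b[of 1] flex_cost_const[OF U] by (intro that[OF _ _ _ _ refl refl]) auto
qed

lemma d1_graph_le_half:
  assumes G: "simple_graph G" "verts G = {1..n}" and H: "simple_graph H" "verts H = {1..n}" and n: "n > 0"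
    and c: "(\<Sum>i=1..n. \<Sum>j=1..n. \<bar>adj G i j - adj H i j\<bar>) / (real n)\<^sup>2 \<le> c"
  shows "d1_graph G H \<le> c / 2"
  using c unfolding sum_adj_diff[OF G(1) H(1) G(2) H(2)] by (simp add: d1_graph_def G(2) mult.commute)

text \<open>The arrangement of G in the cells is free and is found by averaging, which leaves the
  edge density as the only trace of G in the bound.\<close>

lemma robust_flexible_upper:
  assumes P: "graph_property P" and flex: "flexible_graph_property P" and rob: "robust P"
    and U: "U \<in> graph_closure P" "(\<lambda>z. U (fst z) (snd z)) \<in> borel_measurable unit_sq" and \<epsilon>: "\<epsilon> > 0"
  shows "\<exists>N. \<forall>n\<ge>N. \<forall>G. simple_graph G \<longrightarrow> card (verts G) = n \<longrightarrow>
    d1_graph_set G P \<le> ennreal (flex_cost U (\<lambda>_ _. edge_density G) / 2 + \<epsilon>)"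
proof -
  let ?R = "graph_closure P"
  have R: "graphon_property ?R" "flexible_fun_property ?R"
    using graph_closure_graphon_property flex by (auto simp: flexible_graph_property_def)
  have "\<epsilon> / 4 > 0" using \<epsilon> by simp
  from rob[unfolded robust_def, THEN spec, THEN mp, OF this] obtain N0 \<epsilon>' where \<epsilon>': "\<epsilon>' > 0" and
    rob': "\<forall>n\<ge>N0. \<forall>G. simple_graph G \<and> verts G = {1..n} \<and> d1_fun_set (W_graph G) ?R \<le> ennreal \<epsilon>' \<longrightarrow>
      d1_graph_set G P \<le> ennreal (\<epsilon> / 4)" by blast
  have N0: "\<And>n G. n \<ge> N0 \<Longrightarrow> simple_graph G \<Longrightarrow> verts G = {1..n} \<Longrightarrow>
      d1_fun_set (W_graph G) ?R \<le> ennreal \<epsilon>' \<Longrightarrow> d1_graph_set G P \<le> ennreal (\<epsilon> / 4)"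
    using rob' by blast
  \<comment> \<open>Half of \<epsilon>' is for 4\<eta> and half for 1/n. Of \<epsilon>, one half
    covers \<eta> and 4/n in the passage from \<open>G1\<close> to \<open>G'\<close>, the other half
    the step from \<open>G'\<close> into P.\<close>
  define \<eta> where "\<eta> = min (\<epsilon>' / 8) (\<epsilon> / 8)"
  have \<eta>: "\<eta> > 0" using \<epsilon> \<epsilon>' by (simp add: \<eta>_def)
  have U0: "U \<in> W0" using U(1) graph_closure_sub by blast
  define lev where "lev c = {z \<in> space unit_sq. U (fst z) (snd z) = c}" for c
  have lev_sets: "lev c \<in> sets unit_sq" for c unfolding lev_def using U(2) by measurable
  have lev_sym: "(x, y) \<in> lev c \<Longrightarrow> (y, x) \<in> lev c" for x y c
    using U0 by (auto simp: lev_def space_unit_sq W0_def)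
  have lev_ind: "(LINT z|unit_sq. \<bar>indicator (lev c) z - f z\<bar>) =
      (LINT z|unit_sq. \<bar>indicator {z. U (fst z) (snd z) = c} z - f z\<bar>)" for c and f :: "real \<times> real \<Rightarrow> real"
    by (intro Bochner_Integration.integral_cong refl) (simp add: lev_def indicator_def)
  obtain N1 where N1: "\<And>n. n \<ge> N1 \<Longrightarrow> \<exists>a :: nat \<Rightarrow> nat \<Rightarrow> bool. (\<forall>i j. a i j = a j i) \<and>
    (LINT z|unit_sq. \<bar>indicator (lev 0) z - of_bool (a (cell n (fst z)) (cell n (snd z)))\<bar> :: real) < \<eta>"
    using symmetric_pattern_approximation[OF lev_sets lev_sym \<eta>] by blast
  obtain N2 where N2: "\<And>n. n \<ge> N2 \<Longrightarrow> \<exists>a :: nat \<Rightarrow> nat \<Rightarrow> bool. (\<forall>i j. a i j = a j i) \<and>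
    (LINT z|unit_sq. \<bar>indicator (lev 1) z - of_bool (a (cell n (fst z)) (cell n (snd z)))\<bar> :: real) < \<eta>"
    using symmetric_pattern_approximation[OF lev_sets lev_sym \<eta>] by blast
  obtain N3 where N3: "\<And>n. n \<ge> N3 \<Longrightarrow> 1 / real n < min (\<epsilon>' / 2) (\<epsilon> / 16)"
  proof -
    have "(\<lambda>n. 1 / real n) \<longlonglongrightarrow> 0" by (rule lim_1_over_n)
    from order_tendstoD(2)[OF this, of "min (\<epsilon>' / 2) (\<epsilon> / 16)"] \<epsilon> \<epsilon>' that show ?thesis
      by (auto simp: eventually_sequentially)
  qed
  define N where "N = Max {N0, N1, N2, N3, 1}"
  have N_ge: "N \<ge> N0" "N \<ge> N1" "N \<ge> N2" "N \<ge> N3" "N \<ge> 1" by (auto simp: N_def)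
  show ?thesis
  proof (intro exI[of _ N] allI impI)
    fix n and G :: graph
    assume nN: "n \<ge> N" and G: "simple_graph G" and card: "card (verts G) = n"
    have n: "n > 0" "n \<ge> N0" "n \<ge> N1" "n \<ge> N2" "n \<ge> N3" using nN N_ge by auto
    have n_small: "1 / real n < \<epsilon>' / 2" "1 / real n < \<epsilon> / 16" using N3[OF n(5)] by auto
    obtain a0 :: "nat \<Rightarrow> nat \<Rightarrow> bool" where a0: "\<And>i j. a0 i j = a0 j i" and
      e0: "(LINT z|unit_sq. \<bar>indicator {z. U (fst z) (snd z) = 0} z - of_bool (a0 (cell n (fst z)) (cell n (snd z)))\<bar> :: real) < \<eta>"
      using N1[OF n(3)] unfolding lev_ind by blast
    obtain a1 :: "nat \<Rightarrow> nat \<Rightarrow> bool" where a1: "\<And>i j. a1 i j = a1 j i" and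
      e1: "(LINT z|unit_sq. \<bar>indicator {z. U (fst z) (snd z) = 1} z - of_bool (a1 (cell n (fst z)) (cell n (snd z)))\<bar> :: real) < \<eta>"
      using N2[OF n(4)] unfolding lev_ind by blast
    have finV: "finite (verts G)" using G by (simp add: simple_graph_def)
    obtain \<sigma>0 where \<sigma>0: "bij_betw \<sigma>0 {1..n} (verts G)"
      using sorted_enumeration[OF finV, of "\<lambda>_. 0"] unfolding card by blast
    define a where "a i j = (of_bool (a0 i j) - of_bool (a1 i j) :: real)" for i j
    define g where "g i j = adj G (\<sigma>0 i) (\<sigma>0 j)" for i j
    have a_b: "\<bar>a i j\<bar> \<le> 1" and g_b: "\<bar>g i j\<bar> \<le> 1" for i j by (auto simp: a_def g_def adj_def)
    obtain p where p: "p permutes {1..n}" and corr: "(\<Sum>i=1..n. \<Sum>j=1..n. a (p i) (p j) * g i j) \<le>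
        (\<Sum>i=1..n. \<Sum>j=1..n. a i j) * (\<Sum>i=1..n. \<Sum>j=1..n. g i j) / (real n)\<^sup>2 + 4 * real n"
      using permuted_correlation_le[where a = a and w = g, OF n(1) a_b g_b] by blast
    \<comment> \<open>Permuting the patterns by p amounts to relabelling the graph by the inverse.
      It is the graph that moves, since the patterns must stay in place relative to
      \<open>U\<close>.\<close>
    define \<sigma> where "\<sigma> = \<sigma>0 \<circ> inv p"
    have \<sigma>: "bij_betw \<sigma> {1..n} (verts G)"
      unfolding \<sigma>_def by (rule bij_betw_trans[OF permutes_imp_bij[OF permutes_inv[OF p]] \<sigma>0])
    define G1 where "G1 = relabel \<sigma> G"
    have G1: "simple_graph G1" "verts G1 = {1..n}" unfolding G1_def using simple_relabel verts_relabel card by auto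
    have adj_G1: "adj G1 i j = adj G (\<sigma> i) (\<sigma> j)" if "i \<in> {1..n}" "j \<in> {1..n}" for i j
    proof (cases "i = j")
      case True
      then show ?thesis using G by (auto simp: adj_def G1_def relabel_def all_pairs_def simple_graph_def)
    next
      case False
      then show ?thesis using that by (simp add: adj_def G1_def relabel_def all_pairs_def card)
    qed
    \<comment> \<open>Where both patterns apply, \<open>a1\<close> wins and the pair becomes an
      edge; elsewhere \<open>a0\<close> deletes edges.\<close>
    define G' where "G' = ({1..n}, {e \<in> all_pairs {1..n}. \<exists>i j. e = {i, j} \<and> (a1 i j \<or> (e \<in> edges G1 \<and> \<not> a0 i j))})"
    have G': "simple_graph G'" "verts G' = {1..n}" by (auto simp: G'_def simple_graph_def)
    have edge_G': "{i, j} \<in> edges G' \<longleftrightarrow> i \<noteq> j \<and> (a1 i j \<or> ({i, j} \<in> edges G1 \<and> \<not> a0 i j))"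
      if "i \<in> {1..n}" "j \<in> {1..n}" for i j
    proof -
      have "(\<exists>i' j'. {i, j} = {i', j'} \<and> (a1 i' j' \<or> ({i, j} \<in> edges G1 \<and> \<not> a0 i' j'))) \<longleftrightarrow>
        (a1 i j \<or> ({i, j} \<in> edges G1 \<and> \<not> a0 i j))"
        using a0 a1 by (auto simp: doubleton_eq_iff)
      moreover have "{i, j} \<in> all_pairs {1..n} \<longleftrightarrow> i \<noteq> j" using that by (auto simp: all_pairs_def card_insert_if)
      ultimately show ?thesis by (simp add: G'_def)
    qed
    have "flex_cost U (W_graph G') \<le> 4 * \<eta> + 1 / real n"
    proof (rule flex_cost_pattern_le[OF U(2) G' n(1) less_imp_le[OF e0] less_imp_le[OF e1]])
      show "{i, j} \<in> edges G'" if "i \<in> {1..n}" "j \<in> {1..n}" "i \<noteq> j" "a1 i j" for i j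
        using edge_G' that by blast
      show "a1 i j" if "i \<in> {1..n}" "j \<in> {1..n}" "a0 i j" "{i, j} \<in> edges G'" for i j
        using edge_G' that by blast
    qed
    also have "\<dots> \<le> \<epsilon>'" using n_small(1) by (simp add: \<eta>_def)
    finally have "d1_fun_set (W_graph G') ?R \<le> ennreal \<epsilon>'"
      using d1_fun_le_flex_cost[OF R U W_graph_borel(2,1)[OF G' n(1)]] by (meson ennreal_leI order_trans)
    from N0[OF n(2) G' this] have "d1_graph_set G' P \<le> ennreal (\<epsilon> / 4)" .
    also have "\<dots> < ennreal (\<epsilon> / 2)" using \<epsilon> by (intro ennreal_lessI) auto
    finally obtain H where H: "H \<in> P" "verts H = {1..n}" and G'H': "ennreal (d1_graph G' H) < ennreal (\<epsilon> / 2)"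
      unfolding d1_graph_set_def by (auto simp: INF_less_iff G'(2))
    have G'H: "d1_graph G' H \<le> \<epsilon> / 2"
      using G'H' \<epsilon> by (metis ennreal_leI linorder_not_le nle_le)
    have Hs: "simple_graph H" using P H(1) by (auto simp: graph_property_def)
    define A where "A = (\<Sum>i=1..n. \<Sum>j=1..n. a i j) / (real n)\<^sup>2"
    define q where "q = edge_density G"
    have q: "0 \<le> q" "q \<le> 1" unfolding q_def by (rule edge_density_bounds)+
    \<comment> \<open>\<open>edge_density\<close> divides by n^2, diagonal included, so it is the
      mean of the full matrix \<open>g\<close>, as the averaging lemma needs.\<close>
    have q_g: "q = (\<Sum>i=1..n. \<Sum>j=1..n. g i j) / (real n)\<^sup>2"
      unfolding q_def edge_density_def card g_def
      using sum.reindex_bij_betw[OF \<sigma>0, of "\<lambda>u. \<Sum>v\<in>verts G. adj G u v"]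
        sum.reindex_bij_betw[OF \<sigma>0, of "\<lambda>v. adj G u v" for u] by simp
    \<comment> \<open>Edges under \<open>a0\<close> and non-edges under \<open>a1\<close> are paid
      for. The bound is affine in the adjacency, so averaging applies to it.\<close>
    have "(\<Sum>i=1..n. \<Sum>j=1..n. \<bar>adj G1 i j - adj G' i j\<bar>) \<le>
      (\<Sum>i=1..n. \<Sum>j=1..n. a i j * adj G1 i j + of_bool (a1 i j))"
    proof (intro sum_mono)
      fix i j assume ij: "i \<in> {1..n}" "j \<in> {1..n}"
      have "{i, j} \<notin> edges G1" if "i = j" using G1 that by (auto simp: simple_graph_def all_pairs_def)
      then show "\<bar>adj G1 i j - adj G' i j\<bar> \<le> a i j * adj G1 i j + of_bool (a1 i j)"
        unfolding adj_def edge_G'[OF ij] a_def by (auto simp: of_bool_def)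
    qed
    also have "\<dots> = (\<Sum>i=1..n. \<Sum>j=1..n. a i j * adj G1 i j) + (\<Sum>i=1..n. \<Sum>j=1..n. of_bool (a1 i j))"
      by (simp only: sum.distrib)
    also have "(\<Sum>i=1..n. \<Sum>j=1..n. a i j * adj G1 i j) = (\<Sum>i=1..n. \<Sum>j=1..n. a (p i) (p j) * g i j)"
    proof -
      have bp: "bij_betw p {1..n} {1..n}" using p by (rule permutes_imp_bij)
      have "(\<Sum>i=1..n. \<Sum>j=1..n. a i j * adj G1 i j) = (\<Sum>i=1..n. \<Sum>j=1..n. a i j * adj G (\<sigma> i) (\<sigma> j))"
        by (intro sum.cong refl) (simp add: adj_G1)
      also have "\<dots> = (\<Sum>i=1..n. \<Sum>j=1..n. a (p i) j * adj G (\<sigma> (p i)) (\<sigma> j))"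
        by (rule sum.reindex_bij_betw[OF bp, symmetric])
      also have "\<dots> = (\<Sum>i=1..n. \<Sum>j=1..n. a (p i) (p j) * adj G (\<sigma> (p i)) (\<sigma> (p j)))"
        by (intro sum.cong refl sum.reindex_bij_betw[OF bp, symmetric])
      also have "\<dots> = (\<Sum>i=1..n. \<Sum>j=1..n. a (p i) (p j) * g i j)"
        by (simp add: \<sigma>_def g_def permutes_inverses[OF p])
      finally show ?thesis .
    qed
    finally have s: "(\<Sum>i=1..n. \<Sum>j=1..n. \<bar>adj G1 i j - adj G' i j\<bar>) \<le>
      (\<Sum>i=1..n. \<Sum>j=1..n. a i j) * (\<Sum>i=1..n. \<Sum>j=1..n. g i j) / (real n)\<^sup>2 + 4 * real n +
      (\<Sum>i=1..n. \<Sum>j=1..n. of_bool (a1 i j))" using corr by linarith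
    define A1 where "A1 = (\<Sum>i=1..n. \<Sum>j=1..n. of_bool (a1 i j) :: real) / (real n)\<^sup>2"
    have dist1: "(\<Sum>i=1..n. \<Sum>j=1..n. \<bar>adj G1 i j - adj G' i j\<bar>) / (real n)\<^sup>2 \<le> A * q + 4 / real n + A1"
    proof -
      have "(\<Sum>i=1..n. \<Sum>j=1..n. \<bar>adj G1 i j - adj G' i j\<bar>) / (real n)\<^sup>2 \<le>
        ((\<Sum>i=1..n. \<Sum>j=1..n. a i j) * (\<Sum>i=1..n. \<Sum>j=1..n. g i j) / (real n)\<^sup>2 + 4 * real n +
      (\<Sum>i=1..n. \<Sum>j=1..n. of_bool (a1 i j))) / (real n)\<^sup>2"
        by (intro divide_right_mono s) simp
      also have "\<dots> = A * q + 4 / real n + A1"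
        using n(1) by (simp add: A_def A1_def q_g add_divide_distrib power2_eq_square)
      finally show ?thesis .
    qed
    obtain x y where xy: "0 \<le> x" "x \<le> 1" "0 \<le> y" "y \<le> 1" and
      x: "x = (LINT z|unit_sq. indicator {z. U (fst z) (snd z) = 0} z)" and
      y: "y = (LINT z|unit_sq. indicator {z. U (fst z) (snd z) = 1} z)" and
      fc: "\<And>p. flex_cost U (\<lambda>_ _. p) = p * x + (1 - p) * y"
      by (rule flex_cost_const_density[OF U(2)]) (rule that)
    have pat: "\<bar>(LINT z|unit_sq. indicator {z. U (fst z) (snd z) = c} z) -
      (\<Sum>i=1..n. \<Sum>j=1..n. of_bool (b i j)) / (real n)\<^sup>2\<bar> \<le> \<eta>"
      if b: "(LINT z|unit_sq. \<bar>indicator {z. U (fst z) (snd z) = c} z - of_bool (b (cell n (fst z)) (cell n (snd z)))\<bar> :: real) < \<eta>"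
      for c b
    proof -
      have m: "(\<lambda>z. of_bool (b (cell n (fst z)) (cell n (snd z))) :: real) \<in> borel_measurable unit_sq"
        by (rule step_measurable[of "\<lambda>i j. of_bool (b i j)"])
      have "(\<Sum>i=1..n. \<Sum>j=1..n. of_bool (b i j)) / (real n)\<^sup>2 =
        (LINT z|unit_sq. of_bool (b (cell n (fst z)) (cell n (snd z))))"
        by (rule integral_step[OF n(1), symmetric])
      moreover have "integrable unit_sq (\<lambda>z. indicator {z. U (fst z) (snd z) = c} z :: real)"
        by (rule integrable_sq[OF level_indicator_measurable[OF U(2)], of _ 1]) (simp add: indicator_def)
      moreover have "integrable unit_sq (\<lambda>z. of_bool (b (cell n (fst z)) (cell n (snd z))) :: real)"
        by (rule integrable_sq[OF m, of 1]) simp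
      ultimately have "(LINT z|unit_sq. indicator {z. U (fst z) (snd z) = c} z) - (\<Sum>i=1..n. \<Sum>j=1..n. of_bool (b i j)) / (real n)\<^sup>2 =
        (LINT z|unit_sq. indicator {z. U (fst z) (snd z) = c} z - of_bool (b (cell n (fst z)) (cell n (snd z))))" by simp
      also have "\<bar>\<dots>\<bar> \<le> (LINT z|unit_sq. \<bar>indicator {z. U (fst z) (snd z) = c} z - of_bool (b (cell n (fst z)) (cell n (snd z)))\<bar>)"
        using integral_norm_bound[of unit_sq "\<lambda>z. indicator {z. U (fst z) (snd z) = c} z - of_bool (b (cell n (fst z)) (cell n (snd z)))"]
        by simp
      finally show ?thesis using b by linarith
    qed
    define A0 where "A0 = (\<Sum>i=1..n. \<Sum>j=1..n. of_bool (a0 i j) :: real) / (real n)\<^sup>2"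
    have A_split: "A = A0 - A1"
      by (simp add: A_def A0_def A1_def a_def sum_subtractf diff_divide_distrib)
    have xA: "\<bar>x - A0\<bar> \<le> \<eta>" unfolding x A0_def by (rule pat[OF e0])
    have yA: "\<bar>y - A1\<bar> \<le> \<eta>" unfolding y A1_def by (rule pat[OF e1])
    \<comment> \<open>Edges, of density q, are removed on {U = 0}; non-edges, of density 1 - q, are
      added on {U = 1}. The pattern densities are within \<eta> of the measures of these
      sets.\<close>
    have "A * q + A1 = q * A0 + (1 - q) * A1" by (simp add: A_split algebra_simps)
    also have "\<dots> \<le> q * (x + \<eta>) + (1 - q) * (y + \<eta>)"
      using xA yA q by (intro add_mono mult_left_mono) auto
    also have "\<dots> = flex_cost U (\<lambda>_ _. q) + \<eta>" by (simp add: fc algebra_simps)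
    finally have "A * q + 4 / real n + A1 \<le> flex_cost U (\<lambda>_ _. q) + \<eta> + 4 / real n" by simp
    with dist1 have "(\<Sum>i=1..n. \<Sum>j=1..n. \<bar>adj G1 i j - adj G' i j\<bar>) / (real n)\<^sup>2 \<le> flex_cost U (\<lambda>_ _. q) + \<eta> + 4 / real n"
      by linarith
    from d1_graph_le_half[OF G1 G' n(1) this]
    have d: "d1_graph G1 G' \<le> flex_cost U (\<lambda>_ _. q) / 2 + \<epsilon> / 2"
      using n_small(2) \<epsilon> by (simp add: \<eta>_def)
    have fin: "finite (edges G1)" "finite (edges G')" "finite (edges H)"
      using G1 G' Hs H(2) finite_all_pairs[of "{1..n}"] by (auto simp: simple_graph_def intro: finite_subset)
    have "d1_graph G1 H \<le> d1_graph G1 G' + d1_graph G' H"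
      using card_sym_diff_triangle[OF fin] unfolding d1_graph_def G1(2) G'(2)
      by (simp add: add_divide_distrib[symmetric] divide_right_mono flip: of_nat_add)
    then have dH: "d1_graph G1 H \<le> flex_cost U (\<lambda>_ _. q) / 2 + \<epsilon>" using d G'H by linarith
    have "d1_graph_set G P \<le> d1_graph_set G1 P"
      unfolding G1_def using \<sigma> by (intro d1_graph_set_le_relabel[OF P G]) (simp add: card)
    also have "\<dots> \<le> ennreal (d1_graph G1 H)"
      unfolding d1_graph_set_def using H G1 by (intro INF_lower) simp
    also have "\<dots> \<le> ennreal (flex_cost U (\<lambda>_ _. q) / 2 + \<epsilon>)" by (rule ennreal_leI[OF dH])
    finally show "d1_graph_set G P \<le> ennreal (flex_cost U (\<lambda>_ _. edge_density G) / 2 + \<epsilon>)"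
      by (simp add: q_def)
  qed
qed

section \<open>Lower bound: limits of graphs in the property\<close>

lemma graph_closure_limitI:
  assumes P: "\<And>k. H k \<in> P" and simple: "\<And>k. simple_graph (H k)" and card: "\<And>k. card (verts (H k)) > k"
  obtains r \<sigma> U where "strict_mono (r :: nat \<Rightarrow> nat)"
    "\<And>k. bij_betw (\<sigma> k) {1..card (verts (H k))} (verts (H k))"
    "U \<in> graph_closure P" "(\<lambda>z. U (fst z) (snd z)) \<in> borel_measurable unit_sq"
    "\<And>A. A \<in> sets unit_sq \<Longrightarrow>
      (\<lambda>k. LINT z|unit_sq. indicator A z * graph_step (H (r k)) (\<sigma> (r k)) (fst z) (snd z)) \<longlonglongrightarrow>
      (LINT z|unit_sq. indicator A z * U (fst z) (snd z))"
proof -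
  have pos: "0 < card (verts (H k))" for k using card[of k] by simp
  obtain r \<sigma> U where r: "strict_mono (r :: nat \<Rightarrow> nat)"
    and \<sigma>: "\<And>k. bij_betw (\<sigma> k) {1..card (verts (H k))} (verts (H k))"
    and U: "(\<lambda>z. U (fst z) (snd z)) \<in> borel_measurable unit_sq"
      "\<And>x y. 0 \<le> U x y \<and> U x y \<le> 1" "\<And>x y. U x y = U y x"
    and t: "\<And>F. simple_graph F \<Longrightarrow> (\<lambda>k. t_graph F (H (r k))) \<longlonglongrightarrow> t_fun F U"
    and lim: "\<And>A. A \<in> sets unit_sq \<Longrightarrow>
      (\<lambda>k. LINT z|unit_sq. indicator A z * graph_step (H (r k)) (\<sigma> (r k)) (fst z) (snd z)) \<longlonglongrightarrow>
      (LINT z|unit_sq. indicator A z * U (fst z) (snd z))"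
    by (rule graph_compactness[OF simple pos]) (rule that)
  have U0: "U \<in> W0" by (rule W0_I[OF U(1)]) (use U(2,3) in blast)
  have big: "filterlim (\<lambda>k. card (verts (H (r k)))) at_top sequentially"
    unfolding filterlim_at_top
  proof
    fix Z
    show "eventually (\<lambda>k. Z \<le> card (verts (H (r k)))) sequentially"
    proof (rule eventually_sequentiallyI[of Z])
      fix k assume "Z \<le> k"
      then show "Z \<le> card (verts (H (r k)))" using card[of "r k"] seq_suble[OF r, of k] by linarith
    qed
  qed
  have "U \<in> graph_closure P"
    unfolding graph_closure_def using U0 P big t by (auto intro!: exI[of _ "\<lambda>k. H (r k)"])
  then show ?thesis using that[OF r \<sigma> _ U(1) lim] by blast
qed

text \<open>A cut norm condition takes the place of randomness, so that a failure yields a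
  deterministic sequence with tolerances 1/(k+1), to which compactness applies. The condition is
  invariant under relabelling; hence G can be listed in whatever order is chosen for H.\<close>

lemma quasirandom_lower:
  assumes P: "graph_property P" and flex: "flexible_graph_property P" and p: "0 \<le> p" "p \<le> 1"
    and D: "ennreal D \<le> d1_fun_set (\<lambda>_ _. p) (graph_closure P)" and \<epsilon>: "\<epsilon> > 0"
  shows "\<exists>\<eta>>0. \<exists>N. \<forall>n\<ge>N. \<forall>G H. simple_graph G \<longrightarrow> verts G = {1..n} \<longrightarrow>
    cut_le {1..n} (\<lambda>i j. adj G i j - p) (\<eta> * (real n)\<^sup>2) \<longrightarrow> H \<in> P \<longrightarrow> verts H = {1..n} \<longrightarrow>
    D / 2 - \<epsilon> \<le> d1_graph G H"
proof (rule ccontr)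
  let ?R = "graph_closure P"
  have R: "graphon_property ?R" "flexible_fun_property ?R"
    using graph_closure_graphon_property flex by (auto simp: flexible_graph_property_def)
  assume neg: "\<not> ?thesis"
  have "\<forall>k. \<exists>t. fst t > k \<and> simple_graph (fst (snd t)) \<and> verts (fst (snd t)) = {1..fst t} \<and>
    cut_le {1..fst t} (\<lambda>i j. adj (fst (snd t)) i j - p) (1 / real (Suc k) * (real (fst t))\<^sup>2) \<and>
    snd (snd t) \<in> P \<and> verts (snd (snd t)) = {1..fst t} \<and> d1_graph (fst (snd t)) (snd (snd t)) < D / 2 - \<epsilon>"
  proof
    fix k
    have "(1 / real (Suc k)) > 0" by simp
    with neg have "\<not> (\<forall>n\<ge>Suc k. \<forall>G H. simple_graph G \<longrightarrow> verts G = {1..n} \<longrightarrow>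
      cut_le {1..n} (\<lambda>i j. adj G i j - p) (1 / real (Suc k) * (real n)\<^sup>2) \<longrightarrow> H \<in> P \<longrightarrow> verts H = {1..n} \<longrightarrow>
      D / 2 - \<epsilon> \<le> d1_graph G H)" by blast
    then obtain n G H where "n \<ge> Suc k" "simple_graph G" "verts G = {1..n}"
      "cut_le {1..n} (\<lambda>i j. adj G i j - p) (1 / real (Suc k) * (real n)\<^sup>2)" "H \<in> P" "verts H = {1..n}"
      "\<not> D / 2 - \<epsilon> \<le> d1_graph G H" by blast
    then show "\<exists>t. fst t > k \<and> simple_graph (fst (snd t)) \<and> verts (fst (snd t)) = {1..fst t} \<and>
      cut_le {1..fst t} (\<lambda>i j. adj (fst (snd t)) i j - p) (1 / real (Suc k) * (real (fst t))\<^sup>2) \<and>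
      snd (snd t) \<in> P \<and> verts (snd (snd t)) = {1..fst t} \<and> d1_graph (fst (snd t)) (snd (snd t)) < D / 2 - \<epsilon>"
      by (intro exI[of _ "(n, G, H)"]) (simp add: not_le Suc_le_eq)
  qed
  from choice[OF this] obtain t where t: "\<forall>k. fst (t k) > k \<and> simple_graph (fst (snd (t k))) \<and> verts (fst (snd (t k))) = {1..fst (t k)} \<and>
    cut_le {1..fst (t k)} (\<lambda>i j. adj (fst (snd (t k))) i j - p) (1 / real (Suc k) * (real (fst (t k)))\<^sup>2) \<and>
    snd (snd (t k)) \<in> P \<and> verts (snd (snd (t k))) = {1..fst (t k)} \<and> d1_graph (fst (snd (t k))) (snd (snd (t k))) < D / 2 - \<epsilon>"
    by (elim exE)
  define n where "n k = fst (t k)" for k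
  define G where "G k = fst (snd (t k))" for k
  define H where "H k = snd (snd (t k))" for k
  have n: "n k > k" and G: "simple_graph (G k)" "verts (G k) = {1..n k}"
    and qr: "cut_le {1..n k} (\<lambda>i j. adj (G k) i j - p) (1 / real (Suc k) * (real (n k))\<^sup>2)"
    and H: "H k \<in> P" "verts (H k) = {1..n k}" and close: "d1_graph (G k) (H k) < D / 2 - \<epsilon>" for k
    using t unfolding n_def G_def H_def by blast+
  have n0: "n k > 0" for k using n[of k] by simp
  have Hs: "simple_graph (H k)" for k using P H by (auto simp: graph_property_def)
  have cH: "card (verts (H k)) > k" for k using n[of k] by (simp add: H(2))
  obtain r \<sigma> U where r: "strict_mono (r :: nat \<Rightarrow> nat)"
    and \<sigma>': "\<And>k. bij_betw (\<sigma> k) {1..card (verts (H k))} (verts (H k))"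
    and U: "U \<in> ?R" "(\<lambda>z. U (fst z) (snd z)) \<in> borel_measurable unit_sq"
    and lim: "\<And>A. A \<in> sets unit_sq \<Longrightarrow>
      (\<lambda>k. LINT z|unit_sq. indicator A z * graph_step (H (r k)) (\<sigma> (r k)) (fst z) (snd z)) \<longlonglongrightarrow>
      (LINT z|unit_sq. indicator A z * U (fst z) (snd z))"
    by (rule graph_closure_limitI[OF H(1) Hs cH]) (rule that)
  have \<sigma>: "bij_betw (\<sigma> k) {1..n k} {1..n k}" for k using \<sigma>'[of k] by (simp add: H(2))
  have p0: "(\<lambda>_ _. p) \<in> W0" using p by (intro W0_I) auto
  obtain x y where xy: "x = (LINT z|unit_sq. indicator {z. U (fst z) (snd z) = 0} z)"
    "y = (LINT z|unit_sq. indicator {z. U (fst z) (snd z) = 1} z)" "0 \<le> x" "0 \<le> y"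
    and fc: "\<And>p. flex_cost U (\<lambda>_ _. p) = p * x + (1 - p) * y"
    by (rule flex_cost_const_density[OF U(2)]) (rule that)
  have "d1_fun_set (\<lambda>_ _. p) ?R \<le> ennreal (flex_cost U (\<lambda>_ _. p))"
    by (rule d1_fun_le_flex_cost[OF R U p0]) simp
  with D have "ennreal D \<le> ennreal (p * x + (1 - p) * y)" unfolding fc by (rule order_trans)
  then have Dxy: "D \<le> p * x + (1 - p) * y"
    using xy(3,4) p by (subst (asm) ennreal_le_iff) auto
  define Q where "Q k z = graph_step (G k) (\<sigma> k) (fst z) (snd z)" for k and z :: "real \<times> real"
  define W where "W k z = graph_step (H k) (\<sigma> k) (fst z) (snd z)" for k and z :: "real \<times> real"
  have Qm[measurable]: "Q k \<in> borel_measurable unit_sq" for k unfolding Q_def by (rule graph_step_measurable)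
  have Wm[measurable]: "W k \<in> borel_measurable unit_sq" for k unfolding W_def by (rule graph_step_measurable)
  have Q01: "0 \<le> Q k z \<and> Q k z \<le> 1" and W01: "0 \<le> W k z \<and> W k z \<le> 1" for k z
    unfolding Q_def W_def by (rule graph_step_01)+
  have Q_eq: "Q k z = adj (G k) (\<sigma> k (cell (n k) (fst z))) (\<sigma> k (cell (n k) (snd z)))" for k z
    by (simp add: Q_def graph_step_def G(2))
  have W_eq: "W k z = adj (H k) (\<sigma> k (cell (n k) (fst z))) (\<sigma> k (cell (n k) (snd z)))" for k z
    by (simp add: W_def graph_step_def H(2))
  have Q_cut: "cut_norm_le (\<lambda>z. Q k z - p) (1 / real (Suc k))" for k
  proof -
    from cut_norm_le_step[OF n0 cut_le_reindex[OF \<sigma> qr]]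
    have "cut_norm_le (\<lambda>z. Q k z - p) (1 / real (Suc k) * (real (n k))\<^sup>2 / (real (n k))\<^sup>2)"
      unfolding Q_eq .
    then show ?thesis using n0[of k] by simp
  qed
  \<comment> \<open>The cut norm controls rectangles only; the extension to all Borel sets is needed
    for the level sets of \<open>U\<close>.\<close>
  have Q_lim: "(\<lambda>k. LINT z|unit_sq. indicator A z * (Q (r k) z - p)) \<longlonglongrightarrow> 0" if A: "A \<in> sets unit_sq" for A
  proof (rule weakly_null_sets[OF _ _ _ A])
    show "(\<lambda>z. Q (r k) z - p) \<in> borel_measurable unit_sq" for k by measurable
    show "\<bar>Q (r k) z - p\<bar> \<le> 1" for k z using Q01[of "r k" z] p by linarith
    fix S T assume ST: "S \<in> sets unit_lborel" "T \<in> sets unit_lborel"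
    show "(\<lambda>k. LINT z|unit_sq. indicator (S \<times> T) z * (Q (r k) z - p)) \<longlonglongrightarrow> 0"
    proof (rule tendsto_rabs_zero_cancel, rule tendsto_sandwich[OF _ _ tendsto_const])
      show "(\<lambda>k. 1 / real (Suc (r k))) \<longlonglongrightarrow> 0"
        using LIMSEQ_subseq_LIMSEQ[OF LIMSEQ_Suc[OF lim_1_over_n] r] by (simp add: o_def)
      show "eventually (\<lambda>k. \<bar>LINT z|unit_sq. indicator (S \<times> T) z * (Q (r k) z - p)\<bar> \<le> 1 / real (Suc (r k))) sequentially"
        using cut_norm_le_rectangle[OF Q_cut ST] by (intro always_eventually allI)
    qed simp
  qed
  define lev where "lev c = {z \<in> space unit_sq. U (fst z) (snd z) = c}" for c
  have lev_sets[measurable]: "lev c \<in> sets unit_sq" for c unfolding lev_def using U(2) by measurable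
  have lev_measure: "(LINT z|unit_sq. indicator (lev c) z * f z) = (LINT z|unit_sq. indicator {z. U (fst z) (snd z) = c} z * f z)"
    for c and f :: "real \<times> real \<Rightarrow> real"
    by (intro Bochner_Integration.integral_cong refl) (simp add: lev_def indicator_def)
  have U_lev: "(LINT z|unit_sq. indicator (lev c) z * U (fst z) (snd z)) = c * (LINT z|unit_sq. indicator {z. U (fst z) (snd z) = c} z)" for c
  proof -
    have "(LINT z|unit_sq. indicator (lev c) z * U (fst z) (snd z)) = (LINT z|unit_sq. c * indicator {z. U (fst z) (snd z) = c} z)"
      by (intro Bochner_Integration.integral_cong refl) (auto simp: lev_def indicator_def)
    then show ?thesis by simp
  qed
  have i_lev: "integrable unit_sq (\<lambda>z. indicator (lev c) z * Q k z)" "integrable unit_sq (\<lambda>z. indicator (lev c) z * W k z)"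
    "integrable unit_sq (\<lambda>z. indicator (lev c) z :: real)" for c k
  proof -
    have b: "\<bar>indicator (lev c) z * Q k z\<bar> \<le> 1" "\<bar>indicator (lev c) z * W k z\<bar> \<le> 1" for z
      using Q01[of k z] W01[of k z] by (auto simp: indicator_def)
    show "integrable unit_sq (\<lambda>z. indicator (lev c) z * Q k z)" by (rule integrable_sq[of _ 1]) (measurable, rule b)
    show "integrable unit_sq (\<lambda>z. indicator (lev c) z * W k z)" by (rule integrable_sq[of _ 1]) (measurable, rule b)
    show "integrable unit_sq (\<lambda>z. indicator (lev c) z :: real)"
      by (rule integrable_sq[of _ 1]) (use lev_sets[of c] in simp, simp add: indicator_def)
  qed
  have Q_lev: "(\<lambda>k. LINT z|unit_sq. indicator (lev c) z * Q (r k) z) \<longlonglongrightarrow>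
    p * (LINT z|unit_sq. indicator {z. U (fst z) (snd z) = c} z)" for c
  proof -
    have "(LINT z|unit_sq. indicator (lev c) z * Q k z) =
      (LINT z|unit_sq. indicator (lev c) z * (Q k z - p)) + p * (LINT z|unit_sq. indicator (lev c) z)" for k
    proof -
      have "(LINT z|unit_sq. indicator (lev c) z * (Q k z - p)) =
        (LINT z|unit_sq. indicator (lev c) z * Q k z) - (LINT z|unit_sq. indicator (lev c) z * p)"
        using i_lev by (simp only: right_diff_distrib Bochner_Integration.integral_diff integrable_mult_left)
      then show ?thesis by simp
    qed
    moreover have "(\<lambda>k. (LINT z|unit_sq. indicator (lev c) z * (Q (r k) z - p)) + p * (LINT z|unit_sq. indicator (lev c) z))
      \<longlonglongrightarrow> 0 + p * (LINT z|unit_sq. indicator (lev c) z)"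
      by (intro tendsto_add tendsto_const Q_lim lev_sets)
    ultimately show ?thesis using lev_measure[of c "\<lambda>_. 1"] by simp
  qed
  have W_lev: "(\<lambda>k. LINT z|unit_sq. indicator (lev c) z * W (r k) z) \<longlonglongrightarrow>
    c * (LINT z|unit_sq. indicator {z. U (fst z) (snd z) = c} z)" for c
    using lim[OF lev_sets[of c]] unfolding U_lev W_def .
  \<comment> \<open>The surplus of G over H on {U = 0} plus that of H over G on {U = 1}. It is at
    most the L1 distance, which is twice the distance of the graphs, and it tends to p x + (1 - p)
    y, the cost of \<open>U\<close> at p.\<close>
  define L where "L k = ((LINT z|unit_sq. indicator (lev 0) z * Q k z) - (LINT z|unit_sq. indicator (lev 0) z * W k z)) +
    ((LINT z|unit_sq. indicator (lev 1) z * W k z) - (LINT z|unit_sq. indicator (lev 1) z * Q k z))" for k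
  have "(\<lambda>k. L (r k)) \<longlonglongrightarrow> (p * x - 0 * x) + (1 * y - p * y)"
    unfolding L_def xy(1,2) by (intro tendsto_add tendsto_diff Q_lev W_lev)
  moreover have "L k \<le> D - 2 * \<epsilon>" for k
  proof -
    have i: "integrable unit_sq (\<lambda>z. \<bar>Q k z - W k z\<bar>)"
    proof (rule integrable_sq[of _ 1])
      show "\<bar>\<bar>Q k z - W k z\<bar>\<bar> \<le> 1" for z using Q01[of k z] W01[of k z] by linarith
    qed measurable
    have "L k = (LINT z|unit_sq. (indicator (lev 0) z * Q k z - indicator (lev 0) z * W k z) +
      (indicator (lev 1) z * W k z - indicator (lev 1) z * Q k z))"
      using i_lev unfolding L_def by simp
    also have "\<dots> \<le> (LINT z|unit_sq. \<bar>Q k z - W k z\<bar>)"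
    proof (intro integral_mono i Bochner_Integration.integrable_add Bochner_Integration.integrable_diff i_lev)
      show "(indicator (lev 0) z * Q k z - indicator (lev 0) z * W k z) +
        (indicator (lev 1) z * W k z - indicator (lev 1) z * Q k z) \<le> \<bar>Q k z - W k z\<bar>" for z
        by (auto simp: indicator_def lev_def)
    qed
    also have "\<dots> = (\<Sum>i=1..n k. \<Sum>j=1..n k. \<bar>adj (G k) (\<sigma> k i) (\<sigma> k j) - adj (H k) (\<sigma> k i) (\<sigma> k j)\<bar>) / (real (n k))\<^sup>2"
      unfolding Q_eq W_eq
      by (rule integral_step[OF n0, where w = "\<lambda>i j. \<bar>adj (G k) (\<sigma> k i) (\<sigma> k j) - adj (H k) (\<sigma> k i) (\<sigma> k j)\<bar>"])
    also have "(\<Sum>i=1..n k. \<Sum>j=1..n k. \<bar>adj (G k) (\<sigma> k i) (\<sigma> k j) - adj (H k) (\<sigma> k i) (\<sigma> k j)\<bar>) =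
      (\<Sum>i=1..n k. \<Sum>j=1..n k. \<bar>adj (G k) i j - adj (H k) i j\<bar>)"
      by (subst sum.reindex_bij_betw[OF \<sigma>[of k], of "\<lambda>i. \<Sum>j=1..n k. \<bar>adj (G k) i (\<sigma> k j) - adj (H k) i (\<sigma> k j)\<bar>"])
         (intro sum.cong refl sum.reindex_bij_betw[OF \<sigma>])
    also have "\<dots> / (real (n k))\<^sup>2 = 2 * d1_graph (G k) (H k)"
      unfolding sum_adj_diff[OF G(1) Hs G(2) H(2)] by (simp add: d1_graph_def G(2))
    finally show ?thesis using close[of k] by linarith
  qed
  ultimately have "(p * x - 0 * x) + (1 * y - p * y) \<le> D - 2 * \<epsilon>"
    by (intro LIMSEQ_le_const2) auto
  then show False using Dxy \<epsilon> by (simp add: algebra_simps)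
qed

section \<open>Comparison with the expected distance\<close>

lemma random_graph_support:
  assumes "G \<in> set_pmf (random_graph n p)"
  shows "simple_graph G" "verts G = {1..n}"
  using assms by (auto simp: random_graph_def simple_graph_def)

lemma expected_distance_infinite:
  assumes "\<not> (\<exists>H\<in>P. verts H = {1..n})"
  shows "(\<integral>\<^sup>+ H. d1_graph_set H P \<partial>measure_pmf (random_graph n p)) = top"
proof -
  have "(\<integral>\<^sup>+ H. d1_graph_set H P \<partial>measure_pmf (random_graph n p)) = (\<integral>\<^sup>+ H. top \<partial>measure_pmf (random_graph n p))"
  proof (intro nn_integral_cong_AE, subst AE_measure_pmf_iff, intro ballI)
    fix G assume "G \<in> set_pmf (random_graph n p)"
    then have "{H \<in> P. verts H = verts G} = {}" using assms random_graph_support(2) by auto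
    then show "d1_graph_set G P = top" unfolding d1_graph_set_def by (simp only: image_empty Inf_empty)
  qed
  then show ?thesis by simp
qed

text \<open>A crude bound for small n. By invariance under isomorphism, a member of P with n nodes
  has a copy on the nodes of G.\<close>

lemma d1_graph_set_le_1:
  assumes P: "graph_property P" and G: "simple_graph G" "card (verts G) = n" and H: "H \<in> P" "verts H = {1..n}"
  shows "d1_graph_set G P \<le> 1"
proof -
  have finV: "finite (verts G)" using G by (simp add: simple_graph_def)
  obtain \<sigma> where \<sigma>: "bij_betw \<sigma> {1..card (verts G)} (verts G)"
    by (rule sorted_enumeration[OF finV, of "\<lambda>_. 0"])
  let ?G = "relabel \<sigma> G"
  have "simple_graph H" using P H by (auto simp: graph_property_def)
  then have sub: "sym_diff (edges ?G) (edges H) \<subseteq> all_pairs {1..n}"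
    using simple_relabel[of \<sigma> G] verts_relabel[of \<sigma> G] G(2) H(2) by (auto simp: simple_graph_def)
  then have "card (sym_diff (edges ?G) (edges H)) \<le> card (all_pairs {1..n})"
    by (rule card_mono[OF finite_all_pairs[OF finite_atLeastAtMost]])
  also have "\<dots> \<le> n\<^sup>2" by (rule card_all_pairs_le)
  finally have "real (card (sym_diff (edges ?G) (edges H))) \<le> real (n\<^sup>2)" by (rule of_nat_mono)
  then have le: "d1_graph ?G H \<le> 1"
    by (cases "n = 0") (simp_all add: d1_graph_def verts_relabel G(2))
  have "d1_graph_set G P \<le> d1_graph_set ?G P" by (rule d1_graph_set_le_relabel[OF P G(1) \<sigma>])
  also have "\<dots> \<le> ennreal (d1_graph ?G H)"
    unfolding d1_graph_set_def using H by (intro INF_lower) (simp add: verts_relabel G(2))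
  also have "\<dots> \<le> 1" using le by (metis ennreal_1 ennreal_leI)
  finally show ?thesis .
qed

lemma flexible_robust_bound:
  assumes P: "graph_property P" and flex: "flexible_graph_property P" and rob: "robust P"
    and ne: "graph_closure P \<noteq> {}" and p: "0 \<le> p" "p \<le> 1"
    and max: "\<And>q. 0 \<le> q \<Longrightarrow> q \<le> 1 \<Longrightarrow> d1_fun_set (\<lambda>_ _. q) (graph_closure P) \<le> d1_fun_set (\<lambda>_ _. p) (graph_closure P)"
    and \<epsilon>: "\<epsilon> > 0"
  shows "\<exists>N. \<forall>n\<ge>N. \<forall>G. simple_graph G \<longrightarrow> card (verts G) = n \<longrightarrow>
    d1_graph_set G P \<le> (\<integral>\<^sup>+ H. d1_graph_set H P \<partial>measure_pmf (random_graph n p)) + ennreal (6 * \<epsilon>)"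
proof -
  let ?R = "graph_closure P" and ?E = "\<lambda>n. \<integral>\<^sup>+ H. d1_graph_set H P \<partial>measure_pmf (random_graph n p)"
  have R: "graphon_property ?R" "flexible_fun_property ?R"
    using graph_closure_graphon_property flex by (auto simp: flexible_graph_property_def)
  define D where "D = enn2real (d1_fun_set (\<lambda>_ _. p) ?R)"
  have D: "ennreal D = d1_fun_set (\<lambda>_ _. p) ?R" unfolding D_def using d1_fun_set_finite[OF ne] by simp
  have D0: "D \<ge> 0" by (simp add: D_def)
  \<comment> \<open>The infimum in the distance need not be attained, so \<open>U\<close> is optimal
    for q only up to \<epsilon>.\<close>
  have "\<exists>U. U \<in> ?R \<and> (\<lambda>z. U (fst z) (snd z)) \<in> borel_measurable unit_sq \<and> flex_cost U (\<lambda>_ _. q) \<le> D + \<epsilon>"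
    if q: "0 \<le> q" "q \<le> 1" for q
  proof -
    have "d1_fun_set (\<lambda>_ _. q) ?R \<le> ennreal D" using max[OF q] by (simp add: D)
    also have "\<dots> < ennreal (D + \<epsilon>)" using D0 \<epsilon> by (intro ennreal_lessI) auto
    finally obtain V where V: "V \<in> ?R" "ennreal (d1_fun (\<lambda>_ _. q) V) < ennreal (D + \<epsilon>)"
      unfolding d1_fun_set_def by (auto simp: INF_less_iff)
    have V0: "V \<in> W0" using V(1) graph_closure_sub by blast
    obtain U where U: "U \<in> ?R" "(\<lambda>z. U (fst z) (snd z)) \<in> borel_measurable unit_sq"
      "AE z in unit_sq. U (fst z) (snd z) = V (fst z) (snd z)"
      by (rule graphon_property_borel_version[OF R(1) V(1)])
    have U0: "U \<in> W0" using U(1) graph_closure_sub by blast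
    have q0: "(\<lambda>_ _. q) \<in> W0" using q by (intro W0_I) auto
    have "flex_cost U (\<lambda>_ _. q) \<le> d1_fun (\<lambda>_ _. q) U" by (rule flex_cost_const_le_d1[OF U0 U(2) q])
    also have "\<dots> = d1_fun (\<lambda>_ _. q) V"
      by (rule d1_fun_cong_AE[OF q0 q0 U0 V0 AE_I2[OF refl] U(3)])
    also have "\<dots> \<le> D + \<epsilon>"
    proof (rule ccontr)
      assume "\<not> ?thesis"
      then have "ennreal (D + \<epsilon>) \<le> ennreal (d1_fun (\<lambda>_ _. q) V)" by (intro ennreal_leI) simp
      then show False using V(2) by simp
    qed
    finally show ?thesis using U by blast
  qed
  then have "\<forall>q. \<exists>U. 0 \<le> q \<and> q \<le> 1 \<longrightarrow> U \<in> ?R \<and> (\<lambda>z. U (fst z) (snd z)) \<in> borel_measurable unit_sq \<and> flex_cost U (\<lambda>_ _. q) \<le> D + \<epsilon>"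
    by blast
  from choice[OF this] obtain U where U: "\<And>q. 0 \<le> q \<Longrightarrow> q \<le> 1 \<Longrightarrow> U q \<in> ?R"
    "\<And>q. 0 \<le> q \<Longrightarrow> q \<le> 1 \<Longrightarrow> (\<lambda>z. U q (fst z) (snd z)) \<in> borel_measurable unit_sq"
    "\<And>q. 0 \<le> q \<Longrightarrow> q \<le> 1 \<Longrightarrow> flex_cost (U q) (\<lambda>_ _. q) \<le> D + \<epsilon>" by (elim exE) blast
  \<comment> \<open>The size threshold in the upper bound depends on \<open>U\<close>, so only K + 1
    densities are used. For fixed \<open>U\<close> the cost is 1-Lipschitz in the density, so a grid
    of width at most \<epsilon> loses at most \<epsilon>.\<close>
  define K where "K = nat \<lceil>1 / \<epsilon>\<rceil> + 1"
  have K: "K > 0" "1 / real K \<le> \<epsilon>"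
  proof -
    have "1 / \<epsilon> \<le> real K" unfolding K_def by linarith
    moreover show "K > 0" by (simp add: K_def)
    ultimately show "1 / real K \<le> \<epsilon>" using \<epsilon> by (simp add: field_simps)
  qed
  have grid: "0 \<le> real i / real K" "real i / real K \<le> 1" if "i \<le> K" for i using that K by auto
  have "\<forall>i\<in>{..K}. eventually (\<lambda>n. \<forall>G. simple_graph G \<longrightarrow> card (verts G) = n \<longrightarrow>
    d1_graph_set G P \<le> ennreal (flex_cost (U (real i / real K)) (\<lambda>_ _. edge_density G) / 2 + \<epsilon>)) sequentially"
  proof
    fix i assume "i \<in> {..K}"
    then have i: "0 \<le> real i / real K" "real i / real K \<le> 1" using grid by auto
    from robust_flexible_upper[OF P flex rob U(1)[OF i] U(2)[OF i] \<epsilon>]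
    show "eventually (\<lambda>n. \<forall>G. simple_graph G \<longrightarrow> card (verts G) = n \<longrightarrow>
      d1_graph_set G P \<le> ennreal (flex_cost (U (real i / real K)) (\<lambda>_ _. edge_density G) / 2 + \<epsilon>)) sequentially"
      unfolding eventually_sequentially .
  qed
  then have "eventually (\<lambda>n. \<forall>i\<in>{..K}. \<forall>G. simple_graph G \<longrightarrow> card (verts G) = n \<longrightarrow>
    d1_graph_set G P \<le> ennreal (flex_cost (U (real i / real K)) (\<lambda>_ _. edge_density G) / 2 + \<epsilon>)) sequentially"
    by (rule eventually_ball_finite[OF finite_atMost])
  then have upper: "eventually (\<lambda>n. \<forall>G. simple_graph G \<longrightarrow> card (verts G) = n \<longrightarrow> d1_graph_set G P \<le> ennreal (D / 2 + 2 * \<epsilon>)) sequentially"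
  proof (eventually_elim, intro allI impI)
    fix n and G :: graph
    assume all: "\<forall>i\<in>{..K}. \<forall>G. simple_graph G \<longrightarrow> card (verts G) = n \<longrightarrow>
        d1_graph_set G P \<le> ennreal (flex_cost (U (real i / real K)) (\<lambda>_ _. edge_density G) / 2 + \<epsilon>)"
      and G: "simple_graph G" "card (verts G) = n"
    define q where "q = edge_density G"
    have q: "0 \<le> q" "q \<le> 1" unfolding q_def by (rule edge_density_bounds)+
    define i where "i = nat \<lfloor>q * real K\<rfloor>"
    have "0 \<le> q * real K" "q * real K \<le> real K" using q K(1) by (simp_all add: mult_left_le_one_le)
    then have i: "real i \<le> q * real K" "q * real K < real i + 1" "i \<le> K"
      unfolding i_def by linarith+
    have "\<bar>q - real i / real K\<bar> \<le> 1 / real K"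
    proof -
      have "q - real i / real K = (q * real K - real i) / real K" using K(1) by (simp add: field_simps)
      then show ?thesis using i K(1) by (simp add: abs_divide divide_right_mono)
    qed
    then have qi: "\<bar>q - real i / real K\<bar> \<le> \<epsilon>" using K(2) by linarith
    note gi = grid[OF i(3)]
    obtain x y where xy: "0 \<le> x" "x \<le> 1" "0 \<le> y" "y \<le> 1"
      and fc: "\<And>p. flex_cost (U (real i / real K)) (\<lambda>_ _. p) = p * x + (1 - p) * y"
      by (rule flex_cost_const_density[OF U(2)[OF gi]]) (rule that)
    have "flex_cost (U (real i / real K)) (\<lambda>_ _. q) - flex_cost (U (real i / real K)) (\<lambda>_ _. real i / real K) =
      (q - real i / real K) * (x - y)"
    proof -
      have "q * x + (1 - q) * y - (s * x + (1 - s) * y) = (q - s) * (x - y)" for s by (simp add: algebra_simps)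
      then show ?thesis unfolding fc .
    qed
    also have "\<dots> \<le> \<epsilon>"
      using abs_mult_le_left[OF qi, of "x - y"] xy by linarith
    finally have "flex_cost (U (real i / real K)) (\<lambda>_ _. q) \<le> D + 2 * \<epsilon>"
      using U(3)[OF gi] by linarith
    then have "flex_cost (U (real i / real K)) (\<lambda>_ _. q) / 2 + \<epsilon> \<le> D / 2 + 2 * \<epsilon>" by linarith
    then have "ennreal (flex_cost (U (real i / real K)) (\<lambda>_ _. q) / 2 + \<epsilon>) \<le> ennreal (D / 2 + 2 * \<epsilon>)"
      by (rule ennreal_leI)
    moreover have "d1_graph_set G P \<le> ennreal (flex_cost (U (real i / real K)) (\<lambda>_ _. q) / 2 + \<epsilon>)"
      using all G i(3) unfolding q_def by blast
    ultimately show "d1_graph_set G P \<le> ennreal (D / 2 + 2 * \<epsilon>)" by (rule order_trans[rotated])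
  qed
  have "ennreal D \<le> d1_fun_set (\<lambda>_ _. p) ?R" by (simp add: D)
  from quasirandom_lower[OF P flex p this \<epsilon>] obtain \<eta> N1 where \<eta>: "\<eta> > 0" and
    low: "\<And>n G H. n \<ge> N1 \<Longrightarrow> simple_graph G \<Longrightarrow> verts G = {1..n} \<Longrightarrow>
      cut_le {1..n} (\<lambda>i j. adj G i j - p) (\<eta> * (real n)\<^sup>2) \<Longrightarrow> H \<in> P \<Longrightarrow> verts H = {1..n} \<Longrightarrow>
      D / 2 - \<epsilon> \<le> d1_graph G H" by blast
  define good where "good n = {G. cut_le {1..n} (\<lambda>i j. adj G i j - p) (\<eta> * (real n)\<^sup>2)}" for n
  \<comment> \<open>The denominator D + 1 stays positive when D = 0. Graphs that are not quasirandom
    then lower the expectation by at most \<epsilon>.\<close>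
  have "1 - \<epsilon> / (D + 1) < 1" using \<epsilon> D0 by simp
  from order_tendstoD(1)[OF cut_le_random_graph[OF p \<eta>] this]
  have ev_good: "eventually (\<lambda>n. 1 - \<epsilon> / (D + 1) < measure_pmf.prob (random_graph n p) (good n)) sequentially"
    unfolding good_def .
  have lower: "eventually (\<lambda>n. ennreal (D / 2 - 2 * \<epsilon>) \<le> ?E n) sequentially"
    using ev_good eventually_ge_at_top[of N1]
  proof eventually_elim
    case (elim n)
    show ?case
    proof (cases "D / 2 - \<epsilon> \<le> 0")
      case True
      then have "D / 2 - 2 * \<epsilon> \<le> 0" using \<epsilon> by simp
      then show ?thesis by (simp add: ennreal_neg)
    next
      case False
      let ?pr = "measure_pmf.prob (random_graph n p) (good n)"
      have "ennreal (D / 2 - 2 * \<epsilon>) \<le> ennreal ((D / 2 - \<epsilon>) * ?pr)"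
      proof (rule ennreal_leI)
        have "(D / 2 - \<epsilon>) * (1 - ?pr) \<le> (D + 1) * (\<epsilon> / (D + 1))"
          using elim(1) False D0 \<epsilon> by (intro mult_mono) auto
        also have "\<dots> = \<epsilon>" using D0 by simp
        finally show "D / 2 - 2 * \<epsilon> \<le> (D / 2 - \<epsilon>) * ?pr" by (simp add: algebra_simps)
      qed
      also have "\<dots> = (\<integral>\<^sup>+ H. ennreal (D / 2 - \<epsilon>) * indicator (good n) H \<partial>measure_pmf (random_graph n p))"
        using False by (simp add: nn_integral_cmult_indicator measure_pmf.emeasure_eq_measure ennreal_mult)
      also have "\<dots> \<le> ?E n"
      proof (intro nn_integral_mono_AE, subst AE_measure_pmf_iff, intro ballI)
        fix G assume G: "G \<in> set_pmf (random_graph n p)"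
        note Gs = random_graph_support[OF G]
        show "ennreal (D / 2 - \<epsilon>) * indicator (good n) G \<le> d1_graph_set G P"
        proof (cases "G \<in> good n")
          case True
          have "ennreal (D / 2 - \<epsilon>) \<le> d1_graph_set G P"
            unfolding d1_graph_set_def
          proof (rule INF_greatest)
            fix H assume "H \<in> {H \<in> P. verts H = verts G}"
            then have "H \<in> P" "verts H = {1..n}" using Gs by auto
            with low[OF elim(2) Gs] True show "ennreal (D / 2 - \<epsilon>) \<le> ennreal (d1_graph G H)"
              by (intro ennreal_leI) (simp add: good_def)
          qed
          then show ?thesis using True by simp
        qed simp
      qed
      finally show ?thesis .
    qed
  qed
  have "eventually (\<lambda>n. \<forall>G. simple_graph G \<longrightarrow> card (verts G) = n \<longrightarrow>
    d1_graph_set G P \<le> ?E n + ennreal (6 * \<epsilon>)) sequentially"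
    using upper lower
  proof eventually_elim
    case (elim n)
    \<comment> \<open>The two bounds differ by 4\<epsilon>. The cases are distinguished because
      \<open>ennreal\<close> sends negative numbers to 0.\<close>
    have "ennreal (D / 2 + 2 * \<epsilon>) \<le> ?E n + ennreal (6 * \<epsilon>)"
    proof (cases "D / 2 - 2 * \<epsilon> \<ge> 0")
      case True
      have "ennreal (D / 2 + 2 * \<epsilon>) \<le> ennreal ((D / 2 - 2 * \<epsilon>) + 6 * \<epsilon>)" using \<epsilon> by (intro ennreal_leI) simp
      also have "\<dots> = ennreal (D / 2 - 2 * \<epsilon>) + ennreal (6 * \<epsilon>)" using True \<epsilon> by (intro ennreal_plus) auto
      also have "\<dots> \<le> ?E n + ennreal (6 * \<epsilon>)" using elim(2) by (intro add_right_mono)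
      finally show ?thesis .
    next
      case False
      then have "ennreal (D / 2 + 2 * \<epsilon>) \<le> ennreal (6 * \<epsilon>)" using \<epsilon> by (intro ennreal_leI) simp
      also have "\<dots> \<le> ?E n + ennreal (6 * \<epsilon>)" by simp
      finally show ?thesis .
    qed
    with elim(1) show ?case by (blast intro: order_trans)
  qed
  then show ?thesis unfolding eventually_sequentially .
qed

text \<open>Thresholds for all error sizes are merged into one null sequence: the infimum of the
  admissible errors at n, increased by 1/(n+1) so that some admissible error lies below. By the
  first assumption the error 1 is always admissible, which covers the n below a threshold.\<close>

lemma error_term_exists:
  fixes X :: "nat \<Rightarrow> 'a \<Rightarrow> ennreal" and E :: "nat \<Rightarrow> ennreal"
  assumes one: "\<And>n G. S n G \<Longrightarrow> X n G \<le> E n + 1"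
    and small: "\<And>e. e > 0 \<Longrightarrow> \<exists>N. \<forall>n\<ge>N. \<forall>G. S n G \<longrightarrow> X n G \<le> E n + ennreal e"
  shows "\<exists>\<delta> :: nat \<Rightarrow> real. \<delta> \<longlonglongrightarrow> 0 \<and> (\<forall>n G. S n G \<longrightarrow> X n G \<le> E n + ennreal (\<delta> n))"
proof -
  define A where "A n = {e. 0 \<le> e \<and> (\<forall>G. S n G \<longrightarrow> X n G \<le> E n + ennreal e)}" for n
  have A1: "1 \<in> A n" for n using one by (simp add: A_def)
  have bdd: "bdd_below (A n)" for n by (rule bdd_belowI[of _ 0]) (simp add: A_def)
  define \<delta> where "\<delta> n = Inf (A n) + 1 / real (Suc n)" for n
  have Inf0: "0 \<le> Inf (A n)" for n
  proof (rule cInf_greatest)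
    show "A n \<noteq> {}" using A1[of n] by blast
  qed (simp add: A_def)
  have "X n G \<le> E n + ennreal (\<delta> n)" if "S n G" for n G
  proof -
    have "Inf (A n) < \<delta> n" by (simp add: \<delta>_def)
    then obtain e where e: "e \<in> A n" "e < \<delta> n"
      using cInf_lessD[of "A n" "\<delta> n"] A1[of n] by blast
    have "X n G \<le> E n + ennreal e" using e(1) that by (simp add: A_def)
    also have "\<dots> \<le> E n + ennreal (\<delta> n)" using e(2) by (intro add_left_mono ennreal_leI) simp
    finally show ?thesis .
  qed
  moreover have "(\<lambda>n. Inf (A n)) \<longlonglongrightarrow> 0"
  proof (rule LIMSEQ_I)
    fix e :: real assume "e > 0"
    then obtain N where N: "\<And>n G. n \<ge> N \<Longrightarrow> S n G \<Longrightarrow> X n G \<le> E n + ennreal (e / 2)"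
      using small[of "e / 2"] by auto
    have "norm (Inf (A n) - 0) < e" if "n \<ge> N" for n
    proof -
      have "e / 2 \<in> A n" using N[OF that] \<open>e > 0\<close> by (simp add: A_def)
      then have "Inf (A n) \<le> e / 2" by (rule cInf_lower[OF _ bdd])
      then show ?thesis using Inf0[of n] \<open>e > 0\<close> by simp
    qed
    then show "\<exists>N. \<forall>n\<ge>N. norm (Inf (A n) - 0) < e" by blast
  qed
  then have "\<delta> \<longlonglongrightarrow> 0 + 0"
    unfolding \<delta>_def by (intro tendsto_add LIMSEQ_Suc[OF lim_1_over_n])
  ultimately show ?thesis by (intro exI[of _ \<delta>]) simp
qed

theorem theorem3p35:
  shows "(\<forall>R. graphon_property R \<and> flexible_fun_property R \<longrightarrow>
            (\<exists>p::real. (\<lambda>x y. p) \<in> W0 \<and>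
               (\<forall>W\<in>W0. d1_fun_set W R \<le> d1_fun_set (\<lambda>x y. p) R))) \<and>
         (\<forall>P. graph_property P \<and> flexible_graph_property P \<and> robust P \<longrightarrow>
            (\<exists>p::real. 0 \<le> p \<and> p \<le> 1 \<and>
               (\<exists>\<delta>::nat \<Rightarrow> real. \<delta> \<longlonglongrightarrow> 0 \<and>
                  (\<forall>n G. simple_graph G \<and> card (verts G) = n \<longrightarrow>
                     d1_graph_set G P \<le>
                       (\<integral>\<^sup>+ H. d1_graph_set H P \<partial>measure_pmf (random_graph n p)) + ennreal (\<delta> n)))))"
proof (intro conjI allI impI)
  fix R assume R: "graphon_property R \<and> flexible_fun_property R"
  then have sub: "R \<subseteq> W0" by (simp add: graphon_property_def)
  from furthest_constant_exists[OF sub] obtain p where p: "0 \<le> p" "p \<le> 1"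
    "\<And>q. 0 \<le> q \<Longrightarrow> q \<le> 1 \<Longrightarrow> d1_fun_set (\<lambda>_ _. q) R \<le> d1_fun_set (\<lambda>_ _. p) R" by blast
  have "d1_fun_set W R \<le> d1_fun_set (\<lambda>_ _. p) R" if W: "W \<in> W0" for W
  proof -
    obtain q where "0 \<le> q" "q \<le> 1" "d1_fun_set W R \<le> d1_fun_set (\<lambda>_ _. q) R"
      using d1_fun_set_le_const[OF _ _ W] R by blast
    then show ?thesis using p(3) order_trans by blast
  qed
  moreover have "(\<lambda>x y. p) \<in> W0" using p by (intro W0_I) auto
  ultimately show "\<exists>p::real. (\<lambda>x y. p) \<in> W0 \<and> (\<forall>W\<in>W0. d1_fun_set W R \<le> d1_fun_set (\<lambda>x y. p) R)"
    by blast
next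
  fix P assume asm: "graph_property P \<and> flexible_graph_property P \<and> robust P"
  then have P: "graph_property P" "flexible_graph_property P" "robust P" by auto
  from furthest_constant_exists[OF graph_closure_sub[of P]] obtain p where p: "0 \<le> p" "p \<le> 1"
    "\<And>q. 0 \<le> q \<Longrightarrow> q \<le> 1 \<Longrightarrow>
      d1_fun_set (\<lambda>_ _. q) (graph_closure P) \<le> d1_fun_set (\<lambda>_ _. p) (graph_closure P)" by blast
  let ?E = "\<lambda>n. \<integral>\<^sup>+ H. d1_graph_set H P \<partial>measure_pmf (random_graph n p)"
  have "\<exists>\<delta> :: nat \<Rightarrow> real. \<delta> \<longlonglongrightarrow> 0 \<and> (\<forall>n G. (simple_graph G \<and> card (verts G) = n) \<longrightarrow>
    d1_graph_set G P \<le> ?E n + ennreal (\<delta> n))"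
  proof (rule error_term_exists)
    fix n and G :: graph assume G: "simple_graph G \<and> card (verts G) = n"
    show "d1_graph_set G P \<le> ?E n + 1"
    proof (cases "\<exists>H\<in>P. verts H = {1..n}")
      case True
      then obtain H where "H \<in> P" "verts H = {1..n}" by blast
      then have "d1_graph_set G P \<le> 1" using d1_graph_set_le_1[OF P(1)] G by blast
      also have "1 \<le> ?E n + 1" by simp
      finally show ?thesis .
    next
      case False
      then show ?thesis by (simp add: expected_distance_infinite)
    qed
  next
    fix e :: real assume e: "e > 0"
    show "\<exists>N. \<forall>n\<ge>N. \<forall>G. simple_graph G \<and> card (verts G) = n \<longrightarrow> d1_graph_set G P \<le> ?E n + ennreal e"
    proof (cases "graph_closure P = {}")
      case False
      from e have "e / 6 > 0" by simp
      from flexible_robust_bound[OF P False p this] show ?thesis by (simp add: imp_conjL)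
    next
      case True
      \<comment> \<open>Graphs in P of unbounded size would have a limit in the closure by
        compactness. So for large n there is no member of P with n nodes, and the expected distance
        is infinite.\<close>
      have "\<exists>N. \<forall>H\<in>P. card (verts H) \<le> N"
      proof (rule ccontr)
        assume "\<not> ?thesis"
        then have "\<forall>k. \<exists>H. H \<in> P \<and> card (verts H) > k" unfolding not_le[symmetric] by blast
        from choice[OF this] obtain H where H: "\<And>k. H k \<in> P" "\<And>k. card (verts (H k)) > k" by (elim exE) blast
        have "simple_graph (H k)" for k using P(1) H(1) by (auto simp: graph_property_def)
        from graph_closure_limitI[OF H(1) this H(2)] True show False by blast
      qed
      then obtain N where N: "\<And>H. H \<in> P \<Longrightarrow> card (verts H) \<le> N" by blast
      have "?E n = top" if "n > N" for n
      proof (rule expected_distance_infinite)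
        show "\<not> (\<exists>H\<in>P. verts H = {1..n})" using N that by fastforce
      qed
      then show ?thesis by (intro exI[of _ "Suc N"]) simp
    qed
  qed
  then show "\<exists>p::real. 0 \<le> p \<and> p \<le> 1 \<and>
      (\<exists>\<delta>::nat \<Rightarrow> real. \<delta> \<longlonglongrightarrow> 0 \<and>
        (\<forall>n G. simple_graph G \<and> card (verts G) = n \<longrightarrow>
          d1_graph_set G P \<le> (\<integral>\<^sup>+ H. d1_graph_set H P \<partial>measure_pmf (random_graph n p)) + ennreal (\<delta> n)))"
    using p(1,2) by blast
qed

end
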